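(* Consider the reach-avoid game described in the context, with speed ratio $\alpha=v_E/v_P\in(0,1)$. Assume all players have pairwise distinct initial positions, the pursuers' initial positions lie in $\Omega_{\rm play}\cup\mathcal T$, and the evaders' initial positions lie in $\Omega_{\rm play}$. Let the pursuit coalition $k$ consist of two pursuers $P_{i1},P_{i2}$, $\mathcal X_k^0=\{\mathbf x_{P_{i1}}^0,\mathbf x_{P_{i2}}^0\}$. Then its barrier against one evader is as follows. (a) If only one of the two pursuers, $P_i$ ($i=i1$ or $i=i2$), is active in $k$, then $\mathcal B^2(\mathcal X_k^0)=\mathcal B^1(\mathbf x_{P_i}^0)$. (b) If $P_{i1}$ and $P_{i2}$ are both active in $k$, with labels chosen so that $x^0_{P_{i1}}<x^0_{P_{i2}}$, then $$\mathcal B^2(\mathcal X_k^0)=\breve{\mathcal B}^2\cap\Omega_{\rm play},\qquad \breve{\mathcal B}^2=\bigcup_{s=1}^5\breve{\mathcal B}^2_s,\qquad \breve{\mathcal B}^2_s=F^2_s(\mathbf x^0_{P_{i1}},\mathbf x^0_{P_{i2}})\ \ (s=1,\dots,5),$$ where $\breve{\mathcal B}^2$ is the barrier when the boundary of $\Omega_{\rm play}$ is ignored.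
   Context: Domain. $\Omega\subset\mathbb R^2$ is a bounded convex domain. A straight segment $\mathcal T\subset\Omega$ (the target line) with endpoints $\bm m=(0,0)$ and $\bm n=(l,0)$, $l>0$, both on $\partial\Omega$, cuts $\Omega$ into the compact target region $\Omega_{\rm tar}\supset\mathcal T$ (the part in $y\ge 0$) and the play region $\Omega_{\rm play}=\Omega\setminus\Omega_{\rm tar}$ (the part in $y<0$). Players. There are pursuers $P_1,\dots,P_{N_p}$ and evaders $E_1,\dots,E_{N_e}$, which are points moving in $\Omega$ with $\dot{\mathbf x}_{P_i}=v_P\mathbf u_{P_i}$, $\dot{\mathbf x}_{E_j}=v_E\mathbf u_{E_j}$, controls in $\mathcal U=\{\mathbf u\in\mathbb R^2:\|\mathbf u\|_2=1\}$, and initial positions $\mathbf x^0_{P_i}=(x^0_{P_i},y^0_{P_i})$, $\mathbf x^0_{E_j}$; $\alpha=v_E/v_P$. An evader is captured when its position in $\Omega_{\rm play}$ coincides with that of a pursuer; once it enters $\Omega_{\rm tar}$ it can no longer be captured. Information structure: the evader uses state feedback; the pursuit team uses state feedback together with the evader's current input (non-anticipative strategies). Winning regions and barrier. A pursuit coalition $k$ is a nonempty set of $n_k$ pursuers with joint initial position $\mathcal X_k^0$. For a game between coalition $k$ and one evader: $\mathcal W_P^{n_k}(\mathcal X_k^0)\subset\Omega_{\rm play}$ is the set of initial evader positions from which the coalition can guarantee capture before the evader enters $\Omega_{\rm tar}$, whatever the evader does; $\mathcal W_E^{n_k}(\mathcal X_k^0)\subset\Omega_{\rm play}$ is the set of initial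 evader positions from which the evader can guarantee entering $\Omega_{\rm tar}$ without being captured, whatever the coalition does. The barrier $\mathcal B^{n_k}(\mathcal X_k^0)\subset\Omega_{\rm play}$ is the curve separating these two regions, i.e. the set of positions from which neither side can guarantee its own winning (under optimal play capture and arrival at $\mathcal T$ happen simultaneously), with $\mathcal B^{n_k}\cup\mathcal W_P^{n_k}\cup\mathcal W_E^{n_k}=\Omega_{\rm play}$. $\mathcal B^1(\mathbf x_{P_i}^0)$ is the barrier of the coalition $\{P_i\}$. $\breve{\mathcal B}^{n_k}$ denotes the barrier of the same game when the boundary of $\Omega_{\rm play}$ is ignored (players move in $\mathbb R^2$, the evader starts in $\{y<0\}$ and wants to reach $\mathcal T$). Active pursuers. A pursuer $P_i$ of coalition $k$ is active in $k$ if some point of $\mathcal T$ is reached by $P_i$ before all other pursuers of $k$, i.e. there is $\bm p\in\mathcal T$ with $\|\mathbf x^0_{P_i}-\bm p\|_2<\|\mathbf x^0_{P_j}-\bm p\|_2$ for every other $P_j$ in $k$; otherwise it is inactive. Base curves. For $\bm h_1=(x_1,y_1)$, $\bm h_2=(x_2,y_2)$ with $y_1,y_2\le0$, $x_1<x_2$, let $\bm p_c=(x_c,0)$ be the unique point of the $x$-axis with $\|\bm p_c-\bm h_1\|_2=\|\bm p_c-\bm h_2\|_2$, and $k_3=\alpha^2x_1$, $k_4=(1-\alpha^2)x_c+\alpha^2x_1$, $k_5=(1-\alpha^2)x_c+\alpha^2x_2$, $k_6=(1-\alpha^2)l+\alpha^2x_2$. Then (with $\mathbf z=(x,y)\in\mathbb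 R^2$) $$F^2_1(\bm h_1,\bm h_2)=\{\mathbf z:\|\mathbf z-\bm m\|_2=\alpha\|\bm h_1-\bm m\|_2,\ x\le \alpha^2x_1,\ y<0\},$$ $$F^2_2(\bm h_1,\bm h_2)=\{\mathbf z:(x-x_1)^2+(1-1/\alpha^2)y^2+(1-\alpha^2)y_1^2=0,\ x\in(k_3,k_4),\ y<0\},$$ $$F^2_3(\bm h_1,\bm h_2)=\{\mathbf z:\|\mathbf z-\bm p_c\|_2=\alpha\|\bm h_1-\bm p_c\|_2,\ x\in[k_4,k_5],\ y<0\},$$ $$F^2_4(\bm h_1,\bm h_2)=\{\mathbf z:(x-x_2)^2+(1-1/\alpha^2)y^2+(1-\alpha^2)y_2^2=0,\ x\in(k_5,k_6),\ y<0\},$$ $$F^2_5(\bm h_1,\bm h_2)=\{\mathbf z:\|\mathbf z-\bm n\|_2=\alpha\|\bm h_2-\bm n\|_2,\ x\ge (1-\alpha^2)l+\alpha^2x_2,\ y<0\}.$$ *)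

theory Defs
  imports "HOL-Analysis.Analysis"
begin

section \<open>Plays\<close>

type_synonym point = "real ^ 2"
type_synonym control = "real \<Rightarrow> point"

definition controls :: "control set" where
  "controls = {u. u \<in> borel_measurable lebesgue \<and> (\<forall>t. norm (u t) = 1)}"

definition traj :: "real \<Rightarrow> point \<Rightarrow> control \<Rightarrow> real \<Rightarrow> point" where
  "traj v x0 u t = x0 + v *\<^sub>R integral {0..t} u"

text \<open>
  A game is given by an arena \<open>A\<close>, in which all players move, and a target \<open>G\<close>.  Position paths
  are written \<open>e\<close> (evader) and \<open>p i\<close> (pursuers, \<open>i \<in> K\<close>).  The play is in progress at time \<open>t\<close>
  if it has not been decided at any earlier time; simultaneous arrival of the evader and of a
  pursuer in \<open>G\<close> ends the play but is a win for neither side.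
\<close>

definition in_progress ::
  "point set \<Rightarrow> nat set \<Rightarrow> (real \<Rightarrow> point) \<Rightarrow> (nat \<Rightarrow> real \<Rightarrow> point) \<Rightarrow> real \<Rightarrow> bool" where
  "in_progress G K e p t \<longleftrightarrow> (\<forall>s\<in>{0..<t}. e s \<notin> G \<and> (\<forall>i\<in>K. e s \<noteq> p i s))"

definition pursuers_win ::
  "point set \<Rightarrow> point set \<Rightarrow> nat set \<Rightarrow> (real \<Rightarrow> point) \<Rightarrow> (nat \<Rightarrow> real \<Rightarrow> point) \<Rightarrow> bool" where
  "pursuers_win A G K e p \<longleftrightarrow>
     (\<exists>t\<ge>0. e t \<in> A - G \<and> (\<exists>i\<in>K. e t = p i t) \<and> (\<forall>s\<in>{0..t}. e s \<notin> G))"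

definition evader_wins ::
  "point set \<Rightarrow> nat set \<Rightarrow> (real \<Rightarrow> point) \<Rightarrow> (nat \<Rightarrow> real \<Rightarrow> point) \<Rightarrow> bool" where
  "evader_wins G K e p \<longleftrightarrow>
     (\<exists>t\<ge>0. e t \<in> G \<and> (\<forall>s\<in>{0..t}. \<forall>i\<in>K. e s \<noteq> p i s))"

section \<open>Strategies\<close>

text \<open>The evader has to stay in \<open>A\<close> up to the time at which it enters \<open>G\<close>.\<close>

definition evader_controls ::
  "point set \<Rightarrow> point set \<Rightarrow> real \<Rightarrow> point \<Rightarrow> control set" where
  "evader_controls A G vE z =
     {u \<in> controls. \<forall>t\<ge>0. (\<forall>s\<in>{0..<t}. traj vE z u s \<notin> G) \<longrightarrow> traj vE z u t \<in> A}"

text \<open>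
  Non-anticipative (Elliott--Kalton) strategies of the coalition \<open>K\<close> against an evader that starts
  at \<open>z\<close>: the coalition's controls up to time \<open>t\<close> are determined by the evader's control up to
  and including time \<open>t\<close>, and the pursuers stay in \<open>A\<close> as long as the play is in progress.
\<close>

definition pursuit_strategies ::
  "point set \<Rightarrow> point set \<Rightarrow> real \<Rightarrow> real \<Rightarrow> nat set \<Rightarrow> (nat \<Rightarrow> point) \<Rightarrow> point
    \<Rightarrow> (control \<Rightarrow> nat \<Rightarrow> control) set" where
  "pursuit_strategies A G vP vE K xP z =
     {\<gamma>. (\<forall>u\<in>evader_controls A G vE z. \<forall>i\<in>K. \<gamma> u i \<in> controls) \<and>
         (\<forall>u\<in>evader_controls A G vE z. \<forall>w\<in>evader_controls A G vE z. \<forall>t\<ge>0.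
            (AE s in lebesgue. 0 \<le> s \<and> s \<le> t \<longrightarrow> u s = w s) \<longrightarrow>
            (\<forall>i\<in>K. AE s in lebesgue. 0 \<le> s \<and> s \<le> t \<longrightarrow> \<gamma> u i s = \<gamma> w i s)) \<and>
         (\<forall>u\<in>evader_controls A G vE z. \<forall>t\<ge>0.
            in_progress G K (traj vE z u) (\<lambda>i. traj vP (xP i) (\<gamma> u i)) t \<longrightarrow>
            (\<forall>i\<in>K. traj vP (xP i) (\<gamma> u i) t \<in> A))}"

text \<open>
  The evader uses a state feedback law \<open>\<phi>\<close>, a unit vector depending on its own position and on the
  positions of the pursuers in \<open>K\<close>.  A closed-loop control of \<open>\<phi>\<close> against \<open>\<gamma>\<close> is an
  admissible evader control that agrees almost everywhere with \<open>\<phi>\<close> along the resulting play while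
  the play is in progress.
\<close>

definition closed_loop_controls ::
  "point set \<Rightarrow> point set \<Rightarrow> real \<Rightarrow> real \<Rightarrow> nat set \<Rightarrow> (nat \<Rightarrow> point) \<Rightarrow> point
    \<Rightarrow> (point \<Rightarrow> (nat \<Rightarrow> point) \<Rightarrow> point) \<Rightarrow> (control \<Rightarrow> nat \<Rightarrow> control) \<Rightarrow> control set" where
  "closed_loop_controls A G vP vE K xP z \<phi> \<gamma> =
     {u \<in> evader_controls A G vE z.
        AE t in lebesgue.
          0 \<le> t \<and> in_progress G K (traj vE z u) (\<lambda>i. traj vP (xP i) (\<gamma> u i)) t \<longrightarrow>
          u t = \<phi> (traj vE z u t) (\<lambda>i\<in>K. traj vP (xP i) (\<gamma> u i) t)}"

section \<open>Winning regions and barrier\<close>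

text \<open>\<open>S\<close> is the region of initial evader positions under consideration.\<close>

definition pursuit_winning_region ::
  "point set \<Rightarrow> point set \<Rightarrow> point set \<Rightarrow> real \<Rightarrow> real \<Rightarrow> nat set \<Rightarrow> (nat \<Rightarrow> point) \<Rightarrow> point set" where
  "pursuit_winning_region A G S vP vE K xP =
     {z \<in> S. \<exists>\<gamma>\<in>pursuit_strategies A G vP vE K xP z. \<forall>u\<in>evader_controls A G vE z.
        pursuers_win A G K (traj vE z u) (\<lambda>i. traj vP (xP i) (\<gamma> u i))}"

text \<open>
  An arbitrary feedback law need not generate any play; a winning law is therefore required to
  generate at least one play against every pursuit strategy, and to win every play it generates.
\<close>

definition evader_winning_region ::
  "point set \<Rightarrow> point set \<Rightarrow> point set \<Rightarrow> real \<Rightarrow> real \<Rightarrow> nat set \<Rightarrow> (nat \<Rightarrow> point) \<Rightarrow> point set" where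
  "evader_winning_region A G S vP vE K xP =
     {z \<in> S. \<exists>\<phi>. (\<forall>e p. norm (\<phi> e p) = 1) \<and>
        (\<forall>\<gamma>\<in>pursuit_strategies A G vP vE K xP z.
           closed_loop_controls A G vP vE K xP z \<phi> \<gamma> \<noteq> {} \<and>
           (\<forall>u\<in>closed_loop_controls A G vP vE K xP z \<phi> \<gamma>.
              evader_wins G K (traj vE z u) (\<lambda>i. traj vP (xP i) (\<gamma> u i))))}"

definition game_barrier ::
  "point set \<Rightarrow> point set \<Rightarrow> point set \<Rightarrow> real \<Rightarrow> real \<Rightarrow> nat set \<Rightarrow> (nat \<Rightarrow> point) \<Rightarrow> point set" where
  "game_barrier A G S vP vE K xP =
     S - (pursuit_winning_region A G S vP vE K xP \<union> evader_winning_region A G S vP vE K xP)"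

section \<open>The domain\<close>

definition pt_m :: point where
  "pt_m = vector [0, 0]"

definition pt_n :: "real \<Rightarrow> point" where
  "pt_n l = vector [l, 0]"

definition target_line :: "real \<Rightarrow> point set" where
  "target_line l = closed_segment pt_m (pt_n l)"

definition tar_region :: "point set \<Rightarrow> point set" where
  "tar_region \<Omega> = {z \<in> \<Omega>. z $ 2 \<ge> 0}"

definition play_region :: "point set \<Rightarrow> point set" where
  "play_region \<Omega> = \<Omega> - tar_region \<Omega>"

definition barrier :: "point set \<Rightarrow> real \<Rightarrow> real \<Rightarrow> nat set \<Rightarrow> (nat \<Rightarrow> point) \<Rightarrow> point set" where
  "barrier \<Omega> vP vE K xP = game_barrier \<Omega> (tar_region \<Omega>) (play_region \<Omega>) vP vE K xP"

text \<open>
  The same game with the boundary of the play region ignored: all players move in the whole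
  plane, the target is the segment alone, and capture may happen at any point off the segment.
\<close>

definition free_barrier :: "real \<Rightarrow> real \<Rightarrow> real \<Rightarrow> nat set \<Rightarrow> (nat \<Rightarrow> point) \<Rightarrow> point set" where
  "free_barrier l vP vE K xP = game_barrier UNIV (target_line l) {z. z $ 2 < 0} vP vE K xP"

definition active :: "real \<Rightarrow> nat set \<Rightarrow> (nat \<Rightarrow> point) \<Rightarrow> nat \<Rightarrow> bool" where
  "active l K xP i \<longleftrightarrow>
     i \<in> K \<and> (\<exists>q\<in>target_line l. \<forall>j\<in>K - {i}. norm (xP i - q) < norm (xP j - q))"

section \<open>Base curves\<close>

definition x_c :: "point \<Rightarrow> point \<Rightarrow> real" where
  "x_c h1 h2 = (THE c. norm (vector [c, 0] - h1) = norm (vector [c, 0] - h2))"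

definition p_c :: "point \<Rightarrow> point \<Rightarrow> point" where
  "p_c h1 h2 = vector [x_c h1 h2, 0]"

definition k3 :: "real \<Rightarrow> point \<Rightarrow> real" where
  "k3 \<alpha> h1 = \<alpha>\<^sup>2 * h1 $ 1"

definition k4 :: "real \<Rightarrow> point \<Rightarrow> point \<Rightarrow> real" where
  "k4 \<alpha> h1 h2 = (1 - \<alpha>\<^sup>2) * x_c h1 h2 + \<alpha>\<^sup>2 * h1 $ 1"

definition k5 :: "real \<Rightarrow> point \<Rightarrow> point \<Rightarrow> real" where
  "k5 \<alpha> h1 h2 = (1 - \<alpha>\<^sup>2) * x_c h1 h2 + \<alpha>\<^sup>2 * h2 $ 1"

definition k6 :: "real \<Rightarrow> real \<Rightarrow> point \<Rightarrow> real" where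
  "k6 l \<alpha> h2 = (1 - \<alpha>\<^sup>2) * l + \<alpha>\<^sup>2 * h2 $ 1"

definition base_curve :: "real \<Rightarrow> real \<Rightarrow> nat \<Rightarrow> point \<Rightarrow> point \<Rightarrow> point set" where
  "base_curve l \<alpha> s h1 h2 =
    (if s = 1 then
       {z. norm (z - pt_m) = \<alpha> * norm (h1 - pt_m) \<and> z $ 1 \<le> \<alpha>\<^sup>2 * h1 $ 1 \<and> z $ 2 < 0}
     else if s = 2 then
       {z. (z $ 1 - h1 $ 1)\<^sup>2 + (1 - 1 / \<alpha>\<^sup>2) * (z $ 2)\<^sup>2 + (1 - \<alpha>\<^sup>2) * (h1 $ 2)\<^sup>2 = 0 \<and>
           z $ 1 \<in> {k3 \<alpha> h1 <..< k4 \<alpha> h1 h2} \<and> z $ 2 < 0}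
     else if s = 3 then
       {z. norm (z - p_c h1 h2) = \<alpha> * norm (h1 - p_c h1 h2) \<and>
           z $ 1 \<in> {k4 \<alpha> h1 h2 .. k5 \<alpha> h1 h2} \<and> z $ 2 < 0}
     else if s = 4 then
       {z. (z $ 1 - h2 $ 1)\<^sup>2 + (1 - 1 / \<alpha>\<^sup>2) * (z $ 2)\<^sup>2 + (1 - \<alpha>\<^sup>2) * (h2 $ 2)\<^sup>2 = 0 \<and>
           z $ 1 \<in> {k5 \<alpha> h1 h2 <..< k6 l \<alpha> h2} \<and> z $ 2 < 0}
     else if s = 5 then
       {z. norm (z - pt_n l) = \<alpha> * norm (h2 - pt_n l) \<and>
           z $ 1 \<ge> (1 - \<alpha>\<^sup>2) * l + \<alpha>\<^sup>2 * h2 $ 1 \<and> z $ 2 < 0}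
     else {})"

end

theory Submission
  imports Defs
begin

text \<open>
  Write \<open>\<alpha> = vE / vP\<close>.  Against straight motion towards a point \<open>q\<close> of the target line, a pursuer starting
  at \<open>x\<close> is too late iff \<open>|z - q| < \<alpha> |x - q|\<close>.  Conversely, each pursuer guards the part of
  the target line to which it is closest.  If \<open>\<alpha> |x - q| \<le> |z - q|\<close> on a compact convex set \<open>K\<close>, the
  pursuer can preserve this inequality along the play, by running towards the point of \<open>K\<close> nearest to
  the centre of the Apollonius disc, or towards the evader once it is close to that point; the evader then cannot enter \<open>K\<close> before being met.  If the inequality
  is strict, the map sending \<open>z\<close> to \<open>x\<close> and fixing \<open>K\<close> has a Lipschitz extension with constant
  below \<open>1 / \<alpha>\<close>, so its image of the evader is slower than a pursuer; the pursuer moves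
  from this image towards the evader itself, at a gain bounded below in each step, and captures it.
  All pursuers run at full speed along polygons whose vertices depend only on the past, and these stay
  in every convex set containing \<open>K\<close>, \<open>x\<close> and the evader's path, so the boundary of the domain never matters.
  The barrier is therefore the zero set of \<open>min\<^sub>q max\<^sub>i (|z - q| - \<alpha> |x\<^sub>i - q|)\<close>, and on the
  target line the squared versions of these functions are parabolas.
\<close>

section \<open>Trajectories\<close>

text \<open>Committing to a vertex avoids differential equations with discontinuous feedback: the
  control on a segment is a constant chosen at its start, so it is measurable and non-anticipative
  by construction, and each guarantee becomes an inequality about one segment. The price is that
  vertex times may accumulate; every plan must show that this happens only at a capture. Controls
  have norm one, so a pursuer can neither wait nor slow down, and its surplus speed has to be spent
  harmlessly: it is spent on running at the evader. The non-strict inequality can be held without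
  any margin, but holding only denies entry. Capture needs the margin that compactness extracts from
  the strict inequality.\<close>

lemma controls_integrable:
  assumes "u \<in> controls"
  shows "u integrable_on {a..b}"
proof -
  have m: "u \<in> borel_measurable (lebesgue_on {a..b})"
    using assms measurable_restrict_space1[of u lebesgue borel "{a..b}"] unfolding controls_def by blast
  have b: "\<And>t. t \<in> {a..b} \<Longrightarrow> norm (u t) \<le> 1"
    using assms unfolding controls_def by simp
  have i: "(\<lambda>_. 1 :: real) integrable_on {a..b}"
    by (rule integrable_const_ivl)
  show ?thesis
    by (rule measurable_bounded_by_integrable_imp_integrable[OF m i b]) simp_all
qed

lemma traj_0 [simp]: "traj v x u 0 = x"
  by (simp add: traj_def)

lemma traj_add:
  assumes "u \<in> controls" "0 \<le> s" "s \<le> t"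
  shows "traj v x u t = traj v x u s + v *\<^sub>R integral {s..t} u"
proof -
  have "integral {0..s} u + integral {s..t} u = integral {0..t} u"
    using assms by (intro Henstock_Kurzweil_Integration.integral_combine controls_integrable) auto
  then show ?thesis
    unfolding traj_def by (metis add.assoc scaleR_right_distrib)
qed

lemma traj_dist:
  assumes "u \<in> controls" "0 \<le> s" "s \<le> t" "0 \<le> v"
  shows "dist (traj v x u s) (traj v x u t) \<le> v * (t - s)"
proof -
  have "norm (integral {s..t} u) \<le> integral {s..t} (\<lambda>_. 1::real)"
    using assms by (intro integral_norm_bound_integral controls_integrable) (auto simp: controls_def)
  also have "\<dots> = t - s" using assms by simp
  finally show ?thesis
    using assms by (simp add: dist_norm norm_minus_commute traj_add[of u s t] mult_left_mono)
qed

lemma traj_lipschitz: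
  assumes "u \<in> controls" "0 \<le> v"
  shows "v-lipschitz_on {0..} (traj v x u)"
proof (rule lipschitz_onI)
  fix s t :: real assume "s \<in> {0..}" "t \<in> {0..}"
  then show "dist (traj v x u s) (traj v x u t) \<le> v * dist s t"
    using traj_dist[OF assms(1) _ _ assms(2), of s t x] traj_dist[OF assms(1) _ _ assms(2), of t s x]
    by (cases s t rule: le_cases) (auto simp: dist_real_def dist_commute)
qed (use assms in auto)

text \<open>Plans read positions, while non-anticipation is stated for controls up to null sets;
  integration makes the two compatible.\<close>

lemma traj_cong_AE:
  assumes "AE r in lebesgue. 0 \<le> r \<and> r \<le> t \<longrightarrow> u r = w r" "s \<le> t"
  shows "traj v x u s = traj v x w s"
proof -
  obtain N where N: "negligible N" "{r. \<not> (0 \<le> r \<and> r \<le> t \<longrightarrow> u r = w r)} \<subseteq> N"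
    using assms(1) by (auto simp: eventually_ae_filter_negligible)
  have "integral {0..s} u = integral {0..s} w"
    using N assms(2) by (intro integral_spike[of N]) auto
  then show ?thesis by (simp add: traj_def)
qed

lemma traj_const: "0 \<le> t \<Longrightarrow> traj v x (\<lambda>_. d) t = x + (v * t) *\<^sub>R d"
  by (simp add: traj_def)

lemma traj_eq_const_AE:
  assumes "AE r in lebesgue. 0 \<le> r \<and> r \<le> t \<longrightarrow> u r = d" "0 \<le> s" "s \<le> t"
  shows "traj v x u s = x + (v * s) *\<^sub>R d"
  using traj_cong_AE[of t u "\<lambda>_. d", OF assms(1) assms(3)] traj_const[OF assms(2)] by simp

text \<open>The default \<open>axis 1 1\<close> serves times outside all segments, where a control
  must still be a unit vector. With the timing assumed in the next context, coinciding consecutive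
  vertices have an empty time interval, so \<open>sgn 0\<close> never occurs.\<close>

definition polyline :: "(nat \<Rightarrow> real) \<Rightarrow> (nat \<Rightarrow> point) \<Rightarrow> control" where
  "polyline T P t =
     (if \<exists>k. T k \<le> t \<and> t < T (Suc k)
      then sgn (P (Suc (LEAST k. T k \<le> t \<and> t < T (Suc k))) - P (LEAST k. T k \<le> t \<and> t < T (Suc k)))
      else axis 1 1)"

context
  fixes T :: "nat \<Rightarrow> real" and P :: "nat \<Rightarrow> point" and v :: real
  assumes T0: "T 0 = 0" and TS: "\<And>k. T (Suc k) = T k + dist (P k) (P (Suc k)) / v" and v: "v > 0"
begin

lemma polyline_time_mono: "j \<le> k \<Longrightarrow> T j \<le> T k"
  by (rule lift_Suc_mono_le[of T]) (use TS v in auto)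

lemma polyline_time_nonneg: "0 \<le> T k"
  using polyline_time_mono[of 0 k] T0 by simp

lemma polyline_eq:
  assumes "T k \<le> t" "t < T (Suc k)"
  shows "polyline T P t = sgn (P (Suc k) - P k)"
proof -
  have "(LEAST k. T k \<le> t \<and> t < T (Suc k)) = k"
  proof (rule Least_equality)
    fix j assume j: "T j \<le> t \<and> t < T (Suc j)"
    show "k \<le> j"
      using j assms polyline_time_mono[of "Suc j" k] by (cases "Suc j \<le> k") auto
  qed (use assms in auto)
  moreover have "\<exists>k. T k \<le> t \<and> t < T (Suc k)" using assms by blast
  ultimately show ?thesis by (simp add: polyline_def)
qed

lemma polyline_controls: "polyline T P \<in> controls"
proof -
  have norm: "norm (polyline T P t) = 1" for t
  proof (cases "\<exists>k. T k \<le> t \<and> t < T (Suc k)")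
    case True
    then obtain k where k: "T k \<le> t" "t < T (Suc k)" by blast
    then have "P (Suc k) \<noteq> P k" using TS[of k] by auto
    then show ?thesis using polyline_eq[OF k] by (simp add: norm_sgn)
  next
    case False
    then show ?thesis by (simp only: polyline_def if_False) simp
  qed
  \<comment> \<open>The control is constant on each of the countably many segments and on their
    complement, so measurability is checked piece by piece.\<close>
  let ?C = "insert (- (\<Union>k. {T k..<T (Suc k)})) (range (\<lambda>k. {T k..<T (Suc k)}))"
  have "polyline T P \<in> borel_measurable borel"
  proof (rule measurable_piecewise_restrict[of ?C])
    show "countable ?C" by simp
    show "space borel \<subseteq> \<Union>?C" by (simp only: Union_insert) (use Compl_partition2 in blast)
  next
    fix \<Omega> assume \<Omega>: "\<Omega> \<in> ?C"
    then show "\<Omega> \<inter> space borel \<in> sets borel"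
      by (elim insertE imageE) simp_all
    have "\<exists>c. \<forall>t\<in>\<Omega>. polyline T P t = c"
    proof (cases "\<Omega> = - (\<Union>k. {T k..<T (Suc k)})")
      case True
      have "\<forall>t\<in>- (\<Union>k. {T k..<T (Suc k)}). polyline T P t = axis 1 1"
        unfolding polyline_def by force
      then show ?thesis unfolding True by (rule exI)
    next
      case False
      then obtain k where k: "\<Omega> = {T k..<T (Suc k)}" using \<Omega> by auto
      have "\<forall>t\<in>{T k..<T (Suc k)}. polyline T P t = sgn (P (Suc k) - P k)"
        by (simp add: polyline_eq)
      then show ?thesis unfolding k by (rule exI)
    qed
    then obtain c where c: "\<forall>t\<in>\<Omega>. polyline T P t = c" by (rule exE)
    show "polyline T P \<in> borel_measurable (restrict_space borel \<Omega>)"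
    proof (subst measurable_cong)
      show "polyline T P t = c" if "t \<in> space (restrict_space borel \<Omega>)" for t
        using c that by (simp add: space_restrict_space)
    qed simp
  qed
  then have "polyline T P \<in> borel_measurable lebesgue"
    by (simp add: measurable_completion)
  with norm show ?thesis by (simp add: controls_def)
qed

lemma traj_polyline_step:
  assumes "traj v x (polyline T P) (T k) = P k" "T k \<le> t" "t \<le> T (Suc k)"
  shows "traj v x (polyline T P) t = P k + (v * (t - T k)) *\<^sub>R sgn (P (Suc k) - P k)"
proof -
  \<comment> \<open>At \<open>t = T (Suc k)\<close> the control may already belong to a later
    segment, hence the exceptional point \<open>t\<close>.\<close>
  have "integral {T k..t} (polyline T P) = integral {T k..t} (\<lambda>_. sgn (P (Suc k) - P k))"
    using assms polyline_eq[of k] by (intro integral_spike[of "{t}"]) auto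
  then show ?thesis
    using traj_add[OF polyline_controls polyline_time_nonneg assms(2)] assms by simp
qed

lemma traj_polyline_node:
  assumes "x = P 0"
  shows "traj v x (polyline T P) (T k) = P k"
proof (induction k)
  case (Suc k)
  have "v * (T (Suc k) - T k) = norm (P (Suc k) - P k)"
    using TS[of k] v by (simp add: dist_norm norm_minus_commute)
  moreover have "norm y *\<^sub>R sgn y = y" for y :: point
    by (cases "y = 0") (simp_all add: sgn_div_norm)
  ultimately show ?case
    using traj_polyline_step[OF Suc, of "T (Suc k)"] polyline_time_mono[of k "Suc k"]
    by simp
qed (use T0 assms in simp)

text \<open>\<open>\<sigma>\<close> is the fraction of the segment covered so far. The last equation
  turns elapsed time into this fraction, so that the evader's displacement can be compared with the
  segment in the middle of a step.\<close>

lemma traj_polyline: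
  assumes "T k \<le> t" "t \<le> T (Suc k)" "x = P 0"
  obtains \<sigma> where "0 \<le> \<sigma>" "\<sigma> \<le> 1"
    "traj v x (polyline T P) t = P k + \<sigma> *\<^sub>R (P (Suc k) - P k)"
    "v * (t - T k) = \<sigma> * dist (P k) (P (Suc k))"
proof (cases "P (Suc k) = P k")
  case True
  then have "t = T k" using assms TS[of k] by simp
  then show thesis using that[of 0] traj_polyline_node[OF assms(3), of k] by simp
next
  case False
  define D where "D = norm (P (Suc k) - P k)"
  have D: "D > 0" "dist (P k) (P (Suc k)) = D"
    using False by (auto simp: D_def dist_norm norm_minus_commute)
  have le: "v * (t - T k) \<le> D"
    using assms(2) TS[of k] D v by (simp add: field_simps)
  show thesis
  proof (rule that[of "v * (t - T k) / D"])
    show "traj v x (polyline T P) t = P k + (v * (t - T k) / D) *\<^sub>R (P (Suc k) - P k)"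
      using traj_polyline_step[OF traj_polyline_node[OF assms(3)] assms(1,2)]
      by (simp add: sgn_div_norm D_def divide_inverse)
  qed (use D le assms(1) v in simp_all)
qed

text \<open>Vertex times need not tend to infinity: segments can shrink so fast that the times stay
  bounded. The case \<open>limit\<close> is this Zeno behaviour, and later uses have to identify it
  with a capture.\<close>

lemma polyline_time_cases:
  assumes "0 \<le> t"
  obtains (step) k where "T k \<le> t" "t < T (Suc k)" | (limit) "\<And>k. T k \<le> t"
proof (cases "\<forall>k. T k \<le> t")
  case False
  then obtain m where "t < T m" by (auto simp: not_le)
  define k where "k = (LEAST k. t < T k)"
  have k: "t < T k" unfolding k_def by (rule LeastI[of _ m]) fact
  then obtain j where j: "k = Suc j" using T0 assms by (cases k) auto
  have "\<not> t < T j" using not_less_Least[of j "\<lambda>k. t < T k"] j k_def by auto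
  then show thesis using step[of j] k j by auto
qed (use limit in blast)

end

section \<open>Pursuit along vertices chosen one at a time\<close>

section \<open>Waypoint strategies\<close>

lemma lipschitz_on_tendsto:
  fixes f :: "real \<Rightarrow> point"
  assumes "C-lipschitz_on {0..} f" "X \<longlonglongrightarrow> s" "\<And>k. 0 \<le> X k"
  shows "(\<lambda>k. f (X k)) \<longlonglongrightarrow> f s"
proof -
  have "0 \<le> s" using assms(3) by (intro LIMSEQ_le_const[OF assms(2)]) auto
  then show ?thesis
    using continuous_on_tendsto_compose[OF lipschitz_on_continuous_on[OF assms(1)] assms(2)] assms(3)
    by simp
qed

text \<open>The evader is sampled only on arrival at a vertex, and the next vertex is fixed from
  this sample, so the control never looks ahead. The component of type \<open>'a\<close> is the
  plan's memory: trivial for holding, a mixing weight for capture.\<close>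

primrec waypoint ::
  "real \<Rightarrow> (point \<Rightarrow> point \<times> 'a \<Rightarrow> point \<times> 'a) \<Rightarrow> point \<times> 'a \<Rightarrow> (real \<Rightarrow> point) \<Rightarrow> nat
    \<Rightarrow> real \<times> point \<times> 'a" where
  "waypoint v f s0 e 0 = (0, s0)"
| "waypoint v f s0 e (Suc k) =
     (let (t, s) = waypoint v f s0 e k; s' = f (e t) s in (t + dist (fst s) (fst s') / v, s'))"

definition wtime where "wtime v f s0 e k = fst (waypoint v f s0 e k)"
definition wpos where "wpos v f s0 e k = fst (snd (waypoint v f s0 e k))"
definition waux where "waux v f s0 e k = snd (snd (waypoint v f s0 e k))"

lemma wtime_0 [simp]: "wtime v f s0 e 0 = 0"
  and wpos_0 [simp]: "wpos v f s0 e 0 = fst s0"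
  and waux_0 [simp]: "waux v f s0 e 0 = snd s0"
  by (simp_all add: wtime_def wpos_def waux_def)

lemma wtime_Suc: "wtime v f s0 e (Suc k) = wtime v f s0 e k + dist (wpos v f s0 e k) (wpos v f s0 e (Suc k)) / v"
  by (simp add: wtime_def wpos_def Let_def split_beta)

lemma wstate_Suc:
  "(wpos v f s0 e (Suc k), waux v f s0 e (Suc k)) = f (e (wtime v f s0 e k)) (wpos v f s0 e k, waux v f s0 e k)"
  by (simp add: wtime_def wpos_def waux_def Let_def split_beta)

text \<open>Vertex \<open>Suc k\<close> is decided on arrival at vertex \<open>k\<close>, so
  agreement of the paths up to that arrival fixes one vertex more than has been reached.\<close>

lemma waypoint_cong:
  assumes "\<And>s. s \<in> {0..t} \<Longrightarrow> e s = e' s" "v > 0" "wtime v f s0 e k \<le> t"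
  shows "waypoint v f s0 e' (Suc k) = waypoint v f s0 e (Suc k)"
  using assms(3)
proof (induction k)
  case 0
  then show ?case using assms(1)[of 0] by simp
next
  case (Suc k)
  note nonneg = polyline_time_nonneg[of "wtime v f s0 e" "wpos v f s0 e" v, OF wtime_0 wtime_Suc assms(2)]
  note mono = polyline_time_mono[of "wtime v f s0 e" "wpos v f s0 e" v, OF wtime_0 wtime_Suc assms(2)]
  have "wtime v f s0 e k \<le> t" using mono[of k "Suc k"] Suc.prems by simp
  then have IH: "waypoint v f s0 e' (Suc k) = waypoint v f s0 e (Suc k)" by (rule Suc.IH)
  have "e (wtime v f s0 e (Suc k)) = e' (wtime v f s0 e (Suc k))"
    using assms(1) nonneg Suc.prems by simp
  then show ?case
    unfolding waypoint.simps(2)[of v f s0 _ "Suc k"] IH wtime_def by (simp only: Let_def split_beta)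
qed

definition waypoint_control ::
  "real \<Rightarrow> (point \<Rightarrow> point \<times> 'a \<Rightarrow> point \<times> 'a) \<Rightarrow> point \<times> 'a \<Rightarrow> (real \<Rightarrow> point) \<Rightarrow> control" where
  "waypoint_control v f s0 e = polyline (wtime v f s0 e) (wpos v f s0 e)"

lemma waypoint_control_controls: "v > 0 \<Longrightarrow> waypoint_control v f s0 e \<in> controls"
  unfolding waypoint_control_def by (rule polyline_controls[of _ _ v]) (simp_all add: wtime_Suc)

lemma waypoint_control_cong:
  assumes eq: "\<forall>s\<in>{0..t}. e s = e' s" and v: "v > 0" and s: "s \<in> {0..t}"
  shows "waypoint_control v f s0 e s = waypoint_control v f s0 e' s"
proof -
  have step: "polyline (wtime v f s0 e2) (wpos v f s0 e2) s =
        sgn (wpos v f s0 e1 (Suc k) - wpos v f s0 e1 k) \<and>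
      wtime v f s0 e2 k \<le> s \<and> s < wtime v f s0 e2 (Suc k)"
    if eq: "\<forall>s\<in>{0..t}. e1 s = e2 s" and k: "wtime v f s0 e1 k \<le> s" "s < wtime v f s0 e1 (Suc k)"
    for e1 e2 k
  proof -
    have "wtime v f s0 e1 j \<le> t \<Longrightarrow> waypoint v f s0 e2 (Suc j) = waypoint v f s0 e1 (Suc j)" for j
      by (rule waypoint_cong[of t]) (use eq v in auto)
    moreover have "wtime v f s0 e1 j \<le> t" if "j \<le> k" for j
      using polyline_time_mono[of "wtime v f s0 e1" "wpos v f s0 e1" v j k, OF wtime_0 wtime_Suc v that] k s by simp
    ultimately have "waypoint v f s0 e2 (Suc k) = waypoint v f s0 e1 (Suc k)"
        "waypoint v f s0 e2 k = waypoint v f s0 e1 k"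
      by (blast, cases k) (simp_all del: waypoint.simps(2))
    then have e: "wtime v f s0 e2 k = wtime v f s0 e1 k" "wpos v f s0 e2 k = wpos v f s0 e1 k"
        "wtime v f s0 e2 (Suc k) = wtime v f s0 e1 (Suc k)" "wpos v f s0 e2 (Suc k) = wpos v f s0 e1 (Suc k)"
      by (simp_all only: wtime_def wpos_def)
    show ?thesis
      using polyline_eq[of "wtime v f s0 e2" "wpos v f s0 e2" v k s, OF wtime_0 wtime_Suc v] k
      unfolding e by simp
  qed
  have eq': "\<forall>s\<in>{0..t}. e' s = e s" using eq by simp
  show ?thesis
  proof (cases "\<exists>k. wtime v f s0 e k \<le> s \<and> s < wtime v f s0 e (Suc k)")
    case True
    then obtain k where k: "wtime v f s0 e k \<le> s" "s < wtime v f s0 e (Suc k)" by blast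
    then show ?thesis
      unfolding waypoint_control_def using step[OF eq k] step[OF _ k, of e] by simp
  next
    case False
    \<comment> \<open>By symmetry a segment running for \<open>e'\<close> would also run for
      \<open>e\<close>; with none running, both controls take the default direction.\<close>
    then have False': "\<not> (\<exists>k. wtime v f s0 e' k \<le> s \<and> s < wtime v f s0 e' (Suc k))"
      using step[OF eq'] by blast
    show ?thesis
      unfolding waypoint_control_def polyline_def by (simp only: False False' if_False)
  qed
qed

text \<open>The pursuer's position is constrained only as long as it has not met the evader.\<close>

definition pursuit_plan ::
  "real \<Rightarrow> real \<Rightarrow> point \<Rightarrow> point \<Rightarrow> point set \<Rightarrow> ((real \<Rightarrow> point) \<Rightarrow> control) \<Rightarrow> bool" where
  "pursuit_plan vE vP z x K \<Gamma> \<longleftrightarrow>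
     (\<forall>e. e 0 = z \<and> vE-lipschitz_on {0..} e \<longrightarrow>
        \<Gamma> e \<in> controls \<and>
        (\<forall>A t. convex A \<and> K \<subseteq> A \<and> x \<in> A \<and> 0 \<le> t \<and> (\<forall>s\<in>{0..t}. e s \<in> A) \<and>
               (\<forall>s\<in>{0..<t}. e s \<noteq> traj vP x (\<Gamma> e) s) \<longrightarrow> traj vP x (\<Gamma> e) t \<in> A)) \<and>
     (\<forall>e e' t. (\<forall>s\<in>{0..t}. e s = e' s) \<longrightarrow> (\<forall>s\<in>{0..t}. \<Gamma> e s = \<Gamma> e' s))"

text \<open>Bounded increasing vertex times converge, and both paths are Lipschitz, so the vanishing
  distance at the vertices becomes a meeting at the limit time.\<close>

lemma waypoint_capture:
  assumes "vP > 0" "vE-lipschitz_on {0..} e" and "\<And>k. wtime vP f s0 e k \<le> t"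
    and "(\<lambda>k. dist (e (wtime vP f s0 e k)) (wpos vP f s0 e k)) \<longlonglongrightarrow> 0"
  obtains s where "0 \<le> s" "s \<le> t" "\<And>k. wtime vP f s0 e k \<le> s" "wtime vP f s0 e \<longlonglongrightarrow> s"
    "e s = traj vP (fst s0) (waypoint_control vP f s0 e) s"
proof -
  let ?T = "wtime vP f s0 e" and ?P = "wpos vP f s0 e"
  note T = wtime_0 wtime_Suc assms(1)
  have "incseq ?T" using polyline_time_mono[of ?T ?P vP, OF T] by (auto simp: incseq_def)
  then obtain s where s: "?T \<longlonglongrightarrow> s" "\<And>k. ?T k \<le> s"
    using incseq_convergent[of ?T t] assms(3) by blast
  have nn: "0 \<le> ?T k" for k by (rule polyline_time_nonneg[of ?T ?P vP, OF T])
  have "(\<lambda>k. traj vP (fst s0) (waypoint_control vP f s0 e) (?T k)) \<longlonglongrightarrow> traj vP (fst s0) (waypoint_control vP f s0 e) s"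
    by (intro lipschitz_on_tendsto[OF traj_lipschitz s(1) nn] waypoint_control_controls)
       (use assms(1) in auto)
  moreover have "traj vP (fst s0) (waypoint_control vP f s0 e) (?T k) = ?P k" for k
    unfolding waypoint_control_def by (rule traj_polyline_node[OF T]) simp
  ultimately have "?P \<longlonglongrightarrow> traj vP (fst s0) (waypoint_control vP f s0 e) s" by simp
  moreover have "(\<lambda>k. e (?T k)) \<longlonglongrightarrow> e s"
    by (rule lipschitz_on_tendsto[OF assms(2) s(1) nn])
  ultimately have "(\<lambda>k. dist (e (?T k)) (?P k)) \<longlonglongrightarrow> dist (e s) (traj vP (fst s0) (waypoint_control vP f s0 e) s)"
    by (intro tendsto_dist)
  then have "dist (e s) (traj vP (fst s0) (waypoint_control vP f s0 e) s) = 0"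
    using assms(4) LIMSEQ_unique by blast
  moreover have "s \<le> t" using assms(3) by (intro LIMSEQ_le_const2[OF s(1)]) auto
  ultimately show thesis using that[of s] s nn[of 0] s(2)[of 0] by simp
qed

text \<open>These are the two duties of a step rule. Vertices in the hull keep the polygon in any
  admissible convex set, by induction. Vanishing distance settles the times after an accumulation,
  where the polygon prescribes nothing: by then the evader has been met.\<close>

lemma waypoint_plan:
  fixes f :: "point \<Rightarrow> point \<times> 'a \<Rightarrow> point \<times> 'a"
  assumes vP: "vP > 0" and x: "fst s0 = x"
    and hull: "\<And>e k. e 0 = z \<Longrightarrow> vE-lipschitz_on {0..} e \<Longrightarrow>
       wpos vP f s0 e (Suc k) \<in>
         convex hull (insert (e (wtime vP f s0 e k)) (insert (wpos vP f s0 e k) (insert x K)))"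
    and zeno: "\<And>e t. e 0 = z \<Longrightarrow> vE-lipschitz_on {0..} e \<Longrightarrow> (\<And>k. wtime vP f s0 e k \<le> t) \<Longrightarrow>
       (\<lambda>k. dist (e (wtime vP f s0 e k)) (wpos vP f s0 e k)) \<longlonglongrightarrow> 0"
  shows "pursuit_plan vE vP z x K (waypoint_control vP f s0)"
  unfolding pursuit_plan_def
proof (intro conjI allI impI ballI; (elim conjE)?)
  fix e e' :: "real \<Rightarrow> point" and s t :: real
  assume "\<forall>s\<in>{0..t}. e s = e' s" "s \<in> {0..t}"
  then show "waypoint_control vP f s0 e s = waypoint_control vP f s0 e' s"
    by (intro waypoint_control_cong[OF _ vP, of t]) auto
next
  show "waypoint_control vP f s0 e \<in> controls" for e by (rule waypoint_control_controls[OF vP])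
next
  fix e :: "real \<Rightarrow> point" and A t
  assume e: "e 0 = z" "vE-lipschitz_on {0..} e" and A: "convex A" "K \<subseteq> A" "x \<in> A" "\<forall>s\<in>{0..t}. e s \<in> A"
    and t: "0 \<le> t" and free: "\<forall>s\<in>{0..<t}. e s \<noteq> traj vP x (waypoint_control vP f s0 e) s"
  let ?T = "wtime vP f s0 e" and ?P = "wpos vP f s0 e"
  note T = wtime_0 wtime_Suc vP
  have mono: "j \<le> k \<Longrightarrow> ?T j \<le> ?T k" for j k by (rule polyline_time_mono[of ?T ?P vP, OF T])
  have nn: "0 \<le> ?T k" for k by (rule polyline_time_nonneg[of ?T ?P vP, OF T])
  have P: "?T k \<le> t \<Longrightarrow> ?P k \<in> A \<and> ?P (Suc k) \<in> A" for k
  proof (induction k)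
    case (0)
    have "insert (e (?T 0)) (insert (?P 0) (insert x K)) \<subseteq> A" using A x t by auto
    then have "convex hull (insert (e (?T 0)) (insert (?P 0) (insert x K))) \<subseteq> A"
      using A(1) by (rule hull_minimal)
    then show ?case using hull[OF e, of 0] A(3) x by auto
  next
    case (Suc k)
    have Pk: "?P (Suc k) \<in> A" using Suc mono[of k "Suc k"] by simp
    then have "insert (e (?T (Suc k))) (insert (?P (Suc k)) (insert x K)) \<subseteq> A"
      using A Suc.prems nn by auto
    then have "convex hull (insert (e (?T (Suc k))) (insert (?P (Suc k)) (insert x K))) \<subseteq> A"
      using A(1) by (rule hull_minimal)
    then show ?case using hull[OF e, of "Suc k"] Pk by auto
  qed
  show "traj vP x (waypoint_control vP f s0 e) t \<in> A"
  proof (rule polyline_time_cases[of ?T ?P vP t, OF T t])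
    fix k assume k: "?T k \<le> t" "t < ?T (Suc k)"
    obtain \<sigma> where \<sigma>: "0 \<le> \<sigma>" "\<sigma> \<le> 1"
      "traj vP x (waypoint_control vP f s0 e) t = ?P k + \<sigma> *\<^sub>R (?P (Suc k) - ?P k)"
      using traj_polyline[of ?T ?P vP k t x, OF T] k x unfolding waypoint_control_def by auto
    have "(1 - \<sigma>) *\<^sub>R ?P k + \<sigma> *\<^sub>R ?P (Suc k) \<in> A"
      using P[OF k(1)] A(1) \<sigma> by (simp add: convexD_alt)
    moreover have "(1 - \<sigma>) *\<^sub>R ?P k + \<sigma> *\<^sub>R ?P (Suc k) = traj vP x (waypoint_control vP f s0 e) t"
      unfolding \<sigma>(3) by (simp add: algebra_simps)
    ultimately show ?thesis by simp
  next
    assume lim: "\<And>k. ?T k \<le> t"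
    obtain s where s: "0 \<le> s" "s \<le> t" "e s = traj vP x (waypoint_control vP f s0 e) s"
      using waypoint_capture[OF vP e(2) lim zeno[OF e lim]] x by metis
    then have "s = t" using free by force
    then show ?thesis using s A(4) by force
  qed
qed

section \<open>The non-strict inequality: denying entry to a compact convex set\<close>

section \<open>Holding a target set\<close>

text \<open>The argument of \<open>closest_point\<close> is the centre of the Apollonius disc of \<open>y\<close> and \<open>p\<close>.\<close>

definition aim_point :: "real \<Rightarrow> point set \<Rightarrow> point \<Rightarrow> point \<Rightarrow> point" where
  "aim_point \<alpha> K y p = closest_point K ((1 / (1 - \<alpha>\<^sup>2)) *\<^sub>R (y - \<alpha>\<^sup>2 *\<^sub>R p))"

text \<open>As a function of \<open>q\<close>, the right-hand side is a quadratic with leading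
  coefficient \<open>1 - \<alpha>\<^sup>2\<close> and its minimum at the Apollonius centre. Over
  \<open>K\<close> it is least at the point nearest to the centre; strong convexity and the obtuse
  angle at a projection give quadratic growth away from that point.\<close>

lemma apollonius_growth:
  fixes y p q :: point
  assumes \<alpha>: "0 < \<alpha>" "\<alpha> < 1" and K: "closed K" "convex K" "q \<in> K"
  defines "q0 \<equiv> aim_point \<alpha> K y p"
  shows "(norm (y - q0))\<^sup>2 - \<alpha>\<^sup>2 * (norm (p - q0))\<^sup>2 + (1 - \<alpha>\<^sup>2) * (norm (q - q0))\<^sup>2
    \<le> (norm (y - q))\<^sup>2 - \<alpha>\<^sup>2 * (norm (p - q))\<^sup>2"
proof -
  have \<alpha>2: "1 - \<alpha>\<^sup>2 > 0" using \<alpha> by (simp add: power_less_one_iff)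
  define A B v where "A = y - q0" and "B = p - q0" and "v = q - q0"
  define c where "c = (1 / (1 - \<alpha>\<^sup>2)) *\<^sub>R (y - \<alpha>\<^sup>2 *\<^sub>R p)"
  have "(c - q0) \<bullet> v \<le> 0"
    using closest_point_dot[OF K(2,1,3), of c] by (simp add: q0_def aim_point_def c_def v_def)
  moreover have "(1 - \<alpha>\<^sup>2) *\<^sub>R (c - q0) = A - \<alpha>\<^sup>2 *\<^sub>R B"
  proof -
    have "(1 - \<alpha>\<^sup>2) *\<^sub>R c = y - \<alpha>\<^sup>2 *\<^sub>R p" using \<alpha>2 by (simp add: c_def)
    then show ?thesis
      by (simp add: scaleR_diff_right[of "1 - \<alpha>\<^sup>2" c]) (simp add: A_def B_def algebra_simps)
  qed
  ultimately have dot: "(A - \<alpha>\<^sup>2 *\<^sub>R B) \<bullet> v \<le> 0"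
    using \<alpha>2 by (metis inner_scaleR_left mult_nonneg_nonpos less_imp_le)
  have e: "y - q = A - v" "p - q = B - v" by (simp_all add: A_def B_def v_def)
  show ?thesis
    unfolding e using dot
    by (simp add: power2_norm_eq_inner inner_diff_left inner_diff_right inner_commute algebra_simps
        flip: A_def B_def v_def)
qed

text \<open>At \<open>q0\<close> the gains of pursuer and evader balance. For another
  \<open>q\<close> the pursuer runs at an angle and loses
  \<open>norm Z * norm B - Z \<bullet> B\<close>; this is of the order of the square of
  \<open>norm v\<close> and is paid by the growth around \<open>q0\<close>. The bound on
  \<open>\<sigma>\<close> enters twice, also as
  \<open>\<alpha>\<^sup>2 \<le> 1 - \<sigma>\<close>.\<close>

lemma aim_point_step:
  fixes y p q :: point
  assumes \<alpha>: "0 < \<alpha>" "\<alpha> < 1" and K: "closed K" "convex K" "q \<in> K"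
  defines "q0 \<equiv> aim_point \<alpha> K y p"
  assumes inv: "\<alpha> * norm (p - q0) \<le> norm (y - q0)"
    and \<sigma>: "0 \<le> \<sigma>" "\<sigma> \<le> 1 - \<alpha>\<^sup>2"
    and y': "norm (y' - y) \<le> \<alpha> * \<sigma> * norm (p - q0)"
  shows "\<alpha> * norm (p + \<sigma> *\<^sub>R (q0 - p) - q) \<le> norm (y' - q)"
proof -
  define B v Z where "B = p - q0" and "v = q - q0" and "Z = (1 - \<sigma>) *\<^sub>R B - v"
  have Z: "p + \<sigma> *\<^sub>R (q0 - p) - q = Z"
    by (simp add: Z_def B_def v_def algebra_simps)
  have Bv: "p - q = Z + \<sigma> *\<^sub>R B" by (simp add: Z_def B_def v_def algebra_simps)
  have \<sigma>1: "\<alpha>\<^sup>2 \<le> 1 - \<sigma>" using \<sigma> by simp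
  then have \<sigma>0: "0 \<le> 1 - \<sigma>" using zero_le_power2[of \<alpha>] by linarith
  have D0: "0 \<le> norm Z * norm B - Z \<bullet> B"
    using norm_cauchy_schwarz[of Z B] by simp
  \<comment> \<open>The right side exceeds the left by half the square of
    \<open>(1 - \<sigma>) * norm B - norm Z\<close>.\<close>
  have "(1 - \<sigma>) * (norm Z * norm B - Z \<bullet> B) \<le> (norm v)\<^sup>2 / 2"
  proof -
    have v: "v = (1 - \<sigma>) *\<^sub>R B - Z" by (simp add: Z_def)
    have "0 \<le> ((1 - \<sigma>) * norm B - norm Z)\<^sup>2" by simp
    moreover have "(norm v)\<^sup>2 = (1 - \<sigma>)\<^sup>2 * (norm B)\<^sup>2 - 2 * (1 - \<sigma>) * (Z \<bullet> B) + (norm Z)\<^sup>2"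
      unfolding v power2_norm_eq_inner inner_diff_left inner_diff_right
      by (simp add: inner_commute power2_eq_square algebra_simps)
    moreover have "((1 - \<sigma>) * norm B - norm Z)\<^sup>2 =
        (1 - \<sigma>)\<^sup>2 * (norm B)\<^sup>2 - 2 * (1 - \<sigma>) * (norm Z * norm B) + (norm Z)\<^sup>2"
      by (simp add: power2_eq_square algebra_simps)
    moreover have "(1 - \<sigma>) * (norm Z * norm B - Z \<bullet> B) = (1 - \<sigma>) * (norm Z * norm B) - (1 - \<sigma>) * (Z \<bullet> B)"
      by (rule right_diff_distrib)
    ultimately show ?thesis by linarith
  qed
  then have "\<alpha>\<^sup>2 * (norm Z * norm B - Z \<bullet> B) \<le> (norm v)\<^sup>2 / 2"
    using mult_right_mono[OF \<sigma>1 D0] by linarith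
  then have "2 * \<sigma> * (\<alpha>\<^sup>2 * (norm Z * norm B - Z \<bullet> B)) \<le> 2 * \<sigma> * ((norm v)\<^sup>2 / 2)"
    using \<sigma>(1) by (intro mult_left_mono) auto
  also have "\<dots> \<le> (1 - \<alpha>\<^sup>2) * (norm v)\<^sup>2"
    using mult_right_mono[OF \<sigma>(2), of "(norm v)\<^sup>2"] by simp
  finally have gain: "2 * \<sigma> * (\<alpha>\<^sup>2 * (norm Z * norm B - Z \<bullet> B)) \<le> (1 - \<alpha>\<^sup>2) * (norm v)\<^sup>2" .
  have sq: "(norm (p - q))\<^sup>2 = (norm Z)\<^sup>2 + 2 * \<sigma> * (Z \<bullet> B) + \<sigma>\<^sup>2 * (norm B)\<^sup>2"
    unfolding Bv power2_norm_eq_inner inner_add_left inner_add_right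
    by (simp add: inner_commute power2_eq_square algebra_simps)
  have "(\<alpha> * norm B)\<^sup>2 \<le> (norm (y - q0))\<^sup>2"
    using inv \<alpha> by (intro power_mono) (auto simp: B_def)
  then have "(1 - \<alpha>\<^sup>2) * (norm v)\<^sup>2 \<le> (norm (y - q))\<^sup>2 - \<alpha>\<^sup>2 * (norm (p - q))\<^sup>2"
    using apollonius_growth[OF \<alpha> K, of y p] by (simp add: power_mult_distrib B_def v_def q0_def)
  with gain have "(\<alpha> * (norm Z + \<sigma> * norm B))\<^sup>2 \<le> (norm (y - q))\<^sup>2"
    unfolding sq by (simp add: power2_eq_square algebra_simps)
  then have "\<alpha> * (norm Z + \<sigma> * norm B) \<le> norm (y - q)"
    by (rule power2_le_imp_le) simp
  moreover have "norm (y - q) \<le> norm (y' - y) + norm (y' - q)"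
    using norm_triangle_ineq4[of "y' - q" "y' - y"] by simp
  ultimately show ?thesis
    unfolding Z using y' by (simp add: B_def algebra_simps)
qed

text \<open>A pursuer near the aim point is much closer to it than the evader is, and the growth
  estimate spreads this surplus over all of \<open>K\<close>: \<open>a - b\<close> is at least
  \<open>2 * \<alpha> * \<sigma> * d\<close>. One half pays for the evader's advance, the other for
  the pursuer's own move in a direction that may be wrong for \<open>q\<close>.\<close>

lemma pursue_step:
  fixes y p q :: point
  assumes \<alpha>: "0 < \<alpha>" "\<alpha> < 1" and K: "closed K" "convex K" "q \<in> K"
  defines "q0 \<equiv> aim_point \<alpha> K y p"
  assumes near: "norm (p - q0) \<le> norm (y - p) / 4"
    and \<sigma>: "0 \<le> \<sigma>" "\<sigma> \<le> (1 - \<alpha>\<^sup>2) / 8"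
    and y': "norm (y' - y) \<le> \<alpha> * \<sigma> * norm (y - p)"
  shows "\<alpha> * norm (p + \<sigma> *\<^sub>R (y - p) - q) \<le> norm (y' - q)"
proof -
  define d V where "d = norm (y - p)" and "V = norm (q - q0)"
  define a b where "a = norm (y - q)" and "b = \<alpha> * norm (p - q)"
  have \<alpha>2: "0 < 1 - \<alpha>\<^sup>2" "1 - \<alpha>\<^sup>2 < 1" using \<alpha> by (simp_all add: power_less_one_iff)
  have A1: "3/4 * d \<le> norm (y - q0)"
    using norm_triangle_ineq4[of "y - q0" "p - q0"] near by (simp add: d_def)
  have A2: "norm (y - q0) \<le> 5/4 * d"
    using norm_triangle_ineq[of "y - p" "p - q0"] near by (simp add: d_def)
  have d0: "0 \<le> d" "0 \<le> V" by (simp_all add: d_def V_def)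
  have "(3/4 * d)\<^sup>2 \<le> (norm (y - q0))\<^sup>2" using A1 d0 by (intro power_mono) auto
  moreover have "\<alpha>\<^sup>2 * (norm (p - q0))\<^sup>2 \<le> 1 * (d/4)\<^sup>2"
    using near \<alpha>2 by (intro mult_mono power_mono) (auto simp: d_def)
  moreover have "(norm (y - q0))\<^sup>2 - \<alpha>\<^sup>2 * (norm (p - q0))\<^sup>2 + (1 - \<alpha>\<^sup>2) * V\<^sup>2 \<le> a\<^sup>2 - b\<^sup>2"
    using apollonius_growth[OF \<alpha> K, of y p]
    by (simp add: a_def b_def V_def q0_def power_mult_distrib)
  moreover have "(3/4 * d)\<^sup>2 = 9/16 * d\<^sup>2" "(d/4)\<^sup>2 = d\<^sup>2/16"
    by (simp_all add: power2_eq_square)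
  \<comment> \<open>The \<open>1/2\<close> is \<open>9/16 - 1/16\<close>: the evader is at least
    \<open>3/4 * d\<close> from the aim point, the pursuer at most \<open>d/4\<close>.\<close>
  ultimately have grow: "d\<^sup>2 / 2 + (1 - \<alpha>\<^sup>2) * V\<^sup>2 \<le> a\<^sup>2 - b\<^sup>2"
    by linarith
  have "a \<le> norm (y - q0) + V"
    using norm_triangle_ineq4[of "y - q0" "q - q0"] by (simp add: a_def V_def)
  moreover have "b \<le> 1 * (norm (p - q0) + V)"
    unfolding b_def V_def using norm_triangle_ineq4[of "p - q0" "q - q0"] \<alpha>
    by (intro mult_mono) auto
  ultimately have ab: "a + b \<le> 3/2 * d + 2 * V"
    using A2 near by (simp add: d_def)
  have ab0: "0 \<le> a + b" using \<alpha> by (simp add: a_def b_def)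
  have "b + 2 * \<alpha> * \<sigma> * d \<le> a"
  proof (cases "d = 0")
    case True
    have "0 \<le> (1 - \<alpha>\<^sup>2) * V\<^sup>2" using \<alpha>2 by simp
    then have "b\<^sup>2 \<le> a\<^sup>2" using grow zero_le_power2[of d] by linarith
    then show ?thesis using True by (auto intro: power2_le_imp_le simp: a_def)
  next
    case False
    with d0 have d: "0 < d" by simp
    show ?thesis
    proof (rule ccontr)
      assume "\<not> ?thesis"
      then have lt: "a - b \<le> 2 * \<alpha> * \<sigma> * d" by simp
      have "\<alpha> * \<sigma> \<le> 1 * ((1 - \<alpha>\<^sup>2) / 8)" using \<alpha> \<sigma> by (intro mult_mono) auto
      then have "2 * \<alpha> * \<sigma> * d \<le> (1 - \<alpha>\<^sup>2) / 4 * d"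
        using d mult_right_mono[of "\<alpha> * \<sigma>" "(1 - \<alpha>\<^sup>2) / 8" d] by simp
      then have "(a - b) * (a + b) \<le> ((1 - \<alpha>\<^sup>2) / 4 * d) * (a + b)"
        using lt ab0 by (intro mult_right_mono) auto
      also have "\<dots> \<le> ((1 - \<alpha>\<^sup>2) / 4 * d) * (3/2 * d + 2 * V)"
        using ab \<alpha>2 d by (intro mult_left_mono) auto
      also have "\<dots> = (1 - \<alpha>\<^sup>2) * (3/8 * d\<^sup>2 + d * V / 2)"
        by (simp add: power2_eq_square field_simps)
      \<comment> \<open>The mixed term is split by the square of \<open>d/4 - V\<close>. The
        resulting \<open>3/8 + 1/16 = 7/16\<close> stays below the \<open>1/2\<close> in
        \<open>grow\<close>, and the step bound \<open>(1 - \<alpha>\<^sup>2) / 8\<close> is small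
        enough to allow this.\<close>
      also have "\<dots> \<le> (1 - \<alpha>\<^sup>2) * (7/16 * d\<^sup>2 + V\<^sup>2)"
        using zero_le_power2[of "d/4 - V"] \<alpha>2
        by (intro mult_left_mono) (auto simp: power2_eq_square algebra_simps)
      also have "\<dots> < d\<^sup>2 / 2 + (1 - \<alpha>\<^sup>2) * V\<^sup>2"
      proof -
        have "(1 - \<alpha>\<^sup>2) * (7/16 * d\<^sup>2) \<le> 1 * (7/16 * d\<^sup>2)"
          by (rule mult_right_mono[OF less_imp_le[OF \<alpha>2(2)]]) simp
        moreover have "7/16 * d\<^sup>2 < d\<^sup>2 / 2" using d by simp
        ultimately show ?thesis unfolding distrib_left by linarith
      qed
      finally have "a\<^sup>2 - b\<^sup>2 < d\<^sup>2 / 2 + (1 - \<alpha>\<^sup>2) * V\<^sup>2"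
        by (simp only: power2_eq_square square_diff_square_factored mult.commute)
      then show False using grow by simp
    qed
  qed
  moreover have "\<alpha> * norm (p + \<sigma> *\<^sub>R (y - p) - q) \<le> b + \<alpha> * \<sigma> * d"
  proof -
    have "p + \<sigma> *\<^sub>R (y - p) - q = (p - q) + \<sigma> *\<^sub>R (y - p)" by simp
    then have "norm (p + \<sigma> *\<^sub>R (y - p) - q) \<le> norm (p - q) + \<sigma> * d"
      using norm_triangle_ineq[of "p - q" "\<sigma> *\<^sub>R (y - p)"] \<sigma>(1) by (simp only: norm_scaleR d_def abs_of_nonneg)
    then have "\<alpha> * norm (p + \<sigma> *\<^sub>R (y - p) - q) \<le> \<alpha> * (norm (p - q) + \<sigma> * d)"
      using \<alpha> by (intro mult_left_mono) auto
    then show ?thesis by (simp only: b_def distrib_left mult.assoc)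
  qed
  moreover have "a \<le> norm (y' - y) + norm (y' - q)"
    using norm_triangle_ineq4[of "y' - q" "y' - y"] by (simp add: a_def)
  ultimately show ?thesis using y' by (simp add: d_def)
qed

text \<open>Steps towards the aim point alone can become arbitrarily short while the evader is still
  far away, and the pursuer cannot wait. The switch keeps every step at least proportional to the
  distance from the evader.\<close>

definition hold_step :: "real \<Rightarrow> point set \<Rightarrow> point \<Rightarrow> point \<times> unit \<Rightarrow> point \<times> unit" where
  "hold_step \<alpha> K y s =
     (let p = fst s; q0 = aim_point \<alpha> K y p in
      (if norm (p - q0) \<le> norm (y - p) / 4
       then p + ((1 - \<alpha>\<^sup>2) / 8) *\<^sub>R (y - p) else p + (1 - \<alpha>\<^sup>2) *\<^sub>R (q0 - p), ()))"

lemma hold_step_invariant: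
  assumes \<alpha>: "0 < \<alpha>" "\<alpha> < 1" and K: "closed K" "convex K" "K \<noteq> {}"
    and inv: "\<forall>q\<in>K. \<alpha> * norm (p - q) \<le> norm (y - q)"
    and \<sigma>: "0 \<le> \<sigma>" "\<sigma> \<le> 1"
    and p': "p' = fst (hold_step \<alpha> K y (p, ()))"
    and y': "norm (y' - y) \<le> \<alpha> * \<sigma> * dist p p'"
  shows "\<forall>q\<in>K. \<alpha> * norm (p + \<sigma> *\<^sub>R (p' - p) - q) \<le> norm (y' - q)"
proof
  fix q assume q: "q \<in> K"
  have \<alpha>2: "0 < 1 - \<alpha>\<^sup>2" using \<alpha> by (simp add: power_less_one_iff)
  define q0 where "q0 = aim_point \<alpha> K y p"
  have q0: "q0 \<in> K" using K by (simp add: q0_def aim_point_def closest_point_in_set)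
  show "\<alpha> * norm (p + \<sigma> *\<^sub>R (p' - p) - q) \<le> norm (y' - q)"
  proof (cases "norm (p - q0) \<le> norm (y - p) / 4")
    case True
    then have p'': "p' - p = ((1 - \<alpha>\<^sup>2) / 8) *\<^sub>R (y - p)"
      by (simp add: p' hold_step_def q0_def Let_def)
    have "\<alpha> * norm (p + (\<sigma> * ((1 - \<alpha>\<^sup>2) / 8)) *\<^sub>R (y - p) - q) \<le> norm (y' - q)"
    proof (rule pursue_step[OF \<alpha> K(1,2) q])
      have "dist p p' = (1 - \<alpha>\<^sup>2) / 8 * norm (y - p)"
        using p'' \<alpha>2 by (simp add: dist_norm norm_minus_commute[of p p'])
      with y' show "norm (y' - y) \<le> \<alpha> * (\<sigma> * ((1 - \<alpha>\<^sup>2) / 8)) * norm (y - p)"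
        by (simp add: mult.assoc)
      show "\<sigma> * ((1 - \<alpha>\<^sup>2) / 8) \<le> (1 - \<alpha>\<^sup>2) / 8"
        using \<sigma> \<alpha>2 by (intro mult_left_le_one_le) auto
    qed (use True \<sigma> \<alpha>2 in \<open>simp_all add: q0_def\<close>)
    then show ?thesis by (simp add: p'')
  next
    case False
    then have p'': "p' - p = (1 - \<alpha>\<^sup>2) *\<^sub>R (q0 - p)"
      by (simp add: p' hold_step_def q0_def Let_def)
    have "\<alpha> * norm (p + (\<sigma> * (1 - \<alpha>\<^sup>2)) *\<^sub>R (aim_point \<alpha> K y p - p) - q) \<le> norm (y' - q)"
    proof (rule aim_point_step[OF \<alpha> K(1,2) q])
      have "dist p p' = (1 - \<alpha>\<^sup>2) * norm (p - q0)"
        using p'' \<alpha>2 by (simp add: dist_norm norm_minus_commute[of p])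
      with y' show "norm (y' - y) \<le> \<alpha> * (\<sigma> * (1 - \<alpha>\<^sup>2)) * norm (p - aim_point \<alpha> K y p)"
        by (simp add: mult.assoc q0_def)
      show "\<sigma> * (1 - \<alpha>\<^sup>2) \<le> 1 - \<alpha>\<^sup>2"
        using \<sigma> \<alpha>2 by (intro mult_left_le_one_le) auto
    qed (use inv q0 \<sigma> \<alpha>2 in \<open>simp_all add: q0_def\<close>)
    then show ?thesis by (simp add: p'' q0_def)
  qed
qed

text \<open>Bounding the distance by the step length turns accumulation of vertex times into
  capture: along a polygon of finite length the steps tend to zero.\<close>

lemma hold_step_length:
  assumes "0 < \<alpha>" "\<alpha> < 1"
  shows "(1 - \<alpha>\<^sup>2) / 8 * norm (y - p) \<le> dist p (fst (hold_step \<alpha> K y (p, u)))"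
proof -
  have \<alpha>2: "0 < 1 - \<alpha>\<^sup>2" using assms by (simp add: power_less_one_iff)
  define q0 where "q0 = aim_point \<alpha> K y p"
  show ?thesis
  proof (cases "norm (p - q0) \<le> norm (y - p) / 4")
    case True
    then show ?thesis using \<alpha>2 by (simp add: hold_step_def Let_def dist_norm flip: q0_def)
  next
    case False
    then have "norm (y - p) / 8 \<le> norm (q0 - p)"
      using norm_ge_zero[of "p - q0"] by (simp only: norm_minus_commute[of q0 p])
    then have "(1 - \<alpha>\<^sup>2) * (norm (y - p) / 8) \<le> (1 - \<alpha>\<^sup>2) * norm (q0 - p)"
      using \<alpha>2 by (intro mult_left_mono) auto
    with False show ?thesis using \<alpha>2 by (simp add: hold_step_def Let_def dist_norm flip: q0_def)
  qed
qed

lemma hold_step_in_hull: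
  assumes "0 < \<alpha>" "\<alpha> < 1" "closed K" "K \<noteq> {}"
  shows "fst (hold_step \<alpha> K y (p, u)) \<in> convex hull (insert y (insert p (insert x K)))"
proof -
  let ?H = "convex hull (insert y (insert p (insert x K)))"
  have \<alpha>2: "0 < 1 - \<alpha>\<^sup>2" "1 - \<alpha>\<^sup>2 < 1" using assms by (simp_all add: power_less_one_iff)
  define q0 where "q0 = aim_point \<alpha> K y p"
  have "q0 \<in> K" using assms by (simp add: q0_def aim_point_def closest_point_in_set)
  then have mem: "y \<in> ?H" "p \<in> ?H" "q0 \<in> ?H" by (auto intro: hull_inc)
  have "p + \<sigma> *\<^sub>R (w - p) \<in> ?H" if "w \<in> ?H" "0 \<le> \<sigma>" "\<sigma> \<le> 1" for w \<sigma>
    using convexD_alt[OF convex_convex_hull mem(2) that] by (simp add: algebra_simps)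
  from this[OF mem(1), of "(1 - \<alpha>\<^sup>2) / 8"] this[OF mem(3), of "1 - \<alpha>\<^sup>2"]
  show ?thesis
    using \<alpha>2 by (auto simp: hold_step_def Let_def simp flip: q0_def)
qed

text \<open>The constraint already places \<open>x\<close> in \<open>A\<close>, so
  \<open>{x}\<close> can stand in for an empty set to be held.\<close>

lemma pursuit_plan_insert: "pursuit_plan vE vP z x (insert x K) \<Gamma> = pursuit_plan vE vP z x K \<Gamma>"
  by (auto simp: pursuit_plan_def)

lemma lipschitz_on_nonneg_D:
  fixes e :: "real \<Rightarrow> point"
  assumes "C-lipschitz_on {0..} e" "0 \<le> s" "s \<le> t"
  shows "norm (e t - e s) \<le> C * (t - s)"
  using lipschitz_onD[OF assms(1), of t s] assms(2,3) by (simp add: dist_norm)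

text \<open>The step lemmas admit any fraction of a step, so the invariant holds between vertices
  too. Times beyond all vertices are covered by the meeting at the accumulation time.\<close>

lemma hold_plan_nonempty:
  assumes v: "0 < vE" "vE < vP" and K: "compact K" "convex K" "K \<noteq> {}"
    and inv0: "\<forall>q\<in>K. vE / vP * norm (x - q) \<le> norm (z - q)"
  obtains \<Gamma> where "pursuit_plan vE vP z x K \<Gamma>"
    "\<And>e t. e 0 = z \<Longrightarrow> vE-lipschitz_on {0..} e \<Longrightarrow> 0 \<le> t \<Longrightarrow> e t \<in> K \<Longrightarrow>
       \<exists>s\<in>{0..t}. e s = traj vP x (\<Gamma> e) s"
proof -
  define \<alpha> where "\<alpha> = vE / vP"
  have vP: "0 < vP" using v by simp
  have \<alpha>: "0 < \<alpha>" "\<alpha> < 1" using v by (simp_all add: \<alpha>_def)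
  have \<alpha>2: "0 < 1 - \<alpha>\<^sup>2" using \<alpha> by (simp add: power_less_one_iff)
  note clK = compact_imp_closed[OF K(1)]
  define f where "f = hold_step \<alpha> K"
  let ?T = "wtime vP f (x, ())" and ?P = "wpos vP f (x, ())"
  note T = wtime_0[of vP f "(x, ())"] wtime_Suc[of vP f "(x, ())"] vP
  have f_unit: "f y (p, u) = f y (p, ())" for y p u by simp
  have PS: "?P e (Suc k) = fst (f (e (?T e k)) (?P e k, ()))" for e k
  proof -
    have "?P e (Suc k) = fst (f (e (?T e k)) (?P e k, waux vP f (x, ()) e k))"
      using arg_cong[OF wstate_Suc[of vP f "(x, ())" e k], of fst] unfolding fst_conv .
    then show ?thesis unfolding f_unit[of _ _ "waux vP f (x, ()) e k"] .
  qed
  define p where "p = (\<lambda>e. traj vP x (waypoint_control vP f (x, ()) e))"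
  have between: "\<forall>q\<in>K. \<alpha> * norm (p e t - q) \<le> norm (e t - q)"
    if e: "vE-lipschitz_on {0..} e" and t: "?T e k \<le> t" "t \<le> ?T e (Suc k)"
      and inv: "\<forall>q\<in>K. \<alpha> * norm (?P e k - q) \<le> norm (e (?T e k) - q)" for e k t
  proof -
    have nn: "0 \<le> ?T e k" by (rule polyline_time_nonneg[OF T])
    obtain \<sigma> where \<sigma>: "0 \<le> \<sigma>" "\<sigma> \<le> 1" "p e t = ?P e k + \<sigma> *\<^sub>R (?P e (Suc k) - ?P e k)"
      "vP * (t - ?T e k) = \<sigma> * dist (?P e k) (?P e (Suc k))"
      using traj_polyline[OF T t, of x] unfolding p_def waypoint_control_def by auto
    have "vE = \<alpha> * vP" using vP by (simp add: \<alpha>_def)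
    then have "norm (e t - e (?T e k)) \<le> \<alpha> * \<sigma> * dist (?P e k) (?P e (Suc k))"
      using lipschitz_on_nonneg_D[OF e nn t(1)] \<sigma>(4) by (simp add: mult.assoc)
    then show ?thesis
      unfolding \<sigma>(3)
      using hold_step_invariant[OF \<alpha> clK K(2,3) inv \<sigma>(1,2), of "?P e (Suc k)" "e t"] PS[of e k]
      by (simp add: f_def)
  qed
  have node: "p e (?T e k) = ?P e k" for e k
    unfolding p_def waypoint_control_def by (rule traj_polyline_node[OF T]) simp
  have mono: "?T e k \<le> ?T e (Suc k)" for e k using polyline_time_mono[of "?T e" "?P e" vP k "Suc k", OF T] by simp
  have inv: "\<forall>q\<in>K. \<alpha> * norm (?P e k - q) \<le> norm (e (?T e k) - q)"
    if e: "e 0 = z" "vE-lipschitz_on {0..} e" for e k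
  proof (induction k)
    case 0
    then show ?case using inv0 e by (simp add: \<alpha>_def)
  next
    case (Suc k)
    show ?case using between[OF e(2) mono order_refl Suc] by (simp add: node)
  qed
  have zeno: "(\<lambda>k. dist (e (?T e k)) (?P e k)) \<longlonglongrightarrow> 0"
    if bd: "\<And>k. ?T e k \<le> t" for e t
  proof -
    have "incseq (?T e)" using mono by (simp add: incseq_SucI)
    then obtain L where L: "?T e \<longlonglongrightarrow> L"
      using incseq_convergent[of "?T e" t] bd by blast
    let ?c = "8 / (1 - \<alpha>\<^sup>2)"
    have "(\<lambda>k. ?c * (vP * (?T e (Suc k) - ?T e k))) \<longlonglongrightarrow> ?c * (vP * (L - L))"
      by (rule tendsto_mult_left[OF tendsto_mult_left[OF tendsto_diff[OF LIMSEQ_Suc[OF L] L]]])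
    then have lim: "(\<lambda>k. ?c * (vP * (?T e (Suc k) - ?T e k))) \<longlonglongrightarrow> 0"
      by (simp only: diff_self mult_zero_right)
    have "norm (dist (e (?T e k)) (?P e k)) \<le> ?c * (vP * (?T e (Suc k) - ?T e k))" for k
    proof -
      have "vP * (?T e (Suc k) - ?T e k) = dist (?P e k) (?P e (Suc k))"
        using vP by (simp add: T(2))
      moreover have "(1 - \<alpha>\<^sup>2) / 8 * norm (e (?T e k) - ?P e k) \<le> dist (?P e k) (?P e (Suc k))"
        unfolding PS by (rule hold_step_length[OF \<alpha>, of _ _ K, folded f_def])
      ultimately have "(1 - \<alpha>\<^sup>2) * norm (e (?T e k) - ?P e k) \<le> 8 * (vP * (?T e (Suc k) - ?T e k))"
        by simp
      then show ?thesis
        using \<alpha>2 by (simp add: dist_norm pos_le_divide_eq mult.commute)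
    qed
    then show ?thesis
      by (rule Lim_null_comparison[OF always_eventually[OF allI] lim])
  qed
  show thesis
  proof (rule that)
    show "pursuit_plan vE vP z x K (waypoint_control vP f (x, ()))"
    proof (rule waypoint_plan[OF vP])
      show "?P e (Suc k) \<in> convex hull (insert (e (?T e k)) (insert (?P e k) (insert x K)))" for e k
        unfolding PS by (rule hold_step_in_hull[OF \<alpha> clK K(3), folded f_def])
      show "(\<lambda>k. dist (e (?T e k)) (?P e k)) \<longlonglongrightarrow> 0" if "\<And>k. ?T e k \<le> t" for e t
        using that by (rule zeno)
    qed simp
  next
    fix e :: "real \<Rightarrow> point" and t
    assume e: "e 0 = z" "vE-lipschitz_on {0..} e" and t: "0 \<le> t" and et: "e t \<in> K"
    show "\<exists>s\<in>{0..t}. e s = traj vP x (waypoint_control vP f (x, ()) e) s"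
    proof (rule polyline_time_cases[OF T t])
      fix k assume k: "?T e k \<le> t" "t < ?T e (Suc k)"
      \<comment> \<open>With the evader's own position as the point of \<open>K\<close>, the
        invariant leaves the pursuer at distance zero.\<close>
      have "\<alpha> * norm (p e t - e t) \<le> norm (e t - e t)"
        using between[OF e(2) k(1) less_imp_le[OF k(2)] inv[OF e]] et by blast
      then have "e t = p e t" using \<alpha> by (simp add: mult_le_0_iff)
      then show ?thesis using t unfolding p_def by (intro bexI[of _ t]) auto
    next
      assume bd: "\<And>k. ?T e k \<le> t"
      obtain s where "0 \<le> s" "s \<le> t" "e s = traj vP (fst (x, ())) (waypoint_control vP f (x, ()) e) s"
        by (rule waypoint_capture[OF vP e(2) bd zeno[OF bd]])
      then show ?thesis by (intro bexI[of _ s]) auto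
    qed
  qed
qed

lemma hold_plan:
  assumes v: "0 < vE" "vE < vP" and K: "compact K" "convex K"
    and inv0: "\<forall>q\<in>K. vE / vP * norm (x - q) \<le> norm (z - q)"
  obtains \<Gamma> where "pursuit_plan vE vP z x K \<Gamma>"
    "\<And>e t. e 0 = z \<Longrightarrow> vE-lipschitz_on {0..} e \<Longrightarrow> 0 \<le> t \<Longrightarrow> e t \<in> K \<Longrightarrow>
       \<exists>s\<in>{0..t}. e s = traj vP x (\<Gamma> e) s"
proof (cases "K = {}")
  case True
  obtain \<Gamma> where "pursuit_plan vE vP z x {x} \<Gamma>"
    by (rule hold_plan_nonempty[OF v, of "{x}" x z]) auto
  then have "pursuit_plan vE vP z x K \<Gamma>" by (simp add: pursuit_plan_insert True)
  then show thesis using that True by blast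
next
  case False
  show thesis by (rule hold_plan_nonempty[OF v K False inv0 that])
qed

section \<open>The strict inequality: capture before the set is reached\<close>

section \<open>Capture under strict dominance\<close>

text \<open>The exact expansion of the quadratic at \<open>q0\<close>. It also reaches the line
  through \<open>q0\<close> orthogonal to \<open>q0 - c\<close>, where the linear term vanishes, and
  the point \<open>z\<close> beyond that line.\<close>

lemma apollonius_identity:
  fixes z x q q0 c :: point
  assumes "(1 - \<beta>\<^sup>2) *\<^sub>R c = z - \<beta>\<^sup>2 *\<^sub>R x"
  shows "(norm (z - q))\<^sup>2 - \<beta>\<^sup>2 * (norm (x - q))\<^sup>2 =
    (norm (z - q0))\<^sup>2 - \<beta>\<^sup>2 * (norm (x - q0))\<^sup>2 + (1 - \<beta>\<^sup>2) * (norm (q - q0))\<^sup>2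
      + 2 * (1 - \<beta>\<^sup>2) * ((q - q0) \<bullet> (q0 - c))"
proof -
  have "(1 - \<beta>\<^sup>2) *\<^sub>R (q0 - c) = \<beta>\<^sup>2 *\<^sub>R (x - q0) - (z - q0)"
    unfolding scaleR_diff_right[of "1 - \<beta>\<^sup>2" q0 c] assms by (simp add: algebra_simps)
  then have "(1 - \<beta>\<^sup>2) * ((q - q0) \<bullet> (q0 - c)) = (q - q0) \<bullet> (\<beta>\<^sup>2 *\<^sub>R (x - q0) - (z - q0))"
    by (metis inner_scaleR_right)
  then have *: "2 * (1 - \<beta>\<^sup>2) * ((q - q0) \<bullet> (q0 - c)) =
      2 * ((q - q0) \<bullet> (\<beta>\<^sup>2 *\<^sub>R (x - q0) - (z - q0)))" by (simp only: mult.assoc)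
  show ?thesis
    unfolding * power2_norm_eq_inner
    by (simp add: inner_diff_left inner_diff_right inner_commute algebra_simps)
qed

text \<open>The line through \<open>q0\<close> orthogonal to \<open>q0 - c\<close> separates
  \<open>K\<close> from \<open>z\<close>. The map is the identity on the side of \<open>K\<close>;
  on the other side it is the affine map that fixes the line and sends \<open>z\<close> to
  \<open>x\<close>. The guard inequality extends from \<open>q0\<close> to the whole line, and the
  affine map stretches a direction by the ratio of the distances of \<open>x\<close> and
  \<open>z\<close> to a point of that line. A projection finally brings the values into the
  hull.\<close>

lemma guard_map_exists:
  fixes x z :: point
  assumes L: "1 < L" and K: "compact K" "convex K" "K \<noteq> {}" and zx: "z \<noteq> x"
    and guard: "\<forall>q\<in>K. norm (x - q) \<le> L * norm (z - q)"
  obtains \<psi> where "\<psi> z = x" "\<And>q. q \<in> K \<Longrightarrow> \<psi> q = q" "\<And>y. \<psi> y \<in> convex hull (insert x K)"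
    "\<And>y y'. norm (\<psi> y - \<psi> y') \<le> L * norm (y - y')"
proof -
  define \<beta> where "\<beta> = 1 / L"
  have \<beta>: "0 < \<beta>" "\<beta> < 1" using L by (simp_all add: \<beta>_def)
  have \<beta>2: "0 < 1 - \<beta>\<^sup>2" using \<beta> by (simp add: power_less_one_iff)
  define c where "c = (1 / (1 - \<beta>\<^sup>2)) *\<^sub>R (z - \<beta>\<^sup>2 *\<^sub>R x)"
  have c: "(1 - \<beta>\<^sup>2) *\<^sub>R c = z - \<beta>\<^sup>2 *\<^sub>R x" using \<beta>2 by (simp add: c_def)
  note ident = apollonius_identity[OF c]
  define q0 where "q0 = closest_point K c"
  have q0: "q0 \<in> K" using K by (simp add: q0_def closest_point_in_set compact_imp_closed)
  define \<nu> where "\<nu> = q0 - c"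
  have sqD: "norm (x - q) \<le> L * norm (z - q)" if "0 \<le> (norm (z - q))\<^sup>2 - \<beta>\<^sup>2 * (norm (x - q))\<^sup>2" for q
  proof -
    have "(\<beta> * norm (x - q))\<^sup>2 \<le> (norm (z - q))\<^sup>2" using that by (simp add: power_mult_distrib)
    then have "\<beta> * norm (x - q) \<le> norm (z - q)" by (rule power2_le_imp_le) simp
    then show ?thesis using L by (simp add: \<beta>_def field_simps)
  qed
  have f0: "0 \<le> (norm (z - q0))\<^sup>2 - \<beta>\<^sup>2 * (norm (x - q0))\<^sup>2"
  proof -
    have "\<beta> * norm (x - q0) \<le> norm (z - q0)"
      using guard q0 L by (simp add: \<beta>_def field_simps)
    then have "(\<beta> * norm (x - q0))\<^sup>2 \<le> (norm (z - q0))\<^sup>2" using \<beta> by (intro power_mono) auto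
    then show ?thesis by (simp add: power_mult_distrib)
  qed
  define h where "h = (\<lambda>y. (q0 - y) \<bullet> \<nu>)"
  have hz: "0 < h z"
  proof -
    \<comment> \<open>The identity at \<open>q = z\<close> has a negative left side, while
      \<open>f0\<close> is nonnegative, so the linear term is negative: \<open>z\<close> lies
      strictly beyond the line.\<close>
    have "0 < \<beta>\<^sup>2 * (norm (x - z))\<^sup>2" using \<beta> zx by simp
    moreover have "0 \<le> (1 - \<beta>\<^sup>2) * (norm (z - q0))\<^sup>2" using \<beta>2 by simp
    ultimately have "2 * (1 - \<beta>\<^sup>2) * ((z - q0) \<bullet> \<nu>) < 0"
      using ident[of z q0] f0 by (simp add: \<nu>_def)
    then have "(z - q0) \<bullet> \<nu> < 0" using \<beta>2 by (simp add: mult_less_0_iff)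
    then show ?thesis by (simp add: h_def inner_diff_left)
  qed
  define M where "M = (\<lambda>w. w - ((w \<bullet> \<nu>) / h z) *\<^sub>R (x - z))"
  have M: "norm (M w) \<le> L * norm w" for w
  proof (cases "w \<bullet> \<nu> = 0")
    case True
    then show ?thesis using L mult_right_mono[of 1 L "norm w"] by (simp add: M_def)
  next
    case False
    define r where "r = - (w \<bullet> \<nu>) / h z"
    have r: "r \<noteq> 0" using False hz by (simp add: r_def)
    \<comment> \<open>The line through \<open>z\<close> in direction \<open>w\<close> meets the
      fixed line at \<open>q\<close>; \<open>w\<close> and \<open>M w\<close> are the same multiple
      of \<open>z - q\<close> and \<open>x - q\<close>.\<close>
    define q where "q = z - (1 / r) *\<^sub>R w"
    have "(q - q0) \<bullet> \<nu> = - h z - (w \<bullet> \<nu>) / r" by (simp add: q_def h_def inner_diff_left)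
    also have "\<dots> = 0" using False hz by (simp add: r_def)
    finally have "(q - q0) \<bullet> (q0 - c) = 0" by (simp add: \<nu>_def)
    moreover have "0 \<le> (1 - \<beta>\<^sup>2) * (norm (q - q0))\<^sup>2" using \<beta>2 by simp
    ultimately have "norm (x - q) \<le> L * norm (z - q)"
      using ident[of q q0] f0 by (intro sqD) simp
    moreover have "(w \<bullet> \<nu>) / h z = - r" by (simp add: r_def)
    then have "M w = r *\<^sub>R (x - q)" "w = r *\<^sub>R (z - q)"
      using r by (simp_all add: M_def q_def algebra_simps)
    ultimately show ?thesis
      using mult_left_mono[of "norm (x - q)" "L * norm (z - q)" "\<bar>r\<bar>"] by (simp add: mult.left_commute)
  qed
  define A where "A = (\<lambda>y. y + (max 0 (h y) / h z) *\<^sub>R (x - z))"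
  have A: "norm (A y - A y') \<le> L * norm (y - y')" for y y'
  proof -
    let ?w = "y - y'"
    have hw: "h y - h y' = - (?w \<bullet> \<nu>)" by (simp add: h_def inner_diff_left)
    \<comment> \<open>Cutting off at zero keeps a fraction \<open>\<theta>\<close> of any difference
      of \<open>h\<close>, which makes \<open>A y - A y'\<close> a convex combination of
      \<open>?w\<close> and \<open>M ?w\<close>.\<close>
    have "\<exists>\<theta>. 0 \<le> \<theta> \<and> \<theta> \<le> 1 \<and> max 0 (h y) - max 0 (h y') = \<theta> * (h y - h y')"
    proof (cases "h y = h y'")
      case True
      then show ?thesis by (intro exI[of _ 0]) simp
    next
      case False
      then show ?thesis
        by (intro exI[of _ "(max 0 (h y) - max 0 (h y')) / (h y - h y')"])
           (auto simp: max_def divide_simps)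
    qed
    then obtain \<theta> where \<theta>: "0 \<le> \<theta>" "\<theta> \<le> 1" "max 0 (h y) - max 0 (h y') = \<theta> * (h y - h y')" by blast
    have "A y - A y' = ?w + ((max 0 (h y) - max 0 (h y')) / h z) *\<^sub>R (x - z)"
      by (simp add: A_def scaleR_diff_left diff_divide_distrib)
    also have "\<dots> = (1 - \<theta>) *\<^sub>R ?w + \<theta> *\<^sub>R M ?w"
    proof -
      have gen: "w + (- \<theta> * a) *\<^sub>R d = (1 - \<theta>) *\<^sub>R w + \<theta> *\<^sub>R (w - a *\<^sub>R d)" for w d :: point and a
        by (simp add: algebra_simps)
      show ?thesis unfolding \<theta>(3) hw M_def gen[symmetric] by simp
    qed
    also have "norm \<dots> \<le> (1 - \<theta>) * norm ?w + \<theta> * norm (M ?w)"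
      using norm_triangle_ineq[of "(1 - \<theta>) *\<^sub>R ?w" "\<theta> *\<^sub>R M ?w"] \<theta> by simp
    also have "\<dots> \<le> (1 - \<theta>) * (L * norm ?w) + \<theta> * (L * norm ?w)"
    proof (intro add_mono mult_left_mono M)
      show "norm ?w \<le> L * norm ?w" using L mult_right_mono[of 1 L "norm ?w"] by simp
    qed (use \<theta> in auto)
    finally show ?thesis by (simp add: algebra_simps)
  qed
  let ?\<Delta> = "convex hull (insert x K)"
  have \<Delta>: "closed ?\<Delta>" "convex ?\<Delta>" "?\<Delta> \<noteq> {}"
    using K by (simp_all add: compact_imp_closed compact_convex_hull)
  show thesis
  proof (rule that[of "\<lambda>y. closest_point ?\<Delta> (A y)"])
    have "A z = x" using hz by (simp add: A_def)
    then show "closest_point ?\<Delta> (A z) = x"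
      by (simp add: closest_point_self hull_inc)
    show "closest_point ?\<Delta> (A q) = q" if q: "q \<in> K" for q
    proof -
      have "(c - q0) \<bullet> (q - q0) \<le> 0"
        unfolding q0_def using K q by (intro closest_point_dot compact_imp_closed)
      moreover have "h q = (c - q0) \<bullet> (q - q0)"
        by (simp add: h_def \<nu>_def inner_diff_left inner_diff_right inner_commute)
      ultimately have "A q = q" by (simp add: A_def)
      then show ?thesis using q by (simp add: closest_point_self hull_inc)
    qed
    show "closest_point ?\<Delta> (A y) \<in> ?\<Delta>" for y by (rule closest_point_in_set[OF \<Delta>(1,3)])
    show "norm (closest_point ?\<Delta> (A y) - closest_point ?\<Delta> (A y')) \<le> L * norm (y - y')" for y y'
      using closest_point_lipschitz[OF \<Delta>(2,1,3), of "A y" "A y'"] A[of y y']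
      unfolding dist_norm by linarith
  qed
qed

section \<open>One step of the chase between the guard image and the evader\<close>

definition chase_step ::
  "(point \<Rightarrow> point) \<Rightarrow> point set \<Rightarrow> real \<Rightarrow> point \<Rightarrow> point \<times> real \<Rightarrow> point \<times> real" where
  "chase_step \<psi> K \<rho> y s =
    (let s' = (if snd s = 1 \<or> dist y (fst s) \<le> \<rho> * infdist y K then 1
       else SOME r. snd s \<le> r \<and> r \<le> 1 \<and>
              dist ((1 - r) *\<^sub>R \<psi> y + r *\<^sub>R y) (fst s) = \<rho> * infdist y K)
     in ((1 - s') *\<^sub>R \<psi> y + s' *\<^sub>R y, s'))"

text \<open>
  Here \<open>\<rho>\<close> is the length of a step in units of the evader's distance to \<open>K\<close>; it is so small that the
  evader cannot reach \<open>K\<close> during a step.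
\<close>

lemma chase_step_progress:
  fixes y y' :: point and vE vP L :: real
  defines "\<kappa> \<equiv> L * vE / vP"
  defines "\<eta> \<equiv> (1 - \<kappa>) / (2 * vE)"
  defines "\<mu> \<equiv> (1 - \<kappa>) / (1 + \<kappa>) * (vP * \<eta>) / (1 + L)"
  assumes v: "0 < vE" "0 < vP" and L: "1 < L" "\<kappa> < 1"
    and K: "compact K" "K \<noteq> {}"
    and \<psi>K: "\<forall>q\<in>K. \<psi> q = q" and \<psi>: "\<And>y y'. norm (\<psi> y - \<psi> y') \<le> L * norm (y - y')"
    and s: "0 \<le> s" "s < 1" and p: "p = (1 - s) *\<^sub>R \<psi> y' + s *\<^sub>R y'"
    and yy': "norm (y - y') \<le> vE * \<eta> * infdist y' K" and pos: "0 < infdist y' K"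
    and step: "chase_step \<psi> K (vP * \<eta>) y (p, s) = (p', s')"
  shows "p' = (1 - s') *\<^sub>R \<psi> y + s' *\<^sub>R y" "s' = 1 \<or> s + \<mu> \<le> s'" "0 \<le> s'" "s' \<le> 1"
    "dist p p' \<le> vP * \<eta> * infdist y K" "0 < infdist y K" "0 < \<mu>"
proof -
  have \<kappa>0: "0 < \<kappa>" using v L by (simp add: \<kappa>_def)
  have \<eta>0: "0 < \<eta>" using v L by (simp add: \<eta>_def)
  have vE\<eta>: "vE * \<eta> = (1 - \<kappa>) / 2" using v by (simp add: \<eta>_def)
  show \<mu>0: "0 < \<mu>" unfolding \<mu>_def using v L \<kappa>0 \<eta>0
    by (intro divide_pos_pos mult_pos_pos) auto
  have "infdist y' K \<le> infdist y K + dist y' y" by (rule infdist_triangle)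
  \<comment> \<open>During the last step the evader used up at most the share
    \<open>(1 - \<kappa>) / 2\<close> of its distance to \<open>K\<close>.\<close>
  then have \<delta>: "(1 + \<kappa>) / 2 * infdist y' K \<le> infdist y K"
    using yy' unfolding vE\<eta> by (simp add: dist_norm norm_minus_commute field_simps)
  moreover have "0 < (1 + \<kappa>) / 2 * infdist y' K" using \<kappa>0 pos by simp
  ultimately show \<delta>0: "0 < infdist y K" by linarith
  let ?h = "vP * \<eta> * infdist y K"
  have h0: "0 < ?h" using v \<eta>0 \<delta>0 by simp
  define g where "g = (\<lambda>r. dist ((1 - r) *\<^sub>R \<psi> y + r *\<^sub>R y) p)"
  \<comment> \<open>\<open>\<kappa>\<close> compares the top speed of the image with the pursuer's.
    Following with the old weight \<open>s\<close> costs only the share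
    \<open>2 * \<kappa> / (1 + \<kappa>)\<close> of the step; the rest is free for raising the
    weight.\<close>
  have gs: "g s \<le> 2 * \<kappa> / (1 + \<kappa>) * ?h"
  proof -
    have "(1 - s) *\<^sub>R \<psi> y + s *\<^sub>R y - p = (1 - s) *\<^sub>R (\<psi> y - \<psi> y') + s *\<^sub>R (y - y')"
      by (simp add: p algebra_simps)
    then have "g s \<le> (1 - s) * norm (\<psi> y - \<psi> y') + s * norm (y - y')"
      using norm_triangle_ineq[of "(1 - s) *\<^sub>R (\<psi> y - \<psi> y')" "s *\<^sub>R (y - y')"] s
      by (simp add: g_def dist_norm)
    also have "\<dots> \<le> (1 - s) * (L * norm (y - y')) + s * (L * norm (y - y'))"
    proof (intro add_mono mult_left_mono \<psi>)
      show "norm (y - y') \<le> L * norm (y - y')"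
        using L mult_right_mono[of 1 L "norm (y - y')"] by simp
    qed (use s in auto)
    also have "\<dots> = L * norm (y - y')" by (simp add: algebra_simps)
    also have "\<dots> \<le> L * (vE * \<eta> * infdist y' K)" using L yy' by (intro mult_left_mono) auto
    also have "\<dots> \<le> L * (vE * \<eta> * (2 / (1 + \<kappa>) * infdist y K))"
      using L v \<eta>0 \<delta> \<kappa>0 by (intro mult_left_mono) (auto simp: field_simps)
    also have "\<dots> = (L * vE) * (\<eta> * (2 / (1 + \<kappa>) * infdist y K))" by simp
    also have "L * vE = \<kappa> * vP" using v by (simp add: \<kappa>_def)
    finally show ?thesis by (simp add: mult_ac)
  qed
  have frac: "2 * \<kappa> / (1 + \<kappa>) = 1 - (1 - \<kappa>) / (1 + \<kappa>)" using \<kappa>0 by (simp add: field_simps)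
  have frac0: "0 < (1 - \<kappa>) / (1 + \<kappa>)" using \<kappa>0 L by simp
  have gs': "g s \<le> ?h - (1 - \<kappa>) / (1 + \<kappa>) * ?h"
    using gs unfolding frac by (simp add: left_diff_distrib)
  \<comment> \<open>As \<open>\<psi>\<close> fixes the point of \<open>K\<close> nearest to
    \<open>y\<close>, the segment from image to evader is at most proportional to the distance from
    \<open>K\<close>. The spare part of the step therefore raises the weight by at least
    \<open>\<mu>\<close>, whatever that distance is.\<close>
  have near: "norm (y - \<psi> y) \<le> (1 + L) * infdist y K"
  proof -
    obtain q where q: "q \<in> K" "infdist y K = dist y q"
      using infdist_attains_inf[of K y] K by (auto simp: compact_imp_closed)
    have "norm (y - \<psi> y) \<le> norm (y - q) + norm (\<psi> q - \<psi> y)"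
      using norm_triangle_ineq[of "y - q" "\<psi> q - \<psi> y"] bspec[OF \<psi>K q(1)] by simp
    also have "\<dots> \<le> norm (y - q) + L * norm (q - y)" using \<psi>[of q y] by simp
    finally show ?thesis using q by (simp add: dist_norm norm_minus_commute algebra_simps)
  qed
  show p': "p' = (1 - s') *\<^sub>R \<psi> y + s' *\<^sub>R y"
    using step by (auto simp: chase_step_def Let_def)
  have main: "(s' = 1 \<or> s + \<mu> \<le> s') \<and> 0 \<le> s' \<and> s' \<le> 1 \<and> dist p p' \<le> ?h"
  proof (cases "dist y p \<le> ?h")
    case True
    then have "s' = 1" using step by (auto simp: chase_step_def Let_def)
    then show ?thesis using True p' by (simp add: dist_commute)
  next
    case False
    let ?Q = "\<lambda>r. s \<le> r \<and> r \<le> 1 \<and> dist ((1 - r) *\<^sub>R \<psi> y + r *\<^sub>R y) p = ?h"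
    have "0 \<le> (1 - \<kappa>) / (1 + \<kappa>) * ?h" using frac0 h0 by (intro mult_nonneg_nonneg less_imp_le)
    then have "g s \<le> ?h" using gs' by linarith
    moreover have "?h \<le> g 1" using False by (simp add: g_def)
    moreover have "continuous_on {s..1} g" unfolding g_def by (intro continuous_intros)
    \<comment> \<open>By the intermediate value theorem some weight uses exactly the permitted
      length: the old one uses at most that, weight one at least that.\<close>
    ultimately have "\<exists>r\<ge>s. r \<le> 1 \<and> g r = ?h" using s by (intro IVT') auto
    then have "?Q (SOME r. ?Q r)" by (intro someI_ex[of ?Q]) (auto simp: g_def)
    moreover have "s' = (SOME r. ?Q r)"
      using step s False by (auto simp: chase_step_def Let_def)
    ultimately have Q: "s \<le> s'" "s' \<le> 1" "dist p' p = ?h" unfolding p' by metis+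
    have "p' - p = ((1 - s) *\<^sub>R \<psi> y + s *\<^sub>R y - p) + (s' - s) *\<^sub>R (y - \<psi> y)"
      by (simp add: p' algebra_simps)
    then have "?h = norm (((1 - s) *\<^sub>R \<psi> y + s *\<^sub>R y - p) + (s' - s) *\<^sub>R (y - \<psi> y))"
      using Q(3) by (simp only: dist_norm)
    also have "\<dots> \<le> g s + norm ((s' - s) *\<^sub>R (y - \<psi> y))"
      unfolding g_def dist_norm by (rule norm_triangle_ineq)
    finally have "?h \<le> g s + (s' - s) * norm (y - \<psi> y)" using Q(1) by simp
    moreover have "(s' - s) * norm (y - \<psi> y) \<le> (s' - s) * ((1 + L) * infdist y K)"
      using near Q by (intro mult_left_mono) auto
    ultimately have "(1 - \<kappa>) / (1 + \<kappa>) * ?h \<le> (s' - s) * ((1 + L) * infdist y K)"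
      using gs' by linarith
    then have "((1 - \<kappa>) / (1 + \<kappa>) * (vP * \<eta>)) * infdist y K \<le> ((s' - s) * (1 + L)) * infdist y K"
      by (simp only: mult.assoc)
    then have "(1 - \<kappa>) / (1 + \<kappa>) * (vP * \<eta>) \<le> (s' - s) * (1 + L)"
      using \<delta>0 by (simp only: mult_le_cancel_right_pos)
    then have "\<mu> \<le> s' - s" unfolding \<mu>_def using L by (simp only: pos_divide_le_eq)
    then show ?thesis using Q s by (simp add: dist_commute)
  qed
  then show "s' = 1 \<or> s + \<mu> \<le> s'" "0 \<le> s'" "s' \<le> 1" "dist p p' \<le> ?h" by auto
qed

text \<open>The weight grows by \<open>\<mu>\<close> per step until it is one; then each new vertex
  is the evader's last sample. From there on segments shrink by the speed ratio, and the geometric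
  series leaves the evader too little time to reach \<open>K\<close>.\<close>

lemma capture_plan_nonempty:
  assumes v: "0 < vE" "vE < vP" and K: "compact K" "convex K" "K \<noteq> {}" and zx: "z \<noteq> x"
    and strict: "\<forall>q\<in>K. vE / vP * norm (x - q) < norm (z - q)"
  obtains \<Gamma> where "pursuit_plan vE vP z x K \<Gamma>"
    "\<And>e. e 0 = z \<Longrightarrow> vE-lipschitz_on {0..} e \<Longrightarrow>
       \<exists>t\<ge>0. e t = traj vP x (\<Gamma> e) t \<and> (\<forall>s\<in>{0..t}. e s \<notin> K)"
proof -
  define \<alpha> where "\<alpha> = vE / vP"
  have vP: "0 < vP" using v by simp
  have \<alpha>: "0 < \<alpha>" "\<alpha> < 1" using v by (simp_all add: \<alpha>_def)
  have zK: "0 < norm (z - q)" if "q \<in> K" for q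
    using strict that \<alpha> mult_nonneg_nonneg[of \<alpha> "norm (x - q)"] unfolding \<alpha>_def by fastforce
  have "continuous_on K (\<lambda>q. norm (x - q) / norm (z - q))"
    using zK by (intro continuous_intros) auto
  then obtain qm where qm: "qm \<in> K"
    "\<forall>q\<in>K. norm (x - q) / norm (z - q) \<le> norm (x - qm) / norm (z - qm)"
    using continuous_attains_sup[OF K(1,3)] by blast
  \<comment> \<open>By compactness the largest guard ratio is below \<open>1 / \<alpha>\<close>. The
    midpoint of 1 and \<open>1 / \<alpha>\<close> makes \<open>L\<close> exceed 1 as well, as the
    guard map requires.\<close>
  define L where "L = max ((1 + 1 / \<alpha>) / 2) (norm (x - qm) / norm (z - qm))"
  have "(1 + 1 / \<alpha>) / 2 < 1 / \<alpha>" "1 < (1 + 1 / \<alpha>) / 2" using \<alpha> by (simp_all add: field_simps)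
  moreover have "norm (x - qm) / norm (z - qm) < 1 / \<alpha>"
    using strict qm(1) zK[OF qm(1)] \<alpha> by (simp add: \<alpha>_def[symmetric] field_simps)
  ultimately have L: "1 < L" "L < 1 / \<alpha>"
    unfolding L_def less_max_iff_disj max_less_iff_conj by blast+
  have guard: "\<forall>q\<in>K. norm (x - q) \<le> L * norm (z - q)"
  proof
    fix q assume q: "q \<in> K"
    then have "norm (x - q) / norm (z - q) \<le> L"
      unfolding L_def by (intro max.coboundedI2 bspec[OF qm(2)])
    then show "norm (x - q) \<le> L * norm (z - q)" using zK[OF q] by (simp add: pos_divide_le_eq)
  qed
  obtain \<psi> where \<psi>: "\<psi> z = x" "\<And>q. q \<in> K \<Longrightarrow> \<psi> q = q" "\<And>y. \<psi> y \<in> convex hull (insert x K)"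
    "\<And>y y'. norm (\<psi> y - \<psi> y') \<le> L * norm (y - y')"
    using guard_map_exists[OF L(1) K zx guard] by metis
  define \<kappa> where "\<kappa> = L * vE / vP"
  have \<kappa>: "\<kappa> < 1" "\<alpha> \<le> \<kappa>"
    using L v \<alpha> by (simp_all add: \<kappa>_def \<alpha>_def field_simps)
  define \<eta> where "\<eta> = (1 - \<kappa>) / (2 * vE)"
  define \<mu> where "\<mu> = (1 - \<kappa>) / (1 + \<kappa>) * (vP * \<eta>) / (1 + L)"
  have \<eta>0: "0 < \<eta>" using \<kappa> v by (simp add: \<eta>_def)
  have vE\<eta>: "vE * \<eta> = (1 - \<kappa>) / 2" using v by (simp add: \<eta>_def)
  have \<psi>K: "\<forall>q\<in>K. \<psi> q = q" using \<psi>(2) by blast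
  note progress = chase_step_progress[OF v(1) vP L(1) \<kappa>(1)[unfolded \<kappa>_def] K(1,3) \<psi>K \<psi>(4),
      folded \<kappa>_def, folded \<eta>_def, folded \<mu>_def]
  define f where "f = chase_step \<psi> K (vP * \<eta>)"
  let ?T = "wtime vP f (x, 0)" and ?P = "wpos vP f (x, 0)" and ?s = "waux vP f (x, 0)"
  have T0: "?T e 0 = 0" and TS: "?T e (Suc k) = ?T e k + dist (?P e k) (?P e (Suc k)) / vP" for e k
    by (simp, rule wtime_Suc)
  have step: "(?P e (Suc k), ?s e (Suc k)) = f (e (?T e k)) (?P e k, ?s e k)" for e k
    by (rule wstate_Suc)
  have mono: "j \<le> k \<Longrightarrow> ?T e j \<le> ?T e k" for e j k by (rule polyline_time_mono[of "?T e" "?P e" vP, OF T0 TS vP])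
  have nn: "0 \<le> ?T e k" for e k by (rule polyline_time_nonneg[of "?T e" "?P e" vP, OF T0 TS vP])
  have P_eq: "?P e (Suc k) = (1 - ?s e (Suc k)) *\<^sub>R \<psi> (e (?T e k)) + ?s e (Suc k) *\<^sub>R e (?T e k)" for e k
  proof -
    have "fst (f y s) = (1 - snd (f y s)) *\<^sub>R \<psi> y + snd (f y s) *\<^sub>R y" for y s
      by (simp add: f_def chase_step_def Let_def)
    from this[of "e (?T e k)" "(?P e k, ?s e k)"] show ?thesis
      unfolding step[symmetric] by simp
  qed
  have stay: "?s e (Suc k) = 1" if "?s e k = 1" for e k
    using step[of e k] that by (simp add: f_def chase_step_def Let_def)

  \<comment> \<open>Here \<open>y'\<close> is the evader sample from which the current vertex was
    computed, one step old; at the start it is \<open>z\<close>.\<close>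
  define running where "running = (\<lambda>e k. ?s e k < 1 \<and> of_nat k * \<mu> \<le> ?s e k \<and>
      (\<forall>t\<in>{0..?T e k}. e t \<notin> K) \<and>
      (\<exists>y'. ?P e k = (1 - ?s e k) *\<^sub>R \<psi> y' + ?s e k *\<^sub>R y' \<and>
         norm (e (?T e k) - y') \<le> vE * \<eta> * infdist y' K \<and> 0 < infdist y' K))"
  \<comment> \<open>Step \<open>j\<close> is one after which the weight stays one; the data at its
    start feed the final estimates.\<close>
  define ended where "ended = (\<lambda>e k. \<exists>j<k. (\<forall>i>j. ?s e i = 1) \<and> (\<forall>t\<in>{0..?T e j}. e t \<notin> K) \<and>
      dist (?P e j) (?P e (Suc j)) \<le> vP * \<eta> * infdist (e (?T e j)) K \<and> 0 < infdist (e (?T e j)) K)"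
  have phase: "(0 \<le> ?s e k \<and> ?s e k \<le> 1) \<and> (running e k \<or> ended e k)"
    if e: "e 0 = z" "vE-lipschitz_on {0..} e" for e k
  proof (induction k)
    case 0
    have "0 < infdist z K"
      using K zK infdist_pos_not_in_closed[of K z] by (auto simp: compact_imp_closed)
    moreover have "z \<notin> K" using zK by fastforce
    ultimately have "running e 0"
      unfolding running_def using e \<psi>(1) v \<eta>0 by (auto intro!: exI[of _ z])
    then show ?case by simp
  next
    case (Suc k)
    then consider "ended e k" | "running e k" by blast
    then show ?case
    proof cases
      case 1
      then have "ended e (Suc k)" "?s e (Suc k) = 1" unfolding ended_def by (auto intro: less_SucI)
      then show ?thesis by simp
    next
      case 2
      then obtain y' where s: "?s e k < 1" "of_nat k * \<mu> \<le> ?s e k" and free: "\<forall>t\<in>{0..?T e k}. e t \<notin> K"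
        and y': "?P e k = (1 - ?s e k) *\<^sub>R \<psi> y' + ?s e k *\<^sub>R y'"
         "norm (e (?T e k) - y') \<le> vE * \<eta> * infdist y' K" "0 < infdist y' K"
        unfolding running_def by blast
      have s0: "0 \<le> ?s e k" using Suc by simp
      have "chase_step \<psi> K (vP * \<eta>) (e (?T e k)) (?P e k, ?s e k) = (?P e (Suc k), ?s e (Suc k))"
        using step[of e k] by (simp only: f_def)
      note pr = progress[OF s0 s(1) y' this]
      show ?thesis
      proof (cases "?s e (Suc k) = 1")
        case True
        have "\<forall>i>k. ?s e i = 1"
        proof (intro allI impI)
          fix i assume "k < i"
          then have "Suc k \<le> i" by simp
          then show "?s e i = 1"
            by (induction i rule: dec_induct) (use True stay in auto)
        qed
        then have "ended e (Suc k)" unfolding ended_def using free pr(5,6) by blast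
        then show ?thesis using True by simp
      next
        case False
        have d: "dist (?P e k) (?P e (Suc k)) / vP \<le> \<eta> * infdist (e (?T e k)) K"
          using pr(5) vP by (simp add: field_simps)
        have close: "norm (e t - e (?T e k)) \<le> vE * \<eta> * infdist (e (?T e k)) K"
          if t: "?T e k \<le> t" "t \<le> ?T e (Suc k)" for t
        proof -
          have "norm (e t - e (?T e k)) \<le> vE * (t - ?T e k)"
            by (rule lipschitz_on_nonneg_D[OF e(2) nn t(1)])
          also have "\<dots> \<le> vE * (\<eta> * infdist (e (?T e k)) K)"
            using t d TS[of e k] v by (intro mult_left_mono) auto
          finally show ?thesis by simp
        qed
        \<comment> \<open>The factor is \<open>(1 - \<kappa>) / 2\<close>, so in one step the evader
          covers less than its distance to \<open>K\<close>.\<close>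
        have lt: "vE * \<eta> * infdist (e (?T e k)) K < infdist (e (?T e k)) K"
          unfolding vE\<eta> using \<kappa> \<alpha> pr(6) by simp
        have "e t \<notin> K" if t: "t \<in> {0..?T e (Suc k)}" for t
        proof (cases "t \<le> ?T e k")
          case False
          show ?thesis
          proof
            assume "e t \<in> K"
            then have "infdist (e (?T e k)) K \<le> dist (e (?T e k)) (e t)" by (rule infdist_le)
            then show False using close[of t] lt False t by (simp add: dist_norm norm_minus_commute)
          qed
        qed (use free t in auto)
        moreover have "of_nat (Suc k) * \<mu> \<le> ?s e (Suc k)"
          using s(2) pr(2) False by (simp add: distrib_right)
        moreover have "norm (e (?T e (Suc k)) - e (?T e k)) \<le> vE * \<eta> * infdist (e (?T e k)) K"
          using mono[of k "Suc k" e] by (intro close) auto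
        moreover have "?s e (Suc k) < 1" using pr(4) False by simp
        ultimately have "running e (Suc k)"
          unfolding running_def using P_eq[of e k] pr(6)
          by (intro conjI exI[of _ "e (?T e k)"] ballI)
        then show ?thesis using pr(3,4) by blast
      qed
    qed
  qed
  have "0 < \<mu>" unfolding \<mu>_def using v vP L \<kappa> \<alpha> \<eta>0
    by (intro divide_pos_pos mult_pos_pos) auto
  \<comment> \<open>If the first phase were still running at step \<open>N\<close>, the weight would
    be at least \<open>N * \<mu>\<close>, hence above one.\<close>
  then obtain N :: nat where N: "1 < of_nat N * \<mu>" using reals_Archimedean3 by blast

  have final: "\<exists>j. (\<forall>i>j. ?P e (Suc i) = e (?T e i)) \<and> ?P e (Suc j) = e (?T e j) \<and>
      (\<forall>t\<in>{0..?T e j}. e t \<notin> K) \<and> 0 < infdist (e (?T e j)) K \<and>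
      (\<forall>k. ?T e k \<le> ?T e j + \<eta> * infdist (e (?T e j)) K / (1 - \<alpha>))"
    if e: "e 0 = z" "vE-lipschitz_on {0..} e" for e
  proof -
    have "\<not> running e N" using phase[OF e, of N] N unfolding running_def by fastforce
    then have "ended e N" using phase[OF e, of N] by blast
    then obtain j where j: "\<forall>i>j. ?s e i = 1" "\<forall>t\<in>{0..?T e j}. e t \<notin> K"
      "dist (?P e j) (?P e (Suc j)) \<le> vP * \<eta> * infdist (e (?T e j)) K" "0 < infdist (e (?T e j)) K"
      unfolding ended_def by blast
    have Pj: "?P e (Suc i) = e (?T e i)" if "j \<le> i" for i
      using P_eq[of e i] j(1) that by simp
    let ?D = "\<eta> * infdist (e (?T e j)) K"
    have D0: "0 < ?D" using \<eta>0 j(4) by simp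
    \<comment> \<open>Every segment after the one starting at \<open>j\<close> joins two successive
      evader samples, so it lasts at most \<open>\<alpha>\<close> times as long as its
      predecessor.\<close>
    have bound: "?T e (j + i) \<le> ?T e j + ?D * (\<Sum>r<i. \<alpha> ^ r) \<and> ?T e (Suc (j + i)) - ?T e (j + i) \<le> ?D * \<alpha> ^ i" for i
    proof (induction i)
      case 0
      have "dist (?P e j) (?P e (Suc j)) / vP \<le> ?D"
        using j(3) vP by (simp add: pos_divide_le_eq mult_ac)
      then show ?case using TS[of e j] by simp
    next
      case (Suc i)
      have "?T e (Suc (Suc (j + i))) - ?T e (Suc (j + i)) = norm (e (?T e (Suc (j + i))) - e (?T e (j + i))) / vP"
        using TS[of e "Suc (j + i)"] Pj[of "j + i"] Pj[of "Suc (j + i)"]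
        by (simp add: dist_norm norm_minus_commute)
      also have "\<dots> \<le> vE * (?T e (Suc (j + i)) - ?T e (j + i)) / vP"
        using lipschitz_on_nonneg_D[OF e(2) nn mono[of "j + i" "Suc (j + i)"]] vP
        by (intro divide_right_mono) auto
      also have "\<dots> = \<alpha> * (?T e (Suc (j + i)) - ?T e (j + i))" by (simp add: \<alpha>_def)
      also have "\<dots> \<le> \<alpha> * (?D * \<alpha> ^ i)" using Suc \<alpha> by (intro mult_left_mono) auto
      finally show ?case using Suc by (simp add: algebra_simps)
    qed
    have "?T e k \<le> ?T e j + ?D / (1 - \<alpha>)" for k
    proof -
      have "?T e k \<le> ?T e (j + k)" by (rule mono) simp
      also have "\<dots> \<le> ?T e j + ?D * (\<Sum>r<k. \<alpha> ^ r)" using bound[of k] by blast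
      also have "(\<Sum>r<k. \<alpha> ^ r) = (1 - \<alpha> ^ k) / (1 - \<alpha>)"
        using \<alpha> by (simp add: sum_gp_strict)
      also have "?D * ((1 - \<alpha> ^ k) / (1 - \<alpha>)) \<le> ?D * (1 / (1 - \<alpha>))"
        using D0 \<alpha> by (intro mult_left_mono divide_right_mono) auto
      finally show ?thesis by simp
    qed
    then have "\<forall>k. ?T e k \<le> ?T e j + ?D / (1 - \<alpha>)" by blast
    moreover have "\<forall>i>j. ?P e (Suc i) = e (?T e i)" "?P e (Suc j) = e (?T e j)"
      by (simp_all add: Pj)
    ultimately show ?thesis using j(2,4) by (intro exI[of _ j] conjI)
  qed
  have zeno: "(\<lambda>k. dist (e (?T e k)) (?P e k)) \<longlonglongrightarrow> 0"
    if e: "e 0 = z" "vE-lipschitz_on {0..} e" for e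
  proof -
    obtain j where j: "\<forall>i>j. ?P e (Suc i) = e (?T e i)"
      "\<forall>k. ?T e k \<le> ?T e j + \<eta> * infdist (e (?T e j)) K / (1 - \<alpha>)" using final[OF e] by blast
    have "incseq (?T e)" using mono by (simp add: incseq_def)
    then obtain M where M: "?T e \<longlonglongrightarrow> M" using incseq_convergent[of "?T e"] j(2) by metis
    have lim: "(\<lambda>k. vE * (?T e (Suc k) - ?T e k)) \<longlonglongrightarrow> vE * (M - M)"
      by (rule tendsto_mult_left[OF tendsto_diff[OF LIMSEQ_Suc[OF M] M]])
    have "norm (dist (e (?T e (Suc i))) (?P e (Suc i))) \<le> vE * (?T e (Suc i) - ?T e i)" if "j < i" for i
      using lipschitz_on_nonneg_D[OF e(2) nn mono[of i "Suc i"]] j(1) that by (simp add: dist_norm)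
    then have "\<forall>\<^sub>F i in sequentially. norm (dist (e (?T e (Suc i))) (?P e (Suc i))) \<le> vE * (?T e (Suc i) - ?T e i)"
      using eventually_gt_at_top[of j] by (rule eventually_mono[rotated])
    then have "(\<lambda>k. dist (e (?T e (Suc k))) (?P e (Suc k))) \<longlonglongrightarrow> 0"
      by (rule Lim_null_comparison[OF _ lim[unfolded diff_self mult_zero_right]])
    then show ?thesis by (rule LIMSEQ_imp_Suc)
  qed
  show thesis
  proof (rule that)
    show "pursuit_plan vE vP z x K (waypoint_control vP f (x, 0))"
    proof (rule waypoint_plan[OF vP])
      fix e :: "real \<Rightarrow> point" and k assume e: "e 0 = z" "vE-lipschitz_on {0..} e"
      let ?y = "e (?T e k)"
      let ?H = "convex hull (insert ?y (insert (?P e k) (insert x K)))"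
      have "\<psi> ?y \<in> ?H"
        by (rule subsetD[OF hull_mono \<psi>(3)]) auto
      moreover have "?y \<in> ?H" by (simp add: hull_inc)
      moreover have "0 \<le> ?s e (Suc k)" "?s e (Suc k) \<le> 1" using phase[OF e] by auto
      ultimately show "?P e (Suc k) \<in> ?H"
        unfolding P_eq by (intro convexD_alt convex_convex_hull)
    next
      show "(\<lambda>k. dist (e (?T e k)) (?P e k)) \<longlonglongrightarrow> 0" if "e 0 = z" "vE-lipschitz_on {0..} e" for e
        using that by (rule zeno)
    qed simp
  next
    fix e :: "real \<Rightarrow> point"
    assume e: "e 0 = z" "vE-lipschitz_on {0..} e"
    obtain j where j: "\<forall>t\<in>{0..?T e j}. e t \<notin> K" "0 < infdist (e (?T e j)) K"
      "\<And>k. ?T e k \<le> ?T e j + \<eta> * infdist (e (?T e j)) K / (1 - \<alpha>)" using final[OF e] by blast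
    let ?D = "\<eta> * infdist (e (?T e j)) K / (1 - \<alpha>)"
    obtain t where t: "0 \<le> t" "t \<le> ?T e j + ?D" "e t = traj vP x (waypoint_control vP f (x, 0) e) t"
      by (rule waypoint_capture[OF vP e(2) j(3) zeno[OF e]], unfold fst_conv)
    have "e s \<notin> K" if s: "s \<in> {0..t}" for s
    proof (cases "s \<le> ?T e j")
      case False
      show ?thesis
      proof
        assume "e s \<in> K"
        then have "infdist (e (?T e j)) K \<le> dist (e (?T e j)) (e s)" by (rule infdist_le)
        also have "\<dots> \<le> vE * (s - ?T e j)"
          using lipschitz_on_nonneg_D[OF e(2) nn[of e j], of s] False by (simp add: dist_norm norm_minus_commute)
        also have "\<dots> \<le> vE * ?D" using s t v by (intro mult_left_mono) auto
        \<comment> \<open>Since \<open>\<alpha> \<le> \<kappa>\<close>, the whole geometric tail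
          lets the evader cover at most half of its distance to \<open>K\<close>.\<close>
        also have "\<dots> = (1 - \<kappa>) / 2 / (1 - \<alpha>) * infdist (e (?T e j)) K"
          unfolding vE\<eta>[symmetric] by simp
        also have "\<dots> \<le> 1 / 2 * infdist (e (?T e j)) K"
          using \<kappa> \<alpha> j(2) by (intro mult_right_mono) (auto simp: field_simps)
        finally show False using j(2) by simp
      qed
    qed (use j(1) s in auto)
    then show "\<exists>t\<ge>0. e t = traj vP x (waypoint_control vP f (x, 0) e) t \<and> (\<forall>s\<in>{0..t}. e s \<notin> K)"
      using t by blast
  qed
qed

lemma capture_plan:
  assumes v: "0 < vE" "vE < vP" and K: "compact K" "convex K"
    and strict: "\<forall>q\<in>K. vE / vP * norm (x - q) < norm (z - q)"
  obtains \<Gamma> where "pursuit_plan vE vP z x K \<Gamma>"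
    "\<And>e. e 0 = z \<Longrightarrow> vE-lipschitz_on {0..} e \<Longrightarrow>
       \<exists>t\<ge>0. e t = traj vP x (\<Gamma> e) t \<and> (\<forall>s\<in>{0..t}. e s \<notin> K)"
proof (cases "z = x")
  case True
  have zK: "z \<notin> K"
  proof
    assume "z \<in> K"
    then have "vE / vP * norm (x - z) < norm (z - z)" using strict by blast
    then show False using v by (simp add: True)
  qed
  show thesis
  \<comment> \<open>With equal starting points the capture is at time zero, where the constraint on
    the pursuer ends; a constant control will do.\<close>
  proof (rule that[of "\<lambda>_ _. axis 1 1"])
    show "pursuit_plan vE vP z x K (\<lambda>_ _. axis 1 1)"
      unfolding pursuit_plan_def
    proof (intro conjI allI impI ballI; (elim conjE)?)
      show "(\<lambda>_. axis 1 1) \<in> controls" by (simp add: controls_def)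
    next
      fix e :: "real \<Rightarrow> point" and A t
      assume e: "e 0 = z" "x \<in> A" "0 \<le> t" "\<forall>s\<in>{0..<t}. e s \<noteq> traj vP x (\<lambda>_. axis 1 1) s"
      have "t = 0"
      proof (rule ccontr)
        assume "t \<noteq> 0"
        then have "0 \<in> {0..<t}" using e(3) by simp
        then have "e 0 \<noteq> traj vP x (\<lambda>_. axis 1 1) 0" by (rule bspec[OF e(4)])
        then show False using e(1) True by simp
      qed
      then show "traj vP x (\<lambda>_. axis 1 1) t \<in> A" using e by simp
    qed simp
    show "\<exists>t\<ge>0. e t = traj vP x (\<lambda>_. axis 1 1) t \<and> (\<forall>s\<in>{0..t}. e s \<notin> K)" if "e 0 = z" for e
      using that zK True by (intro exI[of _ 0]) auto
  qed
next
  case False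
  show thesis
  proof (cases "K = {}")
    case True
    obtain \<Gamma> where \<Gamma>: "pursuit_plan vE vP z x {x} \<Gamma>"
      "\<And>e. e 0 = z \<Longrightarrow> vE-lipschitz_on {0..} e \<Longrightarrow>
         \<exists>t\<ge>0. e t = traj vP x (\<Gamma> e) t \<and> (\<forall>s\<in>{0..t}. e s \<notin> {x})"
      by (rule capture_plan_nonempty[OF v, of "{x}" z x]) (use False in auto)
    have "pursuit_plan vE vP z x K \<Gamma>" using \<Gamma>(1) by (simp add: pursuit_plan_insert True)
    then show thesis using that[of \<Gamma>] \<Gamma>(2) True by blast
  next
    case False
    with \<open>z \<noteq> x\<close> show thesis by (intro capture_plan_nonempty[OF v K _ _ strict that])
  qed
qed

section \<open>Sufficient conditions for both sides in a general arena\<close>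

section \<open>The barrier of a reach-avoid game\<close>

text \<open>This covers both games: in the domain \<open>G\<close> is the whole target region and
  \<open>T\<close> its edge, in the free game both are the segment. Two assumptions link them:
  \<open>sight\<close> clears the evader's straight run, and \<open>entry\<close> lets the pursuers
  defend \<open>T\<close> in place of \<open>G\<close>.\<close>

locale reach_avoid =
  fixes A G S T :: "point set" and vP vE :: real and I :: "nat set" and x :: "nat \<Rightarrow> point"
  assumes convex_A: "convex A" and closed_G: "closed G" and T: "compact T" "convex T"
    and TG: "T \<subseteq> G" and TA: "T \<subseteq> A" and S: "S \<subseteq> A - G"
    and sight: "\<And>z q. z \<in> S \<Longrightarrow> q \<in> T \<Longrightarrow> open_segment z q \<inter> G = {}"
    and entry: "\<And>e t. continuous_on {0..} e \<Longrightarrow> e 0 \<in> S \<Longrightarrow> 0 \<le> (t::real) \<Longrightarrow> (\<And>s. s \<in> {0..t} \<Longrightarrow> e s \<in> A) \<Longrightarrow>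
      (\<And>s. s \<in> {0..<t} \<Longrightarrow> e s \<notin> G) \<Longrightarrow> e t \<in> G \<Longrightarrow> e t \<in> T"
    and fin: "finite I" and I: "I \<noteq> {}" and xA: "\<And>i. i \<in> I \<Longrightarrow> x i \<in> A"
    and v: "0 < vE" "vE < vP"
begin

lemma vP: "0 < vP" using v by simp

lemma evader_lipschitz:
  "u \<in> evader_controls A G vE z \<Longrightarrow> vE-lipschitz_on {0..} (traj vE z u)"
  using v by (intro traj_lipschitz) (auto simp: evader_controls_def)

lemma closed_subset_Icc_compact: "closed C \<Longrightarrow> C \<subseteq> {a..b :: real} \<Longrightarrow> compact C"
  using compact_Int_closed[OF compact_Icc[of a b], of C] by (simp add: Int_absorb1)

lemma first_entry:
  assumes u: "u \<in> evader_controls A G vE z" and z: "z \<in> S" and t: "0 \<le> t" "traj vE z u t \<in> G"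
  obtains t0 where "0 \<le> t0" "t0 \<le> t" "traj vE z u t0 \<in> T" "\<And>s. s \<in> {0..<t0} \<Longrightarrow> traj vE z u s \<notin> G"
proof -
  let ?e = "traj vE z u"
  have cont: "continuous_on {0..} ?e" using evader_lipschitz[OF u] by (rule lipschitz_on_continuous_on)
  define C where "C = {0..t} \<inter> ?e -` G"
  have "closed C"
    unfolding C_def
    by (rule continuous_closed_preimage[OF continuous_on_subset[OF cont] _ closed_G]) auto
  moreover have "C \<subseteq> {0..t}" by (simp add: C_def)
  ultimately have "compact C" by (rule closed_subset_Icc_compact)
  moreover have "t \<in> C" using t by (simp add: C_def)
  ultimately obtain t0 where t0: "t0 \<in> C" "\<forall>s\<in>C. t0 \<le> s"
    using compact_attains_inf[of C] by blast
  have before: "?e s \<notin> G" if "s \<in> {0..<t0}" for s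
  proof
    assume "?e s \<in> G"
    then have "s \<in> C" using t0(1) that unfolding C_def by auto
    then show False using t0(2) that by force
  qed
  moreover have "?e t0 \<in> T"
  proof (rule entry[OF cont])
    show "?e s \<in> A" if "s \<in> {0..t0}" for s
      using u that before unfolding evader_controls_def by auto
  qed (use z t0 before in \<open>auto simp: C_def\<close>)
  ultimately show thesis using that t0 unfolding C_def by auto
qed

lemma plans_strategy:
  assumes plans: "\<And>i. i \<in> I \<Longrightarrow> pursuit_plan vE vP z (x i) (K i) (\<Gamma> i)" and K: "\<And>i. i \<in> I \<Longrightarrow> K i \<subseteq> A"
  shows "(\<lambda>u i. \<Gamma> i (traj vE z u)) \<in> pursuit_strategies A G vP vE I x z"
  unfolding pursuit_strategies_def
proof (intro CollectI conjI ballI allI impI)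
  fix u i assume u: "u \<in> evader_controls A G vE z" and i: "i \<in> I"
  show "\<Gamma> i (traj vE z u) \<in> controls"
    using plans[OF i] evader_lipschitz[OF u] unfolding pursuit_plan_def by simp
next
  fix u w :: control and t :: real and i
  assume ae: "AE s in lebesgue. 0 \<le> s \<and> s \<le> t \<longrightarrow> u s = w s" and i: "i \<in> I"
  have "\<forall>s\<in>{0..t}. traj vE z u s = traj vE z w s" using traj_cong_AE[OF ae] by simp
  then have "\<forall>s\<in>{0..t}. \<Gamma> i (traj vE z u) s = \<Gamma> i (traj vE z w) s"
    using plans[OF i] unfolding pursuit_plan_def by blast
  then show "AE s in lebesgue. 0 \<le> s \<and> s \<le> t \<longrightarrow> \<Gamma> i (traj vE z u) s = \<Gamma> i (traj vE z w) s" by simp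
next
  fix u i t
  assume u: "u \<in> evader_controls A G vE z" and i: "i \<in> I" and t: "0 \<le> t"
    and prog: "in_progress G I (traj vE z u) (\<lambda>i. traj vP (x i) (\<Gamma> i (traj vE z u))) t"
  have "\<forall>s\<in>{0..t}. traj vE z u s \<in> A"
    using u prog unfolding evader_controls_def in_progress_def by auto
  moreover have "\<forall>s\<in>{0..<t}. traj vE z u s \<noteq> traj vP (x i) (\<Gamma> i (traj vE z u)) s"
    using prog i unfolding in_progress_def by blast
  moreover have "traj vE z u 0 = z" by simp
  ultimately show "traj vP (x i) (\<Gamma> i (traj vE z u)) t \<in> A"
    using plans[OF i] evader_lipschitz[OF u] t K[OF i] xA[OF i] convex_A unfolding pursuit_plan_def
    by blast
qed

lemma strategy_controls:
  "\<gamma> \<in> pursuit_strategies A G vP vE I x z \<Longrightarrow> u \<in> evader_controls A G vE z \<Longrightarrow> i \<in> I \<Longrightarrow> \<gamma> u i \<in> controls"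
  unfolding pursuit_strategies_def by blast

text \<open>The Voronoi cell of \<open>x i\<close>, cut with \<open>T\<close>. Ties belong to every
  nearest pursuer, which keeps the cells closed.\<close>

definition zone :: "nat \<Rightarrow> point set" where
  "zone i = {q \<in> T. \<forall>j\<in>I. norm (x i - q) \<le> norm (x j - q)}"

lemma zone_compact: "compact (zone i)" and zone_convex: "convex (zone i)"
proof -
  \<comment> \<open>The squared norm of \<open>q\<close> cancels, leaving a half-plane.\<close>
  have half: "norm (x i - q) \<le> norm (x j - q) \<longleftrightarrow>
      (2 *\<^sub>R (x j - x i)) \<bullet> q \<le> (norm (x j))\<^sup>2 - (norm (x i))\<^sup>2" for j q
    unfolding norm_le power2_norm_eq_inner
    by (auto simp: inner_diff_left inner_diff_right inner_commute)
  have eq: "zone i = T \<inter> (\<Inter>j\<in>I. {q. (2 *\<^sub>R (x j - x i)) \<bullet> q \<le> (norm (x j))\<^sup>2 - (norm (x i))\<^sup>2})"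
    unfolding zone_def half by blast
  show "compact (zone i)"
    unfolding eq using T by (intro compact_Int_closed closed_INT ballI closed_halfspace_le)
  show "convex (zone i)"
    unfolding eq using T by (intro convex_Int convex_INT convex_halfspace_le)
qed

lemma zone_cover:
  assumes "q \<in> T"
  obtains i where "i \<in> I" "q \<in> zone i"
proof -
  obtain i where "i \<in> I" "\<forall>j\<in>I. norm (x i - q) \<le> norm (x j - q)"
    using ex_min_if_finite[of "(\<lambda>i. norm (x i - q)) ` I"] fin I by fastforce
  then show thesis using that assms by (auto simp: zone_def)
qed

lemma zone_subset: "zone i \<subseteq> T" by (auto simp: zone_def)

lemma pursuers_win_if:
  assumes z: "z \<in> S" and dom: "\<forall>q\<in>T. \<exists>i\<in>I. vE / vP * norm (x i - q) < norm (z - q)"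
  shows "z \<in> pursuit_winning_region A G S vP vE I x"
proof -
  have "\<exists>\<Gamma>. pursuit_plan vE vP z (x i) (zone i) \<Gamma> \<and>
      (\<forall>e. e 0 = z \<longrightarrow> vE-lipschitz_on {0..} e \<longrightarrow>
         (\<exists>t\<ge>0. e t = traj vP (x i) (\<Gamma> e) t \<and> (\<forall>s\<in>{0..t}. e s \<notin> zone i)))" for i
  proof -
    have st: "\<forall>q\<in>zone i. vE / vP * norm (x i - q) < norm (z - q)"
    proof
      fix q assume q: "q \<in> zone i"
      then obtain j where j: "j \<in> I" "vE / vP * norm (x j - q) < norm (z - q)"
        using dom zone_subset by blast
      have "vE / vP * norm (x i - q) \<le> vE / vP * norm (x j - q)"
        using q j(1) v by (intro mult_left_mono) (auto simp: zone_def)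
      then show "vE / vP * norm (x i - q) < norm (z - q)" using j(2) by linarith
    qed
    show ?thesis
      by (rule capture_plan[OF v zone_compact zone_convex st]) blast
  qed
  then obtain \<Gamma> where plan: "\<And>i. pursuit_plan vE vP z (x i) (zone i) (\<Gamma> i)"
    and cap: "\<And>i e. e 0 = z \<Longrightarrow> vE-lipschitz_on {0..} e \<Longrightarrow>
         \<exists>t\<ge>0. e t = traj vP (x i) (\<Gamma> i e) t \<and> (\<forall>s\<in>{0..t}. e s \<notin> zone i)"
    by metis
  have "\<forall>u\<in>evader_controls A G vE z.
      pursuers_win A G I (traj vE z u) (\<lambda>i. traj vP (x i) (\<Gamma> i (traj vE z u)))"
  proof
    fix u assume u: "u \<in> evader_controls A G vE z"
    let ?e = "traj vE z u"
    have "\<exists>t. \<forall>i. t i \<ge> 0 \<and> ?e (t i) = traj vP (x i) (\<Gamma> i ?e) (t i) \<and> (\<forall>s\<in>{0..t i}. ?e s \<notin> zone i)"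
      using cap[OF traj_0 evader_lipschitz[OF u]] by (intro choice allI) blast
    then obtain t where t: "\<And>i. t i \<ge> 0" "\<And>i. ?e (t i) = traj vP (x i) (\<Gamma> i ?e) (t i)"
      "\<And>i. \<forall>s\<in>{0..t i}. ?e s \<notin> zone i" by blast
    \<comment> \<open>Up to the earliest of the separate capture times the evader has entered no
      zone, hence not \<open>T\<close>, and by \<open>first_entry\<close> not \<open>G\<close>
      either.\<close>
    obtain m where m: "m \<in> I" "\<forall>j\<in>I. t m \<le> t j"
      using ex_min_if_finite[of "t ` I"] fin I by fastforce
    have noT: "?e s \<notin> T" if "s \<in> {0..t m}" for s
    proof
      assume "?e s \<in> T"
      then obtain i where "i \<in> I" "?e s \<in> zone i" by (rule zone_cover)
      then show False using t(3)[of i] m that by force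
    qed
    have noG: "\<forall>s\<in>{0..t m}. ?e s \<notin> G"
    proof (intro ballI notI)
      fix s assume s: "s \<in> {0..t m}" "?e s \<in> G"
      then have "0 \<le> s" by simp
      then show False
        by (rule first_entry[OF u z _ s(2)]) (use noT s(1) in auto)
    qed
    then have "?e (t m) \<in> A" using u t(1)[of m] unfolding evader_controls_def by auto
    moreover have "?e (t m) \<notin> G" using noG t(1)[of m] by simp
    ultimately have "?e (t m) \<in> A - G" by (rule DiffI)
    then show "pursuers_win A G I ?e (\<lambda>i. traj vP (x i) (\<Gamma> i ?e))"
      unfolding pursuers_win_def using noG t(1,2)[of m] m(1)
      by (intro exI[of _ "t m"] conjI bexI[of _ m])
  qed
  moreover have "(\<lambda>u i. \<Gamma> i (traj vE z u)) \<in> pursuit_strategies A G vP vE I x z"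
    using zone_subset TA by (intro plans_strategy[OF plan]) auto
  ultimately show ?thesis
    unfolding pursuit_winning_region_def using z
    by (intro CollectI conjI bexI[of _ "\<lambda>u i. \<Gamma> i (traj vE z u)"])
qed

lemma evader_not_wins_if:
  assumes z: "z \<in> S" and dom: "\<forall>q\<in>T. \<exists>i\<in>I. vE / vP * norm (x i - q) \<le> norm (z - q)"
  shows "z \<notin> evader_winning_region A G S vP vE I x"
proof
  assume "z \<in> evader_winning_region A G S vP vE I x"
  then obtain \<phi> where \<phi>: "\<And>\<gamma>. \<gamma> \<in> pursuit_strategies A G vP vE I x z \<Longrightarrow>
      closed_loop_controls A G vP vE I x z \<phi> \<gamma> \<noteq> {} \<and>
      (\<forall>u\<in>closed_loop_controls A G vP vE I x z \<phi> \<gamma>.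
         evader_wins G I (traj vE z u) (\<lambda>i. traj vP (x i) (\<gamma> u i)))"
    unfolding evader_winning_region_def by blast
  have "\<exists>\<Gamma>. pursuit_plan vE vP z (x i) (zone i) \<Gamma> \<and>
      (\<forall>e t. e 0 = z \<longrightarrow> vE-lipschitz_on {0..} e \<longrightarrow> 0 \<le> t \<longrightarrow> e t \<in> zone i \<longrightarrow>
         (\<exists>s\<in>{0..t}. e s = traj vP (x i) (\<Gamma> e) s))" for i
  proof -
    have st: "\<forall>q\<in>zone i. vE / vP * norm (x i - q) \<le> norm (z - q)"
    proof
      fix q assume q: "q \<in> zone i"
      then obtain j where j: "j \<in> I" "vE / vP * norm (x j - q) \<le> norm (z - q)"
        using dom zone_subset by blast
      have "vE / vP * norm (x i - q) \<le> vE / vP * norm (x j - q)"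
        using q j(1) v by (intro mult_left_mono) (auto simp: zone_def)
      then show "vE / vP * norm (x i - q) \<le> norm (z - q)" using j(2) by linarith
    qed
    show ?thesis
      by (rule hold_plan[OF v zone_compact zone_convex st]) blast
  qed
  then obtain \<Gamma> where plan: "\<And>i. pursuit_plan vE vP z (x i) (zone i) (\<Gamma> i)"
    and hold: "\<And>i e t. e 0 = z \<Longrightarrow> vE-lipschitz_on {0..} e \<Longrightarrow> 0 \<le> t \<Longrightarrow> e t \<in> zone i \<Longrightarrow>
         \<exists>s\<in>{0..t}. e s = traj vP (x i) (\<Gamma> i e) s"
    by metis
  let ?\<gamma> = "\<lambda>u i. \<Gamma> i (traj vE z u)"
  have "?\<gamma> \<in> pursuit_strategies A G vP vE I x z"
    using zone_subset TA by (intro plans_strategy[OF plan]) auto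
  \<comment> \<open>A winning law must generate some play against this strategy; that play is the
    one refuted.\<close>
  then obtain u where u: "u \<in> evader_controls A G vE z"
    and win: "evader_wins G I (traj vE z u) (\<lambda>i. traj vP (x i) (?\<gamma> u i))"
    using \<phi>[of ?\<gamma>] unfolding closed_loop_controls_def by blast
  obtain t where t: "0 \<le> t" "traj vE z u t \<in> G"
    and free: "\<forall>s\<in>{0..t}. \<forall>i\<in>I. traj vE z u s \<noteq> traj vP (x i) (?\<gamma> u i) s"
    using win unfolding evader_wins_def by blast
  obtain t0 where t0: "0 \<le> t0" "t0 \<le> t" "traj vE z u t0 \<in> T" by (rule first_entry[OF u z t])
  obtain i where i: "i \<in> I" "traj vE z u t0 \<in> zone i" using t0(3) by (rule zone_cover)
  show False
    using hold[OF traj_0 evader_lipschitz[OF u] t0(1) i(2)] free i(1) t0(2) by fastforce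
qed

section \<open>The evader's straight run to a point of the target\<close>

context
  fixes z q :: point
  assumes z: "z \<in> S" and q: "q \<in> T"
begin

lemma ray_pos: "z \<noteq> q" using z q S TG by auto

lemma ray_point:
  assumes "0 \<le> s" "s \<le> norm (z - q) / vE"
  shows "z + (vE * s) *\<^sub>R sgn (q - z) = (1 - vE * s / norm (z - q)) *\<^sub>R z + (vE * s / norm (z - q)) *\<^sub>R q"
    "0 \<le> vE * s / norm (z - q)" "vE * s / norm (z - q) \<le> 1"
proof -
  let ?r = "vE * s / norm (z - q)"
  have "(vE * s) *\<^sub>R sgn (q - z) = ?r *\<^sub>R (q - z)"
    by (simp add: sgn_div_norm norm_minus_commute[of q z] divide_inverse)
  moreover have "z + \<rho> *\<^sub>R (q - z) = (1 - \<rho>) *\<^sub>R z + \<rho> *\<^sub>R q" for \<rho>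
    by (simp add: algebra_simps)
  ultimately show "z + (vE * s) *\<^sub>R sgn (q - z) = (1 - ?r) *\<^sub>R z + ?r *\<^sub>R q" by simp
  show "0 \<le> ?r" using assms v by simp
  show "?r \<le> 1" using ray_pos assms v by (simp add: pos_divide_le_eq pos_le_divide_eq mult.commute)
qed

lemma ray_end: "z + (vE * (norm (z - q) / vE)) *\<^sub>R sgn (q - z) = q"
  using ray_pos v by (simp add: sgn_div_norm norm_minus_commute[of q z])

lemma ray_in_A:
  assumes "0 \<le> s" "s \<le> norm (z - q) / vE"
  shows "z + (vE * s) *\<^sub>R sgn (q - z) \<in> A"
  unfolding ray_point(1)[OF assms]
  using ray_point(2,3)[OF assms] z q S TA by (intro convexD_alt[OF convex_A]) auto

lemma ray_not_in_G:
  assumes "0 \<le> s" "s < norm (z - q) / vE"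
  shows "z + (vE * s) *\<^sub>R sgn (q - z) \<notin> G"
proof (cases "s = 0")
  case True
  then show ?thesis using z S by auto
next
  case False
  let ?r = "vE * s / norm (z - q)"
  have "0 < ?r" "?r < 1" using False assms v ray_pos by (simp_all add: field_simps)
  then have "(1 - ?r) *\<^sub>R z + ?r *\<^sub>R q \<in> open_segment z q"
    using ray_pos in_segment(2) by blast
  then show ?thesis using sight[OF z q] ray_point(1)[of s] assms by auto
qed

lemma ray_dist:
  assumes "0 \<le> s" "s \<le> norm (z - q) / vE"
  shows "norm (z + (vE * s) *\<^sub>R sgn (q - z) - q) = norm (z - q) - vE * s"
proof -
  let ?r = "vE * s / norm (z - q)"
  have "z + (vE * s) *\<^sub>R sgn (q - z) - q = (1 - ?r) *\<^sub>R (z - q)"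
    unfolding ray_point(1)[OF assms] by (simp add: algebra_simps)
  then have "norm (z + (vE * s) *\<^sub>R sgn (q - z) - q) = (1 - ?r) * norm (z - q)"
    using ray_point(3)[OF assms] by simp
  then show ?thesis using ray_pos by (simp add: left_diff_distrib)
qed

lemma ray_control: "(\<lambda>_. sgn (q - z)) \<in> evader_controls A G vE z"
  unfolding evader_controls_def
proof (intro CollectI conjI allI impI)
  show "(\<lambda>_. sgn (q - z)) \<in> controls" using ray_pos by (simp add: controls_def norm_sgn)
  fix t :: real
  assume t: "0 \<le> t" "\<forall>s\<in>{0..<t}. traj vE z (\<lambda>_. sgn (q - z)) s \<notin> G"
  have "t \<le> norm (z - q) / vE"
  proof (rule ccontr)
    assume "\<not> ?thesis"
    then have "norm (z - q) / vE \<in> {0..<t}" using v by simp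
    then have "traj vE z (\<lambda>_. sgn (q - z)) (norm (z - q) / vE) \<notin> G" by (rule bspec[OF t(2)])
    then show False using v q TG ray_end by (auto simp: traj_const)
  qed
  then show "traj vE z (\<lambda>_. sgn (q - z)) t \<in> A" using t ray_in_A by (simp add: traj_const)
qed

text \<open>The triangle inequality through the meeting point: an interceptor cannot start farther
  from \<open>q\<close> than its own path so far plus the evader's remaining way.\<close>

lemma ray_meets_late:
  assumes w: "w \<in> controls" and s: "0 \<le> s" "s \<le> norm (z - q) / vE"
    and meet: "traj vP y w s = z + (vE * s) *\<^sub>R sgn (q - z)"
  shows "norm (y - q) \<le> vP * s + norm (z - q) - vE * s"
proof -
  have "norm (y - q) \<le> norm (y - traj vP y w s) + norm (traj vP y w s - q)"
    using norm_triangle_ineq[of "y - traj vP y w s" "traj vP y w s - q"] by simp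
  moreover have "norm (y - traj vP y w s) \<le> vP * s"
    using traj_dist[OF w order_refl s(1), of vP y] vP by (simp add: dist_norm)
  ultimately show ?thesis using ray_dist[OF s] meet by simp
qed

text \<open>A capture counts only off \<open>G\<close>, hence at some \<open>t\<close> strictly
  before arrival. With \<open>D = norm (z - q)\<close>, interception puts the pursuer's start within
  \<open>D + (vP - vE) * t\<close> of \<open>q\<close>, which is less than
  \<open>D * vP / vE\<close>; so equality in \<open>near\<close> already excludes it.\<close>

lemma pursuers_not_win_if:
  assumes near: "\<forall>i\<in>I. norm (z - q) \<le> vE / vP * norm (x i - q)"
  shows "z \<notin> pursuit_winning_region A G S vP vE I x"
proof
  assume "z \<in> pursuit_winning_region A G S vP vE I x"
  then obtain \<gamma> where \<gamma>: "\<gamma> \<in> pursuit_strategies A G vP vE I x z"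
    "\<forall>u\<in>evader_controls A G vE z. pursuers_win A G I (traj vE z u) (\<lambda>i. traj vP (x i) (\<gamma> u i))"
    unfolding pursuit_winning_region_def by blast
  let ?u = "\<lambda>_::real. sgn (q - z)"
  obtain t i where t: "0 \<le> t" "\<forall>s\<in>{0..t}. traj vE z ?u s \<notin> G" and i: "i \<in> I"
    "traj vE z ?u t = traj vP (x i) (\<gamma> ?u i) t"
    using bspec[OF \<gamma>(2) ray_control] unfolding pursuers_win_def by blast
  let ?D = "norm (z - q)"
  have lt: "t < ?D / vE"
  proof (rule ccontr)
    assume "\<not> ?thesis"
    then have "?D / vE \<in> {0..t}" using v by simp
    then have "traj vE z ?u (?D / vE) \<notin> G" by (rule bspec[OF t(2)])
    then show False using v q TG ray_end by (auto simp: traj_const)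
  qed
  have "norm (x i - q) \<le> vP * t + ?D - vE * t"
    using i t(1) lt by (intro ray_meets_late[OF strategy_controls[OF \<gamma>(1) ray_control i(1)]])
      (auto simp: traj_const)
  moreover have "?D * vP \<le> vE * norm (x i - q)"
    using near i(1) vP by (simp add: field_simps)
  ultimately have "?D * vP \<le> vE * (vP * t + ?D - vE * t)"
    using mult_left_mono[of "norm (x i - q)" "vP * t + ?D - vE * t" vE] v by linarith
  then have "(vP - vE) * ?D \<le> (vP - vE) * (vE * t)" by (simp add: algebra_simps)
  then have "?D \<le> vE * t" using v by (simp add: mult_le_cancel_left_pos)
  then show False using lt v by (simp add: field_simps)
qed

lemma evader_wins_if:
  assumes near: "\<forall>i\<in>I. norm (z - q) < vE / vP * norm (x i - q)"
  shows "z \<in> evader_winning_region A G S vP vE I x"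
proof -
  let ?d = "sgn (q - z)"
  let ?\<phi> = "\<lambda>(_::point) (_::nat \<Rightarrow> point). ?d"
  let ?tq = "norm (z - q) / vE"
  have "closed_loop_controls A G vP vE I x z ?\<phi> \<gamma> \<noteq> {}" for \<gamma>
    using ray_control unfolding closed_loop_controls_def by auto
  moreover have "evader_wins G I (traj vE z u) (\<lambda>i. traj vP (x i) (\<gamma> u i))"
    if \<gamma>: "\<gamma> \<in> pursuit_strategies A G vP vE I x z" and u: "u \<in> closed_loop_controls A G vP vE I x z ?\<phi> \<gamma>"
    for \<gamma> u
  proof -
    let ?e = "traj vE z u" and ?p = "\<lambda>i. traj vP (x i) (\<gamma> u i)"
    have uc: "u \<in> evader_controls A G vE z" using u unfolding closed_loop_controls_def by simp
    \<comment> \<open>A closed-loop control is tied to the law only while the play is in progress,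
      so straight motion is available only up to the first decisive event.\<close>
    have straight: "?e s = z + (vE * s) *\<^sub>R ?d"
      if "0 \<le> s" "s \<le> t" and prog: "in_progress G I ?e ?p t" for s t
    proof (rule traj_eq_const_AE[OF _ that(1,2)])
      have "AE r in lebesgue. 0 \<le> r \<and> in_progress G I ?e ?p r \<longrightarrow> u r = ?d"
        using u unfolding closed_loop_controls_def by simp
      moreover have "in_progress G I ?e ?p r" if "r \<le> t" for r
        using prog that unfolding in_progress_def by simp
      ultimately show "AE r in lebesgue. 0 \<le> r \<and> r \<le> t \<longrightarrow> u r = ?d"
        by (elim AE_mp) (simp add: AE_I2)
    qed
    have pc: "\<gamma> u i \<in> controls" if "i \<in> I" for i by (rule strategy_controls[OF \<gamma> uc that])
    have no_meet: "z + (vE * s) *\<^sub>R ?d \<noteq> ?p i s" if "0 \<le> s" "s \<le> ?tq" "i \<in> I" for s i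
    proof
      assume "z + (vE * s) *\<^sub>R ?d = ?p i s"
      then have "norm (x i - q) \<le> vP * s + norm (z - q) - vE * s"
        using that by (intro ray_meets_late[OF pc]) auto
      moreover have "norm (z - q) * vP < vE * norm (x i - q)"
        using near that(3) vP by (simp add: field_simps)
      moreover have "(vP - vE) * (vE * s) \<le> (vP - vE) * norm (z - q)"
        using that(2) v by (intro mult_left_mono) (auto simp: field_simps)
      ultimately show False
        using mult_left_mono[of "norm (x i - q)" "vP * s + norm (z - q) - vE * s" vE] v
        by (simp add: algebra_simps)
    qed
    have cont: "continuous_on {0..?tq} ?e"
      by (rule continuous_on_subset[OF lipschitz_on_continuous_on[OF evader_lipschitz[OF uc]]]) auto
    have contp: "continuous_on {0..?tq} (?p i)" if "i \<in> I" for i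
      by (rule continuous_on_subset[OF lipschitz_on_continuous_on[OF traj_lipschitz[OF pc[OF that]]]])
        (use vP in auto)
    \<comment> \<open>These are the times up to arrival at which the play is decided. If one
      preceded arrival, the first of them would be reached by straight motion, where
      \<open>ray_not_in_G\<close> and \<open>no_meet\<close> rule it out.\<close>
    define C where "C = ({0..?tq} \<inter> ?e -` G) \<union> (\<Union>i\<in>I. {0..?tq} \<inter> (\<lambda>s. ?e s - ?p i s) -` {0})"
    have "closed C"
      unfolding C_def
    proof (intro closed_Un closed_UN fin ballI)
      show "closed ({0..?tq} \<inter> ?e -` G)"
        by (rule continuous_closed_preimage[OF cont _ closed_G]) simp
      show "closed ({0..?tq} \<inter> (\<lambda>s. ?e s - ?p i s) -` {0})" if "i \<in> I" for i
        by (rule continuous_closed_preimage[OF continuous_on_diff[OF cont contp[OF that]]]) simp_all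
    qed
    moreover have "C \<subseteq> {0..?tq}" unfolding C_def by auto
    ultimately have cC: "compact C" by (rule closed_subset_Icc_compact)
    have memC: "s \<in> C \<longleftrightarrow> s \<in> {0..?tq} \<and> (?e s \<in> G \<or> (\<exists>i\<in>I. ?e s = ?p i s))" for s
      unfolding C_def by auto
    have prog: "in_progress G I ?e ?p ?tq"
    proof (rule ccontr)
      assume "\<not> in_progress G I ?e ?p ?tq"
      then obtain r where "r \<in> {0..<?tq}" "?e r \<in> G \<or> (\<exists>i\<in>I. ?e r = ?p i r)"
        unfolding in_progress_def by blast
      then have r: "r \<in> C" "r < ?tq" by (simp_all add: memC)
      then obtain s0 where s0: "s0 \<in> C" "\<And>s. s \<in> C \<Longrightarrow> s0 \<le> s"
        using compact_attains_inf[OF cC] by blast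
      have lt: "0 \<le> s0" "s0 < ?tq" using s0 r memC by fastforce+
      have "in_progress G I ?e ?p s0"
        unfolding in_progress_def
      proof
        fix s assume s: "s \<in> {0..<s0}"
        then have "s \<notin> C" using s0(2) by fastforce
        then show "?e s \<notin> G \<and> (\<forall>i\<in>I. ?e s \<noteq> ?p i s)" using s lt unfolding memC by auto
      qed
      then have "?e s0 = z + (vE * s0) *\<^sub>R ?d" using lt by (intro straight) auto
      then show False
        using s0(1) ray_not_in_G[OF lt] no_meet[of s0] lt unfolding memC by auto
    qed
    have "?e s \<noteq> ?p i s" if "s \<in> {0..?tq}" "i \<in> I" for s i
      using straight[OF _ _ prog, of s] no_meet[of s i] that by auto
    moreover have "?e ?tq \<in> G"
      using straight[OF _ order_refl prog] ray_end q TG v by auto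
    ultimately show ?thesis
      unfolding evader_wins_def using v by (intro exI[of _ ?tq]) auto
  qed
  moreover have "norm ?d = 1" using ray_pos by (simp add: norm_sgn)
  ultimately show ?thesis
    unfolding evader_winning_region_def using z
    by (intro CollectI conjI exI[of _ ?\<phi>] ballI allI)
qed

end

text \<open>For each side, the strict condition that ensures its win and the non-strict one that
  prevents it are negations of each other; the barrier is where both preventing conditions
  hold.\<close>

lemma game_barrier_eq:
  "game_barrier A G S vP vE I x =
    {z \<in> S. (\<exists>q\<in>T. \<forall>i\<in>I. norm (z - q) \<le> vE / vP * norm (x i - q)) \<and>
            (\<forall>q\<in>T. \<exists>i\<in>I. vE / vP * norm (x i - q) \<le> norm (z - q))}"
proof (intro set_eqI iffI)
  fix z assume "z \<in> game_barrier A G S vP vE I x"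
  then have z: "z \<in> S" "z \<notin> pursuit_winning_region A G S vP vE I x"
    "z \<notin> evader_winning_region A G S vP vE I x" unfolding game_barrier_def by auto
  have "\<not> (\<forall>q\<in>T. \<exists>i\<in>I. vE / vP * norm (x i - q) < norm (z - q))"
    using pursuers_win_if z by blast
  moreover have "\<not> (\<exists>q\<in>T. \<forall>i\<in>I. norm (z - q) < vE / vP * norm (x i - q))"
    using evader_wins_if z by blast
  ultimately show "z \<in> {z \<in> S. (\<exists>q\<in>T. \<forall>i\<in>I. norm (z - q) \<le> vE / vP * norm (x i - q)) \<and>
            (\<forall>q\<in>T. \<exists>i\<in>I. vE / vP * norm (x i - q) \<le> norm (z - q))}"
    using z(1) by (simp add: not_less)
next
  fix z assume "z \<in> {z \<in> S. (\<exists>q\<in>T. \<forall>i\<in>I. norm (z - q) \<le> vE / vP * norm (x i - q)) \<and>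
            (\<forall>q\<in>T. \<exists>i\<in>I. vE / vP * norm (x i - q) \<le> norm (z - q))}"
  then have "z \<in> S" "z \<notin> pursuit_winning_region A G S vP vE I x"
    "z \<notin> evader_winning_region A G S vP vE I x"
    using pursuers_not_win_if evader_not_wins_if by blast+
  then show "z \<in> game_barrier A G S vP vE I x" unfolding game_barrier_def by blast
qed

end

section \<open>Coordinates and the shape of the domain along the axis\<close>

section \<open>The two-pursuer barrier\<close>

lemma vector2 [simp]: "(vector [a, b] :: point) $ 1 = a" "(vector [a, b] :: point) $ 2 = b"
  by (simp_all add: vector_2)

lemma point_eqI: "p $ 1 = q $ 1 \<Longrightarrow> p $ 2 = q $ 2 \<Longrightarrow> p = (q :: point)"
  by (simp add: vec_eq_iff forall_2)

lemma target_line_eq: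
  assumes "l > 0"
  shows "target_line l = {q. q $ 2 = 0 \<and> 0 \<le> q $ 1 \<and> q $ 1 \<le> l}"
proof (intro set_eqI iffI)
  fix q assume "q \<in> target_line l"
  then obtain u where "0 \<le> u" "u \<le> 1" "q = (1 - u) *\<^sub>R pt_m + u *\<^sub>R pt_n l"
    unfolding target_line_def closed_segment_def by blast
  then show "q \<in> {q. q $ 2 = 0 \<and> 0 \<le> q $ 1 \<and> q $ 1 \<le> l}"
    using assms mult_right_mono[of u 1 l] by (simp add: pt_m_def pt_n_def)
next
  fix q :: point assume q: "q \<in> {q. q $ 2 = 0 \<and> 0 \<le> q $ 1 \<and> q $ 1 \<le> l}"
  show "q \<in> target_line l"
    unfolding target_line_def closed_segment_def
  proof (intro CollectI exI[of _ "q $ 1 / l"] conjI)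
    show "q = (1 - q $ 1 / l) *\<^sub>R pt_m + (q $ 1 / l) *\<^sub>R pt_n l"
      using q assms by (intro point_eqI) (simp_all add: pt_m_def pt_n_def)
  qed (use q assms in auto)
qed

lemma target_line_axis: "l > 0 \<Longrightarrow> target_line l = (\<lambda>c. vector [c, 0]) ` {0..l}"
  by (auto simp: target_line_eq image_iff intro!: point_eqI bexI[of _ "_ $ 1"])

lemma target_line_compact: "compact (target_line l)" and target_line_convex: "convex (target_line l)"
  by (simp_all add: target_line_def)

text \<open>A further point of the domain on the axis would put an end point of the segment between
  two points of the domain, so the normal of a supporting line there is vertical; points above and
  below the axis then force it to vanish. Hence the axis can be crossed only through the target
  line.\<close>

lemma convex_axis_section:
  fixes \<Omega> :: "point set"
  assumes \<Omega>: "convex \<Omega>" "target_line l \<subseteq> \<Omega>" and l: "l > 0"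
    and fr: "pt_m \<in> frontier \<Omega>" "pt_n l \<in> frontier \<Omega>"
    and ab: "\<exists>z\<in>\<Omega>. z $ 2 > 0" "\<exists>z\<in>\<Omega>. z $ 2 < 0"
    and p: "p \<in> \<Omega>" "p $ 2 = 0"
  shows "p \<in> target_line l"
proof (rule ccontr)
  assume "p \<notin> target_line l"
  then have out: "p $ 1 < 0 \<or> l < p $ 1" using p l by (auto simp: target_line_eq)
  have mn: "pt_m \<in> \<Omega>" "pt_n l \<in> \<Omega>" using \<Omega>(2) by (auto simp: target_line_def)
  obtain up dn where ud: "up \<in> \<Omega>" "up $ 2 > 0" "dn \<in> \<Omega>" "dn $ 2 < 0" using ab by blast
  have inner2: "a \<bullet> w = a $ 1 * w $ 1 + a $ 2 * w $ 2" for a w :: point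
    by (simp add: inner_vec_def sum_2)
  have degenerate: "a = 0"
    if sup: "\<And>y. y \<in> \<Omega> \<Longrightarrow> a \<bullet> w \<le> a \<bullet> y" and w: "w $ 2 = 0" and a1: "a $ 1 = 0" for a w :: point
  proof -
    have "0 \<le> a $ 2 * up $ 2" "0 \<le> a $ 2 * dn $ 2"
      using sup[OF ud(1)] sup[OF ud(3)] w a1 by (simp_all add: inner2)
    then have "a $ 2 = 0" using ud by (simp add: zero_le_mult_iff)
    then show ?thesis using a1 by (intro point_eqI) simp_all
  qed
  have support: "\<exists>a. a \<noteq> 0 \<and> (\<forall>y\<in>\<Omega>. a \<bullet> w \<le> a \<bullet> y)"
    if w: "w \<in> frontier \<Omega>" "w \<in> \<Omega>" for w
  proof (cases "interior \<Omega> = {}")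
    case True
    then obtain a b where a: "a \<noteq> 0" "\<Omega> \<subseteq> {y. a \<bullet> y = b}"
      using empty_interior_subset_hyperplane[OF \<Omega>(1)] by blast
    have "a \<bullet> w \<le> a \<bullet> y" if "y \<in> \<Omega>" for y
      using subsetD[OF a(2) w(2)] subsetD[OF a(2) that] by simp
    then show ?thesis using a(1) by blast
  next
    case False
    then have "w \<in> closure \<Omega>" "w \<notin> rel_interior \<Omega>"
      using w by (simp_all add: frontier_def rel_interior_nonempty_interior)
    then obtain a where "a \<noteq> 0" "\<And>y. y \<in> closure \<Omega> \<Longrightarrow> a \<bullet> w \<le> a \<bullet> y"
      using supporting_hyperplane_relative_frontier[OF \<Omega>(1)] by blast
    then show ?thesis using closure_subset by blast
  qed
  show False
  proof (cases "p $ 1 < 0")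
    case True
    obtain a where a: "a \<noteq> 0" "\<And>y. y \<in> \<Omega> \<Longrightarrow> a \<bullet> pt_m \<le> a \<bullet> y" using support[OF fr(1) mn(1)] by blast
    have "0 \<le> a $ 1 * p $ 1" "0 \<le> a $ 1 * l"
      using a(2)[OF p(1)] a(2)[OF mn(2)] p(2) by (simp_all add: inner2 pt_m_def pt_n_def)
    then have "a $ 1 = 0" using True l by (simp add: zero_le_mult_iff)
    then show False using degenerate[OF a(2)] a(1) by (simp add: pt_m_def)
  next
    case False
    then have lp: "l < p $ 1" using out by simp
    obtain a where a: "a \<noteq> 0" "\<And>y. y \<in> \<Omega> \<Longrightarrow> a \<bullet> pt_n l \<le> a \<bullet> y" using support[OF fr(2) mn(2)] by blast
    have "a $ 1 * l \<le> a $ 1 * p $ 1" "a $ 1 * l \<le> 0"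
      using a(2)[OF p(1)] a(2)[OF mn(1)] p(2) by (simp_all add: inner2 pt_m_def pt_n_def)
    then have "a $ 1 = 0" using lp l by (auto simp: mult_le_0_iff mult_le_cancel_left)
    then show False using degenerate[OF a(2)] a(1) by (simp add: pt_n_def)
  qed
qed

lemma open_segment_below:
  assumes "z $ 2 < 0" "q $ 2 = 0" "p \<in> open_segment z (q :: point)"
  shows "p $ 2 < 0"
proof -
  obtain u where "u < 1" "p = (1 - u) *\<^sub>R z + u *\<^sub>R q"
    using assms(3) unfolding in_segment by blast
  then show ?thesis using assms(1,2) by (simp add: mult_pos_neg)
qed

lemma reach_avoid_domain:
  fixes \<Omega> :: "point set"
  assumes \<Omega>: "convex \<Omega>" "target_line l \<subseteq> \<Omega>" and l: "l > 0"
    and fr: "pt_m \<in> frontier \<Omega>" "pt_n l \<in> frontier \<Omega>"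
    and ab: "\<exists>z\<in>\<Omega>. z $ 2 > 0" "\<exists>z\<in>\<Omega>. z $ 2 < 0"
    and G: "compact (tar_region \<Omega>)"
    and v: "0 < vE" "vE < vP" and K: "finite K" "K \<noteq> {}" "\<And>i. i \<in> K \<Longrightarrow> x i \<in> \<Omega>"
  shows "reach_avoid \<Omega> (tar_region \<Omega>) (play_region \<Omega>) (target_line l) vP vE K x"
proof
  show "convex \<Omega>" "target_line l \<subseteq> \<Omega>" by fact+
  show "closed (tar_region \<Omega>)" using G by (rule compact_imp_closed)
  show "compact (target_line l)" "convex (target_line l)"
    by (rule target_line_compact target_line_convex)+
  show "target_line l \<subseteq> tar_region \<Omega>"
    using \<Omega>(2) l by (auto simp: tar_region_def target_line_eq)
  show "play_region \<Omega> \<subseteq> \<Omega> - tar_region \<Omega>" by (simp add: play_region_def)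
  show "open_segment z q \<inter> tar_region \<Omega> = {}" if "z \<in> play_region \<Omega>" "q \<in> target_line l" for z q
    using that l open_segment_below[of z q]
    by (fastforce simp: play_region_def tar_region_def target_line_eq)
  show "e t \<in> target_line l"
    if cont: "continuous_on {0..} e" and e0: "e 0 \<in> play_region \<Omega>" and t: "0 \<le> t"
      and eA: "\<And>s. s \<in> {0..t} \<Longrightarrow> e s \<in> \<Omega>" and before: "\<And>s. s \<in> {0..<t} \<Longrightarrow> e s \<notin> tar_region \<Omega>"
      and et: "e t \<in> tar_region \<Omega>" for e and t :: real
  proof (rule convex_axis_section[OF \<Omega> l fr ab])
    show "e t \<in> \<Omega>" using eA t by simp
    have le0: "e 0 $ 2 < 0" using e0 by (auto simp: play_region_def tar_region_def)
    have ge: "0 \<le> e t $ 2" using et by (simp add: tar_region_def)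
    have "continuous_on {0..t} (\<lambda>s. e s $ 2)"
      by (intro continuous_intros continuous_on_subset[OF cont]) auto
    \<comment> \<open>A crossing of the axis already lies in the target region, so it cannot precede
      \<open>t\<close>.\<close>
    then have "\<exists>s\<ge>0. s \<le> t \<and> e s $ 2 = 0" using le0 ge t by (intro IVT') auto
    then obtain s where s: "0 \<le> s" "s \<le> t" "e s $ 2 = 0" by blast
    have "e s \<in> tar_region \<Omega>" using s eA by (simp add: tar_region_def)
    then have "s = t" using before[of s] s by fastforce
    then show "e t $ 2 = 0" using s by simp
  qed
qed (use v K in auto)

lemma reach_avoid_free:
  assumes "l > 0" "0 < vE" "vE < vP" "finite K" "K \<noteq> {}"
  shows "reach_avoid UNIV (target_line l) {z. z $ 2 < 0} (target_line l) vP vE K x"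
proof
  show "closed (target_line l)" using target_line_compact by (rule compact_imp_closed)
  show "open_segment z q \<inter> target_line l = {}" if "z \<in> {z. z $ 2 < 0}" "q \<in> target_line l" for z q
    using that assms(1) open_segment_below[of z q] by (fastforce simp: target_line_eq)
  show "{z. z $ 2 < 0} \<subseteq> UNIV - target_line l" using assms(1) by (auto simp: target_line_eq)
qed (use assms target_line_compact target_line_convex in auto)

section \<open>The larger of two parabolas with minimum zero\<close>

lemma parabola_mono:
  fixes \<beta> :: real
  assumes "0 < \<beta>"
  shows "\<lbrakk>p \<le> c; c \<le> c'\<rbrakk> \<Longrightarrow> \<beta> * (c - p)\<^sup>2 + C \<le> \<beta> * (c' - p)\<^sup>2 + C"
    and "\<lbrakk>c \<le> p; c' \<le> c\<rbrakk> \<Longrightarrow> \<beta> * (c - p)\<^sup>2 + C \<le> \<beta> * (c' - p)\<^sup>2 + C"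
    and "\<lbrakk>p \<le> c; c < c'\<rbrakk> \<Longrightarrow> \<beta> * (c - p)\<^sup>2 + C < \<beta> * (c' - p)\<^sup>2 + C"
    and "\<lbrakk>c \<le> p; c' < c\<rbrakk> \<Longrightarrow> \<beta> * (c - p)\<^sup>2 + C < \<beta> * (c' - p)\<^sup>2 + C"
  using assms power_mono[of "c - p" "c' - p" 2] power_mono[of "p - c" "p - c'" 2]
    power_strict_mono[of "c - p" "c' - p" 2] power_strict_mono[of "p - c" "p - c'" 2]
  by (simp_all add: power2_commute[of p])

text \<open>\<open>F1\<close> is the larger function left of \<open>xc\<close> and \<open>F2\<close>
  right of it, so the left-hand side says that their maximum has minimum zero on
  \<open>{0..l}\<close>. The minimum sits at an end point, at a vertex inside its own piece, or at
  the kink \<open>xc\<close>; these five places become the five base curves.\<close>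

lemma max_parabola_min_zero:
  fixes \<beta> g l xc p1 p2 C1 C2 :: real
  defines "F1 \<equiv> \<lambda>c. \<beta> * (c - p1)\<^sup>2 + C1" and "F2 \<equiv> \<lambda>c. \<beta> * (c - p2)\<^sup>2 + C2"
  assumes \<beta>: "0 < \<beta>" and g: "0 < g" and xc: "0 < xc" "xc < l"
    and diff: "\<And>c. F1 c - F2 c = g * (xc - c)"
  shows "(\<exists>c\<in>{0..l}. F1 c \<le> 0 \<and> F2 c \<le> 0) \<and> (\<forall>c\<in>{0..l}. 0 \<le> F1 c \<or> 0 \<le> F2 c) \<longleftrightarrow>
    F1 0 = 0 \<and> p1 \<le> 0 \<or> C1 = 0 \<and> 0 < p1 \<and> p1 < xc \<or> F1 xc = 0 \<and> xc \<le> p1 \<and> p2 \<le> xc \<or>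
    C2 = 0 \<and> xc < p2 \<and> p2 < l \<or> F2 l = 0 \<and> l \<le> p2"
  (is "?L \<longleftrightarrow> ?R")
proof -
  have mono1: "p1 \<le> c \<Longrightarrow> c \<le> c' \<Longrightarrow> F1 c \<le> F1 c'" "c \<le> p1 \<Longrightarrow> c' \<le> c \<Longrightarrow> F1 c \<le> F1 c'"
    "p1 \<le> c \<Longrightarrow> c < c' \<Longrightarrow> F1 c < F1 c'" "c \<le> p1 \<Longrightarrow> c' < c \<Longrightarrow> F1 c < F1 c'" for c c'
    unfolding F1_def by (rule parabola_mono[OF \<beta>]; assumption)+
  have mono2: "p2 \<le> c \<Longrightarrow> c \<le> c' \<Longrightarrow> F2 c \<le> F2 c'" "c \<le> p2 \<Longrightarrow> c' \<le> c \<Longrightarrow> F2 c \<le> F2 c'"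
    "p2 \<le> c \<Longrightarrow> c < c' \<Longrightarrow> F2 c < F2 c'" "c \<le> p2 \<Longrightarrow> c' < c \<Longrightarrow> F2 c < F2 c'" for c c'
    unfolding F2_def by (rule parabola_mono[OF \<beta>]; assumption)+
  have lt: "F2 c < F1 c" if "c < xc" for c using diff[of c] g that mult_pos_pos[of g "xc - c"] by linarith
  have gt: "F1 c < F2 c" if "xc < c" for c using diff[of c] g that mult_pos_neg[of g "xc - c"] by linarith
  have eq: "F1 xc = F2 xc" using diff[of xc] by simp
  show ?thesis
  proof
    assume L: ?L
    then obtain c0 where c0: "c0 \<in> {0..l}" "F1 c0 \<le> 0" "F2 c0 \<le> 0" by blast
    have pos1: "0 \<le> F1 c" if "0 \<le> c" "c \<le> xc" for c
    proof -
      have "0 \<le> F1 c \<or> 0 \<le> F2 c" using L that xc by simp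
      then show ?thesis using lt[of c] eq that by (cases "c = xc") auto
    qed
    have pos2: "0 \<le> F2 c" if "xc \<le> c" "c \<le> l" for c
    proof -
      have "0 \<le> F1 c \<or> 0 \<le> F2 c" using L that xc by simp
      then show ?thesis using gt[of c] eq that by (cases "c = xc") auto
    qed
    consider "c0 = 0" | "0 < c0" "c0 < xc" | "c0 = xc" | "xc < c0" "c0 < l" | "c0 = l"
      using c0 by fastforce
    then show ?R
    proof cases
      case 1
      then have F: "F1 0 = 0" using c0 pos1[of 0] xc by simp
      have "p1 \<le> 0"
      proof (rule ccontr)
        assume "\<not> p1 \<le> 0"
        \<comment> \<open>\<open>min p1 xc\<close> moves towards the vertex without leaving the
          piece on which \<open>F1\<close> must be nonnegative. The other cases truncate in the same
          way.\<close>
        then have "F1 (min p1 xc) < F1 0" using xc by (intro mono1(4)) auto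
        then show False using pos1[of "min p1 xc"] \<open>\<not> p1 \<le> 0\<close> xc F by simp
      qed
      then show ?R using F by blast
    next
      case 2
      then have F: "F1 c0 = 0" using c0 pos1[of c0] by simp
      have "\<not> c0 < p1"
      proof
        assume "c0 < p1"
        then have "F1 (min p1 xc) < F1 c0" using 2 by (intro mono1(4)) auto
        then show False using pos1[of "min p1 xc"] \<open>c0 < p1\<close> 2 xc F by simp
      qed
      moreover have "\<not> p1 < c0"
      proof
        assume "p1 < c0"
        then have "F1 (max p1 0) < F1 c0" using 2 by (intro mono1(3)) auto
        then show False using pos1[of "max p1 0"] \<open>p1 < c0\<close> 2 xc F by simp
      qed
      ultimately have "p1 = c0" by simp
      then show ?R using F 2 by (simp add: F1_def)
    next
      case 3
      then have F: "F1 xc = 0" "F2 xc = 0" using c0 pos1[of xc] eq xc by simp_all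
      have "xc \<le> p1"
      proof (rule ccontr)
        assume n: "\<not> xc \<le> p1"
        then have "F1 (max p1 0) < F1 xc" using xc by (intro mono1(3)) auto
        then show False using pos1[of "max p1 0"] n xc F by simp
      qed
      moreover have "p2 \<le> xc"
      proof (rule ccontr)
        assume n: "\<not> p2 \<le> xc"
        then have "F2 (min p2 l) < F2 xc" using xc by (intro mono2(4)) auto
        then show False using pos2[of "min p2 l"] n xc F by simp
      qed
      ultimately show ?R using F by blast
    next
      case 4
      then have F: "F2 c0 = 0" using c0 pos2[of c0] by simp
      have "\<not> c0 < p2"
      proof
        assume "c0 < p2"
        then have "F2 (min p2 l) < F2 c0" using 4 by (intro mono2(4)) auto
        then show False using pos2[of "min p2 l"] \<open>c0 < p2\<close> 4 xc F by simp
      qed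
      moreover have "\<not> p2 < c0"
      proof
        assume "p2 < c0"
        then have "F2 (max p2 xc) < F2 c0" using 4 by (intro mono2(3)) auto
        then show False using pos2[of "max p2 xc"] \<open>p2 < c0\<close> 4 xc F by simp
      qed
      ultimately have "p2 = c0" by simp
      then show ?R using F 4 by (simp add: F2_def)
    next
      case 5
      then have F: "F2 l = 0" using c0 pos2[of l] xc by simp
      have "l \<le> p2"
      proof (rule ccontr)
        assume n: "\<not> l \<le> p2"
        then have "F2 (max p2 xc) < F2 l" using xc by (intro mono2(3)) auto
        then show False using pos2[of "max p2 xc"] n xc F by simp
      qed
      then show ?R using F by blast
    qed
  next
    \<comment> \<open>On the piece left of \<open>xc\<close>, \<open>F2\<close> lies below
      \<open>F1\<close>, so a zero of \<open>F1\<close> there is a point where both are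
      nonpositive.\<close>
    have via1: ?L if "c0 \<in> {0..xc}" "F1 c0 = 0" "\<And>c. c \<in> {0..l} \<Longrightarrow> 0 \<le> F1 c" for c0
    proof (intro conjI bexI[of _ c0] ballI)
      show "F2 c0 \<le> 0" using that lt[of c0] eq by (cases "c0 = xc") auto
    qed (use that xc in auto)
    have via2: ?L if "c0 \<in> {xc..l}" "F2 c0 = 0" "\<And>c. c \<in> {0..l} \<Longrightarrow> 0 \<le> F2 c" for c0
    proof (intro conjI bexI[of _ c0] ballI)
      show "F1 c0 \<le> 0" using that gt[of c0] eq by (cases "c0 = xc") auto
    qed (use that xc in auto)
    assume ?R
    then consider "F1 0 = 0" "p1 \<le> 0" | "C1 = 0" "0 < p1" "p1 < xc" | "F1 xc = 0" "xc \<le> p1" "p2 \<le> xc"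
      | "C2 = 0" "xc < p2" "p2 < l" | "F2 l = 0" "l \<le> p2" by blast
    then show ?L
    proof cases
      case 1
      show ?L using 1 xc mono1(1)[of 0] by (intro via1[of 0]) fastforce+
    next
      case 2
      show ?L using 2 \<beta> by (intro via1[of p1]) (auto simp: F1_def)
    next
      case 3
      show ?L
      proof (intro conjI bexI[of _ xc] ballI)
        fix c assume "c \<in> {0..l}"
        show "0 \<le> F1 c \<or> 0 \<le> F2 c"
          using 3 mono1(2)[of xc c] mono2(1)[of xc c] eq by (cases "c \<le> xc") auto
      qed (use 3 eq xc in auto)
    next
      case 4
      show ?L using 4 \<beta> by (intro via2[of p2]) (auto simp: F2_def)
    next
      case 5
      show ?L using 5 xc mono2(2)[of l] by (intro via2[of l]) fastforce+
    qed
  qed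
qed

section \<open>Squared distance comparisons as parabolas, and the base curves\<close>

definition gap :: "real \<Rightarrow> point \<Rightarrow> point \<Rightarrow> real \<Rightarrow> real" where
  "gap \<alpha> h z c = (z $ 1 - c)\<^sup>2 + (z $ 2)\<^sup>2 - \<alpha>\<^sup>2 * ((h $ 1 - c)\<^sup>2 + (h $ 2)\<^sup>2)"

lemma norm_point_sq: "(norm (p :: point))\<^sup>2 = (p $ 1)\<^sup>2 + (p $ 2)\<^sup>2"
  unfolding power2_norm_eq_inner by (simp add: inner_vec_def sum_2 power2_eq_square)

lemma gap_norm:
  "gap \<alpha> h z c = (norm (z - vector [c, 0]))\<^sup>2 - (\<alpha> * norm (h - vector [c, 0]))\<^sup>2"
  by (simp add: gap_def power_mult_distrib norm_point_sq)

lemma gap_iff: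
  assumes "0 < \<alpha>"
  shows "norm (z - vector [c, 0]) \<le> \<alpha> * norm (h - vector [c, 0]) \<longleftrightarrow> gap \<alpha> h z c \<le> 0"
    "\<alpha> * norm (h - vector [c, 0]) \<le> norm (z - vector [c, 0]) \<longleftrightarrow> 0 \<le> gap \<alpha> h z c"
    "norm (z - vector [c, 0]) = \<alpha> * norm (h - vector [c, 0]) \<longleftrightarrow> gap \<alpha> h z c = 0"
proof -
  have n: "0 \<le> \<alpha> * norm (h - vector [c, 0])" using assms by simp
  show "norm (z - vector [c, 0]) \<le> \<alpha> * norm (h - vector [c, 0]) \<longleftrightarrow> gap \<alpha> h z c \<le> 0"
    unfolding gap_norm using power_mono_iff[OF norm_ge_zero[of "z - vector [c, 0]"] n, of 2] by auto
  show "\<alpha> * norm (h - vector [c, 0]) \<le> norm (z - vector [c, 0]) \<longleftrightarrow> 0 \<le> gap \<alpha> h z c"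
    unfolding gap_norm using power_mono_iff[OF n norm_ge_zero[of "z - vector [c, 0]"], of 2] by auto
  show "norm (z - vector [c, 0]) = \<alpha> * norm (h - vector [c, 0]) \<longleftrightarrow> gap \<alpha> h z c = 0"
    unfolding gap_norm using power2_eq_iff_nonneg[OF norm_ge_zero[of "z - vector [c, 0]"] n] by auto
qed

text \<open>The abscissa of the Apollonius centre of \<open>z\<close> and \<open>h\<close>: the axis
  point where the squared comparison favours the evader most.\<close>

definition vertex :: "real \<Rightarrow> point \<Rightarrow> point \<Rightarrow> real" where
  "vertex \<alpha> h z = (z $ 1 - \<alpha>\<^sup>2 * h $ 1) / (1 - \<alpha>\<^sup>2)"

lemma gap_parabola:
  assumes "0 < 1 - \<alpha>\<^sup>2"
  shows "gap \<alpha> h z c = (1 - \<alpha>\<^sup>2) * (c - vertex \<alpha> h z)\<^sup>2 + gap \<alpha> h z (vertex \<alpha> h z)"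
proof -
  define p where "p = vertex \<alpha> h z"
  have p: "z $ 1 = (1 - \<alpha>\<^sup>2) * p + \<alpha>\<^sup>2 * h $ 1" using assms by (simp add: p_def vertex_def)
  show ?thesis unfolding p_def[symmetric] gap_def p by (simp add: power2_eq_square algebra_simps)
qed

text \<open>A zero minimum means that the Apollonius circle touches the axis. Eliminating the vertex
  turns this tangency into the hyperbola of the second and fourth base curves: the two sides agree
  up to a nonzero factor.\<close>

lemma gap_vertex:
  assumes "0 < \<alpha>" "0 < 1 - \<alpha>\<^sup>2"
  shows "gap \<alpha> h z (vertex \<alpha> h z) = 0 \<longleftrightarrow>
    (z $ 1 - h $ 1)\<^sup>2 + (1 - 1 / \<alpha>\<^sup>2) * (z $ 2)\<^sup>2 + (1 - \<alpha>\<^sup>2) * (h $ 2)\<^sup>2 = 0" (is "_ \<longleftrightarrow> ?H = 0")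
proof -
  define p where "p = vertex \<alpha> h z"
  have p: "z $ 1 = (1 - \<alpha>\<^sup>2) * p + \<alpha>\<^sup>2 * h $ 1" using assms by (simp add: p_def vertex_def)
  have H: "\<alpha>\<^sup>2 * ?H = \<alpha>\<^sup>2 * (z $ 1 - h $ 1)\<^sup>2 + (\<alpha>\<^sup>2 - 1) * (z $ 2)\<^sup>2 + \<alpha>\<^sup>2 * (1 - \<alpha>\<^sup>2) * (h $ 2)\<^sup>2"
  proof -
    have "\<alpha>\<^sup>2 \<noteq> 0" using assms(1) by simp
    then have "\<alpha>\<^sup>2 * (1 - 1 / \<alpha>\<^sup>2) = \<alpha>\<^sup>2 - 1" by (simp add: right_diff_distrib)
    then have "\<alpha>\<^sup>2 * ((1 - 1 / \<alpha>\<^sup>2) * w) = (\<alpha>\<^sup>2 - 1) * w" for w by (metis mult.assoc)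
    then show ?thesis by (simp only: distrib_left mult.assoc)
  qed
  have "(1 - \<alpha>\<^sup>2) * gap \<alpha> h z p = - (\<alpha>\<^sup>2 * ?H)"
    unfolding H unfolding gap_def p by (simp add: power2_eq_square algebra_simps)
  then show ?thesis using assms unfolding p_def[symmetric]
    by (metis mult_eq_0_iff neg_equal_0_iff_equal power2_less_0 less_irrefl zero_less_power)
qed

text \<open>The difference of squared distances is affine in \<open>c\<close> with nonzero slope, so
  the \<open>THE\<close> in \<open>x_c\<close> has a unique solution.\<close>

lemma x_c_eq:
  assumes "h1 $ 1 < h2 $ 1"
  shows "(h1 $ 1 - c)\<^sup>2 + (h1 $ 2)\<^sup>2 - ((h2 $ 1 - c)\<^sup>2 + (h2 $ 2)\<^sup>2) =
    2 * (h2 $ 1 - h1 $ 1) * (c - x_c h1 h2)"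
proof -
  let ?f = "\<lambda>c. (h1 $ 1 - c)\<^sup>2 + (h1 $ 2)\<^sup>2 - ((h2 $ 1 - c)\<^sup>2 + (h2 $ 2)\<^sup>2)"
  define d where "d = ((h2 $ 1)\<^sup>2 + (h2 $ 2)\<^sup>2 - ((h1 $ 1)\<^sup>2 + (h1 $ 2)\<^sup>2)) / (2 * (h2 $ 1 - h1 $ 1))"
  have d: "2 * (h2 $ 1 - h1 $ 1) * d = (h2 $ 1)\<^sup>2 + (h2 $ 2)\<^sup>2 - ((h1 $ 1)\<^sup>2 + (h1 $ 2)\<^sup>2)"
    using assms by (simp add: d_def)
  have f: "?f c = 2 * (h2 $ 1 - h1 $ 1) * (c - d)" for c
    unfolding right_diff_distrib[of _ c d] d by (simp add: power2_eq_square algebra_simps)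
  have iff: "norm (vector [c, 0] - h1) = norm (vector [c, 0] - h2) \<longleftrightarrow> c = d" for c
  proof -
    have "norm (vector [c, 0] - h1) = norm (vector [c, 0] - h2) \<longleftrightarrow> ?f c = 0"
      unfolding power2_eq_iff_nonneg[OF norm_ge_zero norm_ge_zero, symmetric] norm_point_sq
      by (simp add: power2_commute[of c])
    also have "\<dots> \<longleftrightarrow> c = d" unfolding f using assms by simp
    finally show ?thesis .
  qed
  have "x_c h1 h2 = d" unfolding x_c_def iff by simp
  then show ?thesis using f by simp
qed

lemma closer_iff:
  assumes "h1 $ 1 < h2 $ 1"
  shows "norm (h1 - vector [c, 0]) < norm (h2 - vector [c, 0]) \<longleftrightarrow> c < x_c h1 h2"
    "norm (h2 - vector [c, 0]) < norm (h1 - vector [c, 0]) \<longleftrightarrow> x_c h1 h2 < c"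
proof -
  have sq: "norm a < norm b \<longleftrightarrow> (norm a)\<^sup>2 < (norm b)\<^sup>2" for a b :: point
    using power_mono_iff[of "norm b" "norm a" 2] by (simp add: not_le[symmetric])
  have "norm (h1 - vector [c, 0]) < norm (h2 - vector [c, 0]) \<longleftrightarrow>
      (h1 $ 1 - c)\<^sup>2 + (h1 $ 2)\<^sup>2 - ((h2 $ 1 - c)\<^sup>2 + (h2 $ 2)\<^sup>2) < 0"
    unfolding sq norm_point_sq by simp
  then show "norm (h1 - vector [c, 0]) < norm (h2 - vector [c, 0]) \<longleftrightarrow> c < x_c h1 h2"
    unfolding x_c_eq[OF assms] using assms by (simp add: mult_less_0_iff)
  have "norm (h2 - vector [c, 0]) < norm (h1 - vector [c, 0]) \<longleftrightarrow>
      0 < (h1 $ 1 - c)\<^sup>2 + (h1 $ 2)\<^sup>2 - ((h2 $ 1 - c)\<^sup>2 + (h2 $ 2)\<^sup>2)"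
    unfolding sq norm_point_sq by simp
  then show "norm (h2 - vector [c, 0]) < norm (h1 - vector [c, 0]) \<longleftrightarrow> x_c h1 h2 < c"
    unfolding x_c_eq[OF assms] using assms by (simp add: zero_less_mult_iff)
qed

text \<open>The range conditions on \<open>z $ 1\<close> are conditions on the vertices: comparing
  \<open>vertex \<alpha> h z\<close> with 0, \<open>x_c h1 h2\<close> or \<open>l\<close> is
  comparing \<open>z $ 1\<close> with one of the thresholds. By \<open>x_c_eq\<close> the two gaps
  differ by an affine function vanishing at \<open>x_c h1 h2\<close>, which places the kink.\<close>

lemma base_curves_eq:
  assumes \<alpha>: "0 < \<alpha>" "\<alpha> < 1" and l: "l > 0" and h: "h1 $ 1 < h2 $ 1" and xc: "0 < x_c h1 h2" "x_c h1 h2 < l"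
  shows "(\<Union>s\<in>{1..5}. base_curve l \<alpha> s h1 h2) =
    {z. z $ 2 < 0 \<and>
        (\<exists>q\<in>target_line l. norm (z - q) \<le> \<alpha> * norm (h1 - q) \<and> norm (z - q) \<le> \<alpha> * norm (h2 - q)) \<and>
        (\<forall>q\<in>target_line l. \<alpha> * norm (h1 - q) \<le> norm (z - q) \<or> \<alpha> * norm (h2 - q) \<le> norm (z - q))}"
proof (rule set_eqI)
  fix z :: point
  have \<alpha>2: "0 < 1 - \<alpha>\<^sup>2" using \<alpha> by (simp add: power_less_one_iff)
  let ?xc = "x_c h1 h2" and ?p1 = "vertex \<alpha> h1 z" and ?p2 = "vertex \<alpha> h2 z"
  let ?C1 = "gap \<alpha> h1 z ?p1" and ?C2 = "gap \<alpha> h2 z ?p2"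
  have "(1 - \<alpha>\<^sup>2) * (c - ?p1)\<^sup>2 + ?C1 - ((1 - \<alpha>\<^sup>2) * (c - ?p2)\<^sup>2 + ?C2) =
      2 * \<alpha>\<^sup>2 * (h2 $ 1 - h1 $ 1) * (?xc - c)" for c
  proof -
    have "gap \<alpha> h1 z c - gap \<alpha> h2 z c =
        - \<alpha>\<^sup>2 * ((h1 $ 1 - c)\<^sup>2 + (h1 $ 2)\<^sup>2 - ((h2 $ 1 - c)\<^sup>2 + (h2 $ 2)\<^sup>2))"
      by (simp add: gap_def right_diff_distrib)
    also have "\<dots> = 2 * \<alpha>\<^sup>2 * (h2 $ 1 - h1 $ 1) * (?xc - c)"
      unfolding x_c_eq[OF h] by (simp add: algebra_simps)
    finally show ?thesis unfolding gap_parabola[OF \<alpha>2, of h1 z c] gap_parabola[OF \<alpha>2, of h2 z c] .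
  qed
  moreover have "0 < 2 * \<alpha>\<^sup>2 * (h2 $ 1 - h1 $ 1)" using \<alpha> h by simp
  ultimately have main: "(\<exists>c\<in>{0..l}. gap \<alpha> h1 z c \<le> 0 \<and> gap \<alpha> h2 z c \<le> 0) \<and>
      (\<forall>c\<in>{0..l}. 0 \<le> gap \<alpha> h1 z c \<or> 0 \<le> gap \<alpha> h2 z c) \<longleftrightarrow>
      gap \<alpha> h1 z 0 = 0 \<and> ?p1 \<le> 0 \<or> ?C1 = 0 \<and> 0 < ?p1 \<and> ?p1 < ?xc \<or>
      gap \<alpha> h1 z ?xc = 0 \<and> ?xc \<le> ?p1 \<and> ?p2 \<le> ?xc \<or>
      ?C2 = 0 \<and> ?xc < ?p2 \<and> ?p2 < l \<or> gap \<alpha> h2 z l = 0 \<and> l \<le> ?p2"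
    using max_parabola_min_zero[OF \<alpha>2 _ xc, of "2 * \<alpha>\<^sup>2 * (h2 $ 1 - h1 $ 1)" ?p1 ?C1 ?p2 ?C2]
    unfolding gap_parabola[OF \<alpha>2, symmetric] by simp
  have le: "r \<le> vertex \<alpha> h z \<longleftrightarrow> (1 - \<alpha>\<^sup>2) * r + \<alpha>\<^sup>2 * h $ 1 \<le> z $ 1"
    "vertex \<alpha> h z \<le> r \<longleftrightarrow> z $ 1 \<le> (1 - \<alpha>\<^sup>2) * r + \<alpha>\<^sup>2 * h $ 1" for r h
    unfolding vertex_def pos_le_divide_eq[OF \<alpha>2] pos_divide_le_eq[OF \<alpha>2] mult.commute[of r "1 - \<alpha>\<^sup>2"]
    by linarith+
  note lt = le[THEN arg_cong[of _ _ Not], unfolded not_le]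
  note gapD = gap_iff[OF \<alpha>(1), where z = z]
  have nm: "pt_m = vector [0, 0]" "pt_n l = vector [l, 0]" "p_c h1 h2 = vector [?xc, 0]"
    by (simp_all add: pt_m_def pt_n_def p_c_def)
  have curve:
    "z \<in> base_curve l \<alpha> 1 h1 h2 \<longleftrightarrow> gap \<alpha> h1 z 0 = 0 \<and> ?p1 \<le> 0 \<and> z $ 2 < 0"
    "z \<in> base_curve l \<alpha> 2 h1 h2 \<longleftrightarrow> ?C1 = 0 \<and> (0 < ?p1 \<and> ?p1 < ?xc) \<and> z $ 2 < 0"
    "z \<in> base_curve l \<alpha> 3 h1 h2 \<longleftrightarrow> gap \<alpha> h1 z ?xc = 0 \<and> (?xc \<le> ?p1 \<and> ?p2 \<le> ?xc) \<and> z $ 2 < 0"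
    "z \<in> base_curve l \<alpha> 4 h1 h2 \<longleftrightarrow> ?C2 = 0 \<and> (?xc < ?p2 \<and> ?p2 < l) \<and> z $ 2 < 0"
    "z \<in> base_curve l \<alpha> 5 h1 h2 \<longleftrightarrow> gap \<alpha> h2 z l = 0 \<and> l \<le> ?p2 \<and> z $ 2 < 0"
    unfolding gapD(3)[symmetric] gap_vertex[OF \<alpha>(1) \<alpha>2] le lt
    by (simp_all add: base_curve_def k3_def k4_def k5_def k6_def nm)
  have five: "{1..5} = {1, 2, 3, 4, 5 :: nat}" by auto
  have "z \<in> (\<Union>s\<in>{1..5}. base_curve l \<alpha> s h1 h2) \<longleftrightarrow> z $ 2 < 0 \<and>
     (gap \<alpha> h1 z 0 = 0 \<and> ?p1 \<le> 0 \<or> ?C1 = 0 \<and> 0 < ?p1 \<and> ?p1 < ?xc \<or>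
      gap \<alpha> h1 z ?xc = 0 \<and> ?xc \<le> ?p1 \<and> ?p2 \<le> ?xc \<or>
      ?C2 = 0 \<and> ?xc < ?p2 \<and> ?p2 < l \<or> gap \<alpha> h2 z l = 0 \<and> l \<le> ?p2)"
    unfolding five UN_insert UN_empty Un_iff curve by blast
  also have "\<dots> \<longleftrightarrow> z \<in> {z. z $ 2 < 0 \<and>
        (\<exists>q\<in>target_line l. norm (z - q) \<le> \<alpha> * norm (h1 - q) \<and> norm (z - q) \<le> \<alpha> * norm (h2 - q)) \<and>
        (\<forall>q\<in>target_line l. \<alpha> * norm (h1 - q) \<le> norm (z - q) \<or> \<alpha> * norm (h2 - q) \<le> norm (z - q))}"
    unfolding main[symmetric] target_line_axis[OF l] mem_Collect_eq bex_simps ball_simps gapD by (rule refl)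
  finally show "z \<in> (\<Union>s\<in>{1..5}. base_curve l \<alpha> s h1 h2) \<longleftrightarrow> z \<in> {z. z $ 2 < 0 \<and>
        (\<exists>q\<in>target_line l. norm (z - q) \<le> \<alpha> * norm (h1 - q) \<and> norm (z - q) \<le> \<alpha> * norm (h2 - q)) \<and>
        (\<forall>q\<in>target_line l. \<alpha> * norm (h1 - q) \<le> norm (z - q) \<or> \<alpha> * norm (h2 - q) \<le> norm (z - q))}" .
qed

theorem theorem2:
  fixes \<Omega> :: "point set" and l vP vE \<alpha> :: real
    and Np Ne i1 i2 :: nat and xP xE :: "nat \<Rightarrow> point"
  assumes "bounded \<Omega>" and "convex \<Omega>"
    and "l > 0" and "target_line l \<subseteq> \<Omega>"
    and "pt_m \<in> frontier \<Omega>" and "pt_n l \<in> frontier \<Omega>"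
    and "compact (tar_region \<Omega>)"
    and "\<exists>z\<in>\<Omega>. z $ 2 > 0" and "\<exists>z\<in>\<Omega>. z $ 2 < 0"
    and "vP > 0" and "vE > 0" and "\<alpha> = vE / vP" and "0 < \<alpha>" and "\<alpha> < 1"
    and "inj_on xP {1..Np}" and "inj_on xE {1..Ne}"
    and "\<And>i j. i \<in> {1..Np} \<Longrightarrow> j \<in> {1..Ne} \<Longrightarrow> xP i \<noteq> xE j"
    and "\<And>i. i \<in> {1..Np} \<Longrightarrow> xP i \<in> play_region \<Omega> \<union> target_line l"
    and "\<And>j. j \<in> {1..Ne} \<Longrightarrow> xE j \<in> play_region \<Omega>"
    and "i1 \<in> {1..Np}" and "i2 \<in> {1..Np}" and "i1 \<noteq> i2"
  shows "(\<forall>i\<in>{i1, i2}. {j \<in> {i1, i2}. active l {i1, i2} xP j} = {i} \<longrightarrow>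
            barrier \<Omega> vP vE {i1, i2} xP = barrier \<Omega> vP vE {i} xP) \<and>
         (active l {i1, i2} xP i1 \<and> active l {i1, i2} xP i2 \<and> xP i1 $ 1 < xP i2 $ 1 \<longrightarrow>
            barrier \<Omega> vP vE {i1, i2} xP = free_barrier l vP vE {i1, i2} xP \<inter> play_region \<Omega> \<and>
            free_barrier l vP vE {i1, i2} xP = (\<Union>s\<in>{1..5}. base_curve l \<alpha> s (xP i1) (xP i2)))"
proof -
  note l = \<open>l > 0\<close>
  have v: "0 < vE" "vE < vP"
    using assms(10-12,14) mult_strict_right_mono[of \<alpha> 1 vP] by simp_all
  have x\<Omega>: "xP i \<in> \<Omega>" if "i \<in> {i1, i2}" for i
    using assms(18)[of i] assms(4,20,21) that by (auto simp: play_region_def)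
  have dom: "barrier \<Omega> vP vE K xP =
      {z \<in> play_region \<Omega>. (\<exists>q\<in>target_line l. \<forall>i\<in>K. norm (z - q) \<le> \<alpha> * norm (xP i - q)) \<and>
            (\<forall>q\<in>target_line l. \<exists>i\<in>K. \<alpha> * norm (xP i - q) \<le> norm (z - q))}"
    if "K \<subseteq> {i1, i2}" "K \<noteq> {}" for K
    unfolding barrier_def \<open>\<alpha> = vE / vP\<close>
  proof (rule reach_avoid.game_barrier_eq, rule reach_avoid_domain[OF assms(2,4) l assms(5,6,8,9,7) v])
    show "finite K" using that(1) finite_subset by blast
  qed (use that x\<Omega> in auto)
  have free: "free_barrier l vP vE K xP =
      {z \<in> {z. z $ 2 < 0}. (\<exists>q\<in>target_line l. \<forall>i\<in>K. norm (z - q) \<le> \<alpha> * norm (xP i - q)) \<and>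
            (\<forall>q\<in>target_line l. \<exists>i\<in>K. \<alpha> * norm (xP i - q) \<le> norm (z - q))}"
    if "finite K" "K \<noteq> {}" for K
    unfolding free_barrier_def \<open>\<alpha> = vE / vP\<close>
    by (rule reach_avoid.game_barrier_eq[OF reach_avoid_free[OF l v that]])
  have a: "barrier \<Omega> vP vE {i1, i2} xP = barrier \<Omega> vP vE {i} xP"
    if i: "i \<in> {i1, i2}" and act: "{j \<in> {i1, i2}. active l {i1, i2} xP j} = {i}" for i
  proof -
    define j where "j = (if i = i1 then i2 else i1)"
    have ij: "{i1, i2} = {i, j}" "i \<noteq> j" using i assms(22) by (auto simp: j_def)
    have "\<not> active l {i, j} xP j" using act ij by auto
    moreover have "{i, j} - {j} = {i}" using ij(2) by auto
    \<comment> \<open>In a coalition of two, the partner of an inactive pursuer is at least as near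
      everywhere on the target line, so it alone decides both conditions.\<close>
    ultimately have "\<forall>q\<in>target_line l. norm (xP i - q) \<le> norm (xP j - q)"
      by (simp add: active_def not_less)
    then have near: "\<forall>q\<in>target_line l. \<alpha> * norm (xP i - q) \<le> \<alpha> * norm (xP j - q)"
      using assms(13) by simp
    have "barrier \<Omega> vP vE {i, j} xP = barrier \<Omega> vP vE {i} xP"
    proof (subst (1 2) dom)
      show "{z \<in> play_region \<Omega>. (\<exists>q\<in>target_line l. \<forall>i\<in>{i, j}. norm (z - q) \<le> \<alpha> * norm (xP i - q)) \<and>
            (\<forall>q\<in>target_line l. \<exists>i\<in>{i, j}. \<alpha> * norm (xP i - q) \<le> norm (z - q))} =
        {z \<in> play_region \<Omega>. (\<exists>q\<in>target_line l. \<forall>i\<in>{i}. norm (z - q) \<le> \<alpha> * norm (xP i - q)) \<and>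
            (\<forall>q\<in>target_line l. \<exists>i\<in>{i}. \<alpha> * norm (xP i - q) \<le> norm (z - q))}"
        using near order_trans by (simp, blast)
    qed (use ij in auto)
    then show ?thesis using ij by simp
  qed
  have b: "barrier \<Omega> vP vE {i1, i2} xP = free_barrier l vP vE {i1, i2} xP \<inter> play_region \<Omega> \<and>
            free_barrier l vP vE {i1, i2} xP = (\<Union>s\<in>{1..5}. base_curve l \<alpha> s (xP i1) (xP i2))"
    if act: "active l {i1, i2} xP i1" "active l {i1, i2} xP i2" and lt: "xP i1 $ 1 < xP i2 $ 1"
  proof
    have "play_region \<Omega> \<subseteq> {z. z $ 2 < 0}" by (auto simp: play_region_def tar_region_def)
    \<comment> \<open>Both games impose the same condition on \<open>z\<close>; they differ only in
      the region of starting positions.\<close>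
    then show "barrier \<Omega> vP vE {i1, i2} xP = free_barrier l vP vE {i1, i2} xP \<inter> play_region \<Omega>"
      unfolding dom[OF subset_refl insert_not_empty] free[OF finite.insertI[OF finite.insertI[OF finite.emptyI]] insert_not_empty]
      by blast
    have diffs: "{i1, i2} - {i1} = {i2}" "{i1, i2} - {i2} = {i1}" using assms(22) by auto
    obtain c1 where c1: "c1 \<in> {0..l}" "norm (xP i1 - vector [c1, 0]) < norm (xP i2 - vector [c1, 0])"
      using act(1) unfolding active_def diffs target_line_axis[OF l] by auto
    obtain c2 where c2: "c2 \<in> {0..l}" "norm (xP i2 - vector [c2, 0]) < norm (xP i1 - vector [c2, 0])"
      using act(2) unfolding active_def diffs target_line_axis[OF l] by auto
    \<comment> \<open>Each pursuer is strictly nearer somewhere on the segment, which puts the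
      equidistant point strictly between the end points.\<close>
    have xc: "0 < x_c (xP i1) (xP i2)" "x_c (xP i1) (xP i2) < l"
      using c1 c2 unfolding closer_iff[OF lt] by auto
    show "free_barrier l vP vE {i1, i2} xP = (\<Union>s\<in>{1..5}. base_curve l \<alpha> s (xP i1) (xP i2))"
      unfolding base_curves_eq[OF assms(13,14) l lt xc]
        free[OF finite.insertI[OF finite.insertI[OF finite.emptyI]] insert_not_empty]
      by simp
  qed
  show ?thesis using a b by blast
qed

end
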